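(* Let $X$ be a compact triangulable topological space and $f:X\to\mathbb{R}^n$ a continuous function. For every $(\bar u,\bar v)\in D_n^+$ and every $\vec e\in\mathbb{R}^n$ with $\vec e\succ 0$, it holds that $$\beta_f(\bar u,\bar v)=\sum_{\substack{u\preceq\bar u,\ v\succ\bar v\\ \bar u-u,\ v-\bar v\in\langle\vec e\,\rangle}}\mu_f(u,v)+\sum_{\substack{u\preceq\bar u\\ \bar u-u\in\langle\vec e\,\rangle}}\mu_f(u,\infty),$$ where $\langle\vec e\,\rangle$ denotes the line in $\mathbb{R}^n$ spanned by $\vec e$.
   Context: For $u,v\in\mathbb{R}^n$, $u\preceq v$ (resp. $u\prec v$, $u\succeq v$, $u\succ v$) means $u_i\le v_i$ (resp. $u_i<v_i$, $u_i\ge v_i$, $u_i>v_i$) for all $i=1,\dots,n$. $D_n^+=\{(u,v)\in\mathbb{R}^n\times\mathbb{R}^n: u\prec v\}$ and $D_n^*=D_n^+\cup\{(u,\infty):u\in\mathbb{R}^n\}$. Fix a field $\mathbb{K}$ and a homology degree $k\in\mathbb{Z}$. $\check H_k$ is $k$th Čech homology with coefficients in $\mathbb{K}$. For $u\in\mathbb{R}^n$, $X\langle f\preceq u\rangle=\{x\in X:f(x)\preceq u\}$; for $u\preceq v$, $\iota_k^{u,v}:\check H_k(X\langle f\preceq u\rangle)\to\check H_k(X\langle f\preceq v\rangle)$ is the map induced by inclusion. The persistent Betti numbers function is $\beta_f:D_n^+\to\mathbb{N}$, $\beta_f(u,v)=\operatorname{rank}\iota_k^{u,v}$ (which is finite);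 the degree $k$ is omitted from the notation. Multiplicity of a proper point $(u,v)\in D_n^+$: $\mu_f(u,v)$ is the minimum, over all $\vec e\in\mathbb{R}^n$ with $\vec e\succ0$ and $u+\vec e\prec v-\vec e$, of $$\beta_f(u+\vec e,v-\vec e)-\beta_f(u-\vec e,v-\vec e)-\beta_f(u+\vec e,v+\vec e)+\beta_f(u-\vec e,v+\vec e).$$ Multiplicity of a point at infinity $(u,\infty)\in D_n^*$: $\mu_f(u,\infty)$ is the minimum, over all $\vec e\succ0$ and all $v\in\mathbb{R}^n$ with $u+\vec e\prec v$, of $\beta_f(u+\vec e,v)-\beta_f(u-\vec e,v)$. Both are finite non-negative integers. *)

theory Defs
  imports
    "HOL-Analysis.Analysis"
    "HOL-Library.Poly_Mapping"
    "Jordan_Normal_Form.Missing_VectorSpace"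
begin

subsection \<open>Simplicial homology of an abstract simplicial complex, with field coefficients\<close>

text \<open>
  An abstract simplicial complex is given by its set \<open>K\<close> of (finite, nonempty) simplices.
  Homology is computed from the ordered chain complex: the generators in degree \<open>k\<close> are the
  \<open>(k + 1)\<close>-tuples of vertices, repetitions allowed, whose entries span a simplex.
  The degree is an integer; in negative degrees every chain is zero, because the empty tuple
  does not span a simplex.
\<close>

definition coeff_field :: "'k::field ring" where
  "coeff_field = \<lparr>carrier = UNIV, monoid.mult = (*), one = 1, zero = 0, add = (+)\<rparr>"

definition scale_chain :: "'k::field \<Rightarrow> ('v list \<Rightarrow>\<^sub>0 'k) \<Rightarrow> ('v list \<Rightarrow>\<^sub>0 'k)" where
  "scale_chain a = Poly_Mapping.map ((*) a)"

definition simplicial_chains :: "'v set set \<Rightarrow> int \<Rightarrow> ('v list \<Rightarrow>\<^sub>0 'k::field) set" where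
  "simplicial_chains K k = {c. \<forall>\<sigma>\<in>Poly_Mapping.keys c. set \<sigma> \<in> K \<and> int (length \<sigma>) = k + 1}"

text \<open>Vertices (one-element tuples) have boundary zero: the homology is not reduced.\<close>

definition boundary_simplex :: "'v list \<Rightarrow> ('v list \<Rightarrow>\<^sub>0 'k::field)" where
  "boundary_simplex \<sigma> =
     (if length \<sigma> \<le> 1 then 0
      else \<Sum>i<length \<sigma>. Poly_Mapping.single (take i \<sigma> @ drop (Suc i) \<sigma>) ((-1) ^ i))"

definition boundary :: "('v list \<Rightarrow>\<^sub>0 'k::field) \<Rightarrow> ('v list \<Rightarrow>\<^sub>0 'k)" where
  "boundary c =
     (\<Sum>\<sigma>\<in>Poly_Mapping.keys c. scale_chain (Poly_Mapping.lookup c \<sigma>) (boundary_simplex \<sigma>))"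

definition cycles :: "'v set set \<Rightarrow> int \<Rightarrow> ('v list \<Rightarrow>\<^sub>0 'k::field) set" where
  "cycles K k = {c \<in> simplicial_chains K k. boundary c = 0}"

definition boundaries :: "'v set set \<Rightarrow> int \<Rightarrow> ('v list \<Rightarrow>\<^sub>0 'k::field) set" where
  "boundaries K k = boundary ` simplicial_chains K (k + 1)"

text \<open>
  The vector space \<open>cycles K k / boundaries K k\<close>, whose elements are cosets. The product and
  unit that the record type \<open>module\<close> inherits from rings play no role for vector spaces.
\<close>

definition simplicial_homology ::
    "int \<Rightarrow> 'v set set \<Rightarrow> ('k::field, ('v list \<Rightarrow>\<^sub>0 'k) set) module" where
  "simplicial_homology k K =
     \<lparr>carrier = {{z + b | b. b \<in> boundaries K k} | z. z \<in> cycles K k},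
      monoid.mult = undefined, one = undefined,
      zero = boundaries K k,
      add = (\<lambda>x y. {c + d | c d. c \<in> x \<and> d \<in> y}),
      smult = (\<lambda>a x. {scale_chain a c + b | c b. c \<in> x \<and> b \<in> boundaries K k})\<rparr>"

definition push_chain :: "('v \<Rightarrow> 'w) \<Rightarrow> ('v list \<Rightarrow>\<^sub>0 'k::field) \<Rightarrow> ('w list \<Rightarrow>\<^sub>0 'k)" where
  "push_chain p c =
     (\<Sum>\<sigma>\<in>Poly_Mapping.keys c. Poly_Mapping.single (map p \<sigma>) (Poly_Mapping.lookup c \<sigma>))"

text \<open>
  The map on homology induced by a simplicial map \<open>p\<close> into the complex \<open>L\<close>: the class of \<open>z\<close> is
  sent to the class of \<open>push_chain p z\<close>.
\<close>

definition simplicial_induced ::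
    "int \<Rightarrow> 'w set set \<Rightarrow> ('v \<Rightarrow> 'w) \<Rightarrow> ('v list \<Rightarrow>\<^sub>0 'k::field) set \<Rightarrow> ('w list \<Rightarrow>\<^sub>0 'k) set" where
  "simplicial_induced k L p x = {push_chain p c + b | c b. c \<in> x \<and> b \<in> boundaries L k}"


subsection \<open>Cech homology\<close>

definition open_covers :: "'a topology \<Rightarrow> 'a set set set" where
  "open_covers A = {\<U>. (\<forall>U\<in>\<U>. openin A U) \<and> \<Union>\<U> = topspace A}"

definition nerve :: "'a set set \<Rightarrow> 'a set set set" where
  "nerve \<U> = {S. S \<subseteq> \<U> \<and> finite S \<and> S \<noteq> {} \<and> \<Inter>S \<noteq> {}}"

definition refinement_map :: "'a set set \<Rightarrow> 'a set set \<Rightarrow> ('a set \<Rightarrow> 'a set) \<Rightarrow> bool" where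
  "refinement_map \<U> \<V> p \<longleftrightarrow> (\<forall>U\<in>\<U>. p U \<in> \<V> \<and> U \<subseteq> p U)"

text \<open>
  The inverse limit, over all open covers ordered by refinement, of the homology of the nerves,
  with pointwise operations. Any two refinement maps between the same covers are contiguous and so
  induce the same map on homology; the compatibility condition may therefore range over all of them.
\<close>

definition cech_homology ::
    "int \<Rightarrow> 'a topology \<Rightarrow> ('k::field, 'a set set \<Rightarrow> ('a set list \<Rightarrow>\<^sub>0 'k) set) module" where
  "cech_homology k A =
     \<lparr>carrier =
        {c \<in> \<Pi>\<^sub>E \<U>\<in>open_covers A. carrier (simplicial_homology k (nerve \<U>)).
          \<forall>\<U>\<in>open_covers A. \<forall>\<V>\<in>open_covers A. \<forall>p.
            refinement_map \<U> \<V> p \<longrightarrow> simplicial_induced k (nerve \<V>) p (c \<U>) = c \<V>},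
      monoid.mult = undefined, one = undefined,
      zero = (\<lambda>\<U>\<in>open_covers A. \<zero>\<^bsub>simplicial_homology k (nerve \<U>)\<^esub>),
      add = (\<lambda>c d. \<lambda>\<U>\<in>open_covers A. c \<U> \<oplus>\<^bsub>simplicial_homology k (nerve \<U>)\<^esub> d \<U>),
      smult = (\<lambda>a c. \<lambda>\<U>\<in>open_covers A. a \<odot>\<^bsub>simplicial_homology k (nerve \<U>)\<^esub> c \<U>)\<rparr>"

text \<open>
  The map induced by the inclusion of a subspace \<open>A\<close> of \<open>B\<close>. An open cover \<open>\<V>\<close> of \<open>B\<close> restricts to
  the open cover \<open>{V \<inter> A | V \<in> \<V>}\<close> of \<open>A\<close>, and its nerve maps to the nerve of \<open>\<V>\<close> by choosing for each
  \<open>V \<inter> A\<close> a member of \<open>\<V>\<close> containing it; on homology the choice is immaterial, by contiguity.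
\<close>

definition restrict_cover :: "'a topology \<Rightarrow> 'a set set \<Rightarrow> 'a set set" where
  "restrict_cover A \<V> = (\<lambda>V. V \<inter> topspace A) ` \<V>"

definition cech_inclusion ::
    "int \<Rightarrow> 'a topology \<Rightarrow> 'a topology \<Rightarrow> ('a set set \<Rightarrow> ('a set list \<Rightarrow>\<^sub>0 'k::field) set)
      \<Rightarrow> ('a set set \<Rightarrow> ('a set list \<Rightarrow>\<^sub>0 'k) set)" where
  "cech_inclusion k A B c =
     (\<lambda>\<V>\<in>open_covers B.
        simplicial_induced k (nerve \<V>)
          (SOME p. refinement_map (restrict_cover A \<V>) \<V> p) (c (restrict_cover A \<V>)))"


subsection \<open>Persistent Betti numbers and multiplicities\<close>

text \<open>
  The non-strict order on \<open>\<real>\<^sup>n\<close> is the library order \<open>\<le>\<close> on \<open>real ^ 'n\<close>, which is componentwise.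
  The library's strict order \<open><\<close> is not componentwise, hence the following relation.
\<close>

definition vec_less :: "real ^ 'n \<Rightarrow> real ^ 'n \<Rightarrow> bool" (infix \<open>\<prec>\<^sub>n\<close> 50) where
  "u \<prec>\<^sub>n v \<longleftrightarrow> (\<forall>i. u $ i < v $ i)"

definition sublevel :: "'a topology \<Rightarrow> ('a \<Rightarrow> real ^ 'n) \<Rightarrow> real ^ 'n \<Rightarrow> 'a topology" where
  "sublevel X f u = subtopology X {x \<in> topspace X. f x \<le> u}"

text \<open>The rank of a linear map is the dimension of its image. The type argument fixes the field.\<close>

definition betti ::
    "'k::field itself \<Rightarrow> int \<Rightarrow> 'a topology \<Rightarrow> ('a \<Rightarrow> real ^ 'n) \<Rightarrow> real ^ 'n \<Rightarrow> real ^ 'n \<Rightarrow> nat" where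
  "betti _ k X f u v =
     vectorspace.dim (coeff_field :: 'k ring)
       ((cech_homology k (sublevel X f v))
          \<lparr>carrier := cech_inclusion k (sublevel X f u) (sublevel X f v)
             ` carrier (cech_homology k (sublevel X f u))\<rparr>)"

definition mult_proper ::
    "'k::field itself \<Rightarrow> int \<Rightarrow> 'a topology \<Rightarrow> ('a \<Rightarrow> real ^ 'n) \<Rightarrow> real ^ 'n \<Rightarrow> real ^ 'n \<Rightarrow> int" where
  "mult_proper F k X f u v =
     (LEAST m. \<exists>e. 0 \<prec>\<^sub>n e \<and> u + e \<prec>\<^sub>n v - e \<and>
        m = int (betti F k X f (u + e) (v - e)) - int (betti F k X f (u - e) (v - e))
          - int (betti F k X f (u + e) (v + e)) + int (betti F k X f (u - e) (v + e)))"

definition mult_infinity ::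
    "'k::field itself \<Rightarrow> int \<Rightarrow> 'a topology \<Rightarrow> ('a \<Rightarrow> real ^ 'n) \<Rightarrow> real ^ 'n \<Rightarrow> int" where
  "mult_infinity F k X f u =
     (LEAST m. \<exists>e v. 0 \<prec>\<^sub>n e \<and> u + e \<prec>\<^sub>n v \<and>
        m = int (betti F k X f (u + e) v) - int (betti F k X f (u - e) v))"

end

theory Submission
  imports Defs
begin

text \<open>
  Restricted to the plane through \<open>(u', v')\<close> spanned by \<open>(e, 0)\<close> and \<open>(0, e)\<close>, the persistent Betti
  numbers become a function \<open>b s t\<close> of two real variables. The multiplicities can be computed from \<open>b\<close>
  alone, since a small multiple of \<open>e\<close> lies below any given positive vector and the differences that
  are minimized shrink with the rectangle. A monotone integer-valued function is the sum of its
  jumps; applied in each variable, this yields the formula over a quadrant whose boundary carries no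
  jumps, and the given quadrant can be moved to such a position because \<open>b\<close> is continuous from the
  right in both variables.

  This rests on three properties of Cech homology. The ranks are finite: if \<open>u \<prec>\<^sub>n v\<close>, the
  sublevel set of \<open>v\<close> contains a collar of that of \<open>u\<close>, and as the polyhedron is a neighbourhood
  retract, a cycle of small mesh that bounds at a fixed scale also bounds, after subdivision and
  retraction, at every smaller scale in the larger set; the inclusion then factors through the nerve
  of one finite cover. The second differences are nonnegative by rank-nullity. Right-continuity is
  continuity of Cech homology along a decreasing sequence of sublevel sets; in \<open>u\<close> it needs in
  addition that the images stabilize (Mittag-Leffler), which they do because the ranks are finite.
\<close>


subsection \<open>Ordered chains\<close>

text \<open>A single sublevel set can be wild and its Cech homology infinite-dimensional. Only a map
  between sublevel sets with \<open>u \<prec>\<^sub>n v\<close> is known to have finite rank, so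
  every dimension count happens inside the image of such a map, and \<open>b s t\<close> is usable
  only for s < t + \<delta>. For fixed t the function of s therefore lives on a half-line; it is
  frozen at a small \<eta> > 0 to make it monotone on the whole line. The freezing leaves the jumps
  at s \<le> 0 alone and creates none at s > 0, because \<open>b\<close> is constant on [0, \<eta>]
  for all t from a positive bound on, with one common \<eta>: the increment in s decreases with t.

  Inverse limits do not preserve surjectivity. This makes right-continuity in \<open>u\<close>
  harder than in \<open>v\<close>: in \<open>v\<close> a kernel has to vanish, in \<open>u\<close> a
  class has to be lifted.

  Comparisons between spaces are made on nerves. A map of points that carries cover members into
  cover members takes a common point of a simplex to a common point of its image, and this already
  yields a simplicial map that is unique up to contiguity.\<close>

lemma lookup_scale_chain [simp]:
  "Poly_Mapping.lookup (scale_chain a c) k = a * Poly_Mapping.lookup c k"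
  by (simp add: scale_chain_def Poly_Mapping.map.rep_eq when_def)

lemma scale_chain_simps [simp]:
  "scale_chain a 0 = 0" "scale_chain 0 c = 0" "scale_chain 1 c = c"
  "scale_chain a (scale_chain b c) = scale_chain (a * b) c"
  "scale_chain a (Poly_Mapping.single \<sigma> b) = Poly_Mapping.single \<sigma> (a * b)"
  by (rule poly_mapping_eqI; simp add: lookup_single when_def)+

lemma scale_chain_algebra:
  "scale_chain a (c + d) = scale_chain a c + scale_chain a d"
  "scale_chain (a + b) c = scale_chain a c + scale_chain b c"
  "scale_chain a (- c) = - scale_chain a c"
  "scale_chain (- a) c = - scale_chain a c"
  "scale_chain a (c - d) = scale_chain a c - scale_chain a d"
  by (rule poly_mapping_eqI; simp add: lookup_add lookup_minus algebra_simps)+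

lemma scale_chain_sum: "scale_chain a (sum f I) = (\<Sum>i\<in>I. scale_chain a (f i))"
  by (induction I rule: infinite_finite_induct) (auto simp: scale_chain_algebra)

lemma keys_scale_chain: "Poly_Mapping.keys (scale_chain a c) \<subseteq> Poly_Mapping.keys c"
  by (auto simp: in_keys_iff)

definition chain_linear :: "(('v list \<Rightarrow>\<^sub>0 'k::field) \<Rightarrow> ('w list \<Rightarrow>\<^sub>0 'k)) \<Rightarrow> bool" where
  "chain_linear f \<longleftrightarrow>
     (\<forall>c d. f (c + d) = f c + f d) \<and> (\<forall>a c. f (scale_chain a c) = scale_chain a (f c))"

lemma chain_linearD:
  assumes "chain_linear f"
  shows "f (c + d) = f c + f d" "f (scale_chain a c) = scale_chain a (f c)"
    "f 0 = 0" "f (- c) = - f c" "f (c - d) = f c - f d"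
proof -
  show add: "f (c + d) = f c + f d" for c d
    using assms by (simp add: chain_linear_def)
  show "f (scale_chain a c) = scale_chain a (f c)"
    using assms by (simp add: chain_linear_def)
  show zero: "f 0 = 0"
    using add[of 0 0] by simp
  show neg: "f (- c) = - f c" for c
    using add[of "- c" c] zero by (simp add: eq_neg_iff_add_eq_0)
  show "f (c - d) = f c - f d"
    using add[of c "- d"] neg by simp
qed

lemma chain_linear_sum:
  assumes "chain_linear f"
  shows "f (sum g I) = (\<Sum>i\<in>I. f (g i))"
  by (induction I rule: infinite_finite_induct) (auto simp: chain_linearD[OF assms])

lemma chain_expand:
  "c = (\<Sum>\<sigma>\<in>Poly_Mapping.keys c. Poly_Mapping.single \<sigma> (Poly_Mapping.lookup c \<sigma>))"
proof (rule poly_mapping_eqI)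
  fix k
  show "Poly_Mapping.lookup c k =
    Poly_Mapping.lookup (\<Sum>\<sigma>\<in>Poly_Mapping.keys c. Poly_Mapping.single \<sigma> (Poly_Mapping.lookup c \<sigma>)) k"
    by (cases "k \<in> Poly_Mapping.keys c")
      (auto simp: lookup_sum lookup_single when_def sum.If_cases in_keys_iff sum.delta')
qed

text \<open>Only tuples that occur in \<open>c\<close> have to be compared. Inductions on the length
  of a tuple rely on this: they apply the rule to a boundary, whose tuples are shorter.\<close>

lemma chain_linear_eqI:
  assumes f: "chain_linear f" and g: "chain_linear g"
    and eq: "\<And>\<sigma>. \<sigma> \<in> Poly_Mapping.keys c \<Longrightarrow>
      f (Poly_Mapping.single \<sigma> 1) = g (Poly_Mapping.single \<sigma> 1)"
  shows "f c = g c"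
proof -
  have 1: "h (Poly_Mapping.single \<sigma> a) = scale_chain a (h (Poly_Mapping.single \<sigma> 1))"
    if "chain_linear h" for h :: "('a list \<Rightarrow>\<^sub>0 'b) \<Rightarrow> ('c list \<Rightarrow>\<^sub>0 'b)" and \<sigma> a
    using chain_linearD(2)[OF that, of a "Poly_Mapping.single \<sigma> 1"] by simp
  have "h c = (\<Sum>\<sigma>\<in>Poly_Mapping.keys c. scale_chain (Poly_Mapping.lookup c \<sigma>) (h (Poly_Mapping.single \<sigma> 1)))"
    if h: "chain_linear h" for h :: "('a list \<Rightarrow>\<^sub>0 'b) \<Rightarrow> ('c list \<Rightarrow>\<^sub>0 'b)"
    using arg_cong[OF chain_expand[of c], of h] by (simp add: chain_linear_sum[OF h] flip: 1[OF h])
  from this[OF f] this[OF g] show ?thesis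
    by (simp add: eq)
qed

lemma chain_linear_comp: "chain_linear f \<Longrightarrow> chain_linear g \<Longrightarrow> chain_linear (\<lambda>c. f (g c))"
  by (auto simp: chain_linear_def)

lemma chain_linear_add: "chain_linear f \<Longrightarrow> chain_linear g \<Longrightarrow> chain_linear (\<lambda>c. f c + g c)"
  and chain_linear_diff: "chain_linear f \<Longrightarrow> chain_linear g \<Longrightarrow> chain_linear (\<lambda>c. f c - g c)"
  and chain_linear_id: "chain_linear (\<lambda>c. c)"
  by (auto simp: chain_linear_def scale_chain_algebra)

definition chain_ext :: "('v list \<Rightarrow> ('w list \<Rightarrow>\<^sub>0 'k::field)) \<Rightarrow> ('v list \<Rightarrow>\<^sub>0 'k) \<Rightarrow> ('w list \<Rightarrow>\<^sub>0 'k)" where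
  "chain_ext f c = (\<Sum>\<sigma>\<in>Poly_Mapping.keys c. scale_chain (Poly_Mapping.lookup c \<sigma>) (f \<sigma>))"

lemma chain_ext_superset:
  assumes "finite S" "Poly_Mapping.keys c \<subseteq> S"
  shows "chain_ext f c = (\<Sum>\<sigma>\<in>S. scale_chain (Poly_Mapping.lookup c \<sigma>) (f \<sigma>))"
  unfolding chain_ext_def using assms by (intro sum.mono_neutral_left) (auto simp: in_keys_iff)

lemma chain_linear_ext: "chain_linear (chain_ext f)"
  unfolding chain_linear_def
proof (intro conjI allI)
  fix c d :: "'a list \<Rightarrow>\<^sub>0 'b" and a
  let ?S = "Poly_Mapping.keys c \<union> Poly_Mapping.keys d"
  show "chain_ext f (c + d) = chain_ext f c + chain_ext f d"
    using Poly_Mapping.keys_add[of c d]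
    by (simp add: chain_ext_superset[where S = ?S] lookup_add scale_chain_algebra sum.distrib)
  show "chain_ext f (scale_chain a c) = scale_chain a (chain_ext f c)"
    using keys_scale_chain[of a c]
    by (simp add: chain_ext_superset[where S = "Poly_Mapping.keys c"] scale_chain_sum)
qed

lemma chain_ext_single [simp]: "chain_ext f (Poly_Mapping.single \<sigma> a) = scale_chain a (f \<sigma>)"
  by (simp add: chain_ext_superset[where S = "{\<sigma>}"])

lemma keys_chain_ext: "Poly_Mapping.keys (chain_ext f c) \<subseteq> (\<Union>\<sigma>\<in>Poly_Mapping.keys c. Poly_Mapping.keys (f \<sigma>))"
proof -
  have "Poly_Mapping.keys (chain_ext f c)
      \<subseteq> (\<Union>\<sigma>\<in>Poly_Mapping.keys c. Poly_Mapping.keys (scale_chain (Poly_Mapping.lookup c \<sigma>) (f \<sigma>)))"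
    unfolding chain_ext_def by (rule Poly_Mapping.keys_sum)
  also have "\<dots> \<subseteq> (\<Union>\<sigma>\<in>Poly_Mapping.keys c. Poly_Mapping.keys (f \<sigma>))"
    by (intro UN_mono order_refl keys_scale_chain)
  finally show ?thesis .
qed

lemma boundary_eq_chain_ext: "boundary = chain_ext boundary_simplex"
  by (rule ext) (simp add: boundary_def chain_ext_def)

lemma push_chain_eq_chain_ext:
  "push_chain p = chain_ext (\<lambda>\<sigma>. Poly_Mapping.single (map p \<sigma>) 1)"
  by (rule ext) (simp add: push_chain_def chain_ext_def)

lemma boundary_linear: "chain_linear boundary"
  by (simp add: boundary_eq_chain_ext chain_linear_ext)

lemma push_chain_linear: "chain_linear (push_chain p)"
  by (simp add: push_chain_eq_chain_ext chain_linear_ext)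

lemma push_chain_single [simp]:
  "push_chain p (Poly_Mapping.single \<sigma> a) = Poly_Mapping.single (map p \<sigma>) a"
  by (simp add: push_chain_eq_chain_ext)

lemma keys_push_chain: "Poly_Mapping.keys (push_chain p c) \<subseteq> map p ` Poly_Mapping.keys c"
  unfolding push_chain_eq_chain_ext by (rule order_trans[OF keys_chain_ext]) auto

lemma push_chain_comp: "push_chain q (push_chain p c) = push_chain (q \<circ> p) c"
proof (rule chain_linear_eqI[where f = "\<lambda>c. push_chain q (push_chain p c)"])
  show "chain_linear (\<lambda>c. push_chain q (push_chain p c))"
    by (rule chain_linear_comp[OF push_chain_linear push_chain_linear])
qed (simp_all add: push_chain_linear comp_def)

lemma push_chain_cong:
  "(\<And>\<sigma> x. \<sigma> \<in> Poly_Mapping.keys c \<Longrightarrow> x \<in> set \<sigma> \<Longrightarrow> p x = q x) \<Longrightarrow> push_chain p c = push_chain q c"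
  unfolding push_chain_def by (intro sum.cong refl arg_cong2[where f = Poly_Mapping.single]) auto

lemma push_chain_id: "push_chain (\<lambda>x. x) c = c"
  by (rule chain_linear_eqI[OF push_chain_linear chain_linear_id]) simp

section \<open>Cones and the augmented boundary\<close>

definition cone_chain :: "'v \<Rightarrow> ('v list \<Rightarrow>\<^sub>0 'k::field) \<Rightarrow> ('v list \<Rightarrow>\<^sub>0 'k)" where
  "cone_chain x = chain_ext (\<lambda>\<sigma>. Poly_Mapping.single (x # \<sigma>) 1)"

lemma cone_linear: "chain_linear (cone_chain x)"
  by (simp add: cone_chain_def chain_linear_ext)

lemma cone_single [simp]: "cone_chain x (Poly_Mapping.single \<sigma> a) = Poly_Mapping.single (x # \<sigma>) a"
  by (simp add: cone_chain_def)

lemma keys_cone: "Poly_Mapping.keys (cone_chain x c) \<subseteq> (#) x ` Poly_Mapping.keys c"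
  unfolding cone_chain_def by (rule order_trans[OF keys_chain_ext]) auto

text \<open>The augmented boundary, for which the empty tuple is a simplex of degree \<open>-1\<close>, obeys the
  cone recursion in every degree.\<close>

fun aug_boundary_simplex :: "'v list \<Rightarrow> ('v list \<Rightarrow>\<^sub>0 'k::field)" where
  "aug_boundary_simplex [] = 0"
| "aug_boundary_simplex (x # \<sigma>) = Poly_Mapping.single \<sigma> 1 - cone_chain x (aug_boundary_simplex \<sigma>)"

definition aug_boundary :: "('v list \<Rightarrow>\<^sub>0 'k::field) \<Rightarrow> ('v list \<Rightarrow>\<^sub>0 'k)" where
  "aug_boundary = chain_ext aug_boundary_simplex"

lemma aug_boundary_linear: "chain_linear aug_boundary"
  by (simp add: aug_boundary_def chain_linear_ext)

lemma aug_boundary_single [simp]: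
  "aug_boundary (Poly_Mapping.single \<sigma> a) = scale_chain a (aug_boundary_simplex \<sigma>)"
  by (simp add: aug_boundary_def)

lemmas chain_lin_simps =
  chain_linearD[OF boundary_linear] chain_linearD[OF push_chain_linear]
  chain_linearD[OF cone_linear] chain_linearD[OF aug_boundary_linear]

lemma aug_boundary_simplex_eq_sum:
  "aug_boundary_simplex \<sigma> =
     (\<Sum>i<length \<sigma>. Poly_Mapping.single (take i \<sigma> @ drop (Suc i) \<sigma>) ((-1) ^ i))"
proof (induction \<sigma>)
  case (Cons x \<sigma>)
  show ?case
    by (simp add: Cons sum.lessThan_Suc_shift chain_linear_sum[OF cone_linear] single_uminus sum_negf
        del: sum.lessThan_Suc)
qed simp

lemma single_chain_sum: "Poly_Mapping.single k (sum f I) = (\<Sum>i\<in>I. Poly_Mapping.single k (f i))"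
  by (induction I rule: infinite_finite_induct) (simp_all add: single_add)

text \<open>The difference comes from one-element tuples, whose augmented boundary is the empty
  tuple. The scalar is the augmentation of \<open>c\<close>; later it only matters that the
  difference is a multiple of the empty tuple.\<close>

lemma aug_boundary_eq_boundary:
  fixes c :: "'v list \<Rightarrow>\<^sub>0 'k::field"
  shows "\<exists>a. aug_boundary c = boundary c + Poly_Mapping.single [] a"
proof -
  have simplex: "\<exists>a. aug_boundary_simplex \<sigma> = boundary_simplex \<sigma> + Poly_Mapping.single [] a" for \<sigma> :: "'v list"
  proof (cases "length \<sigma> \<le> 1")
    case True
    then consider "\<sigma> = []" | x where "\<sigma> = [x]"
      by (cases \<sigma>) auto
    then show ?thesis
    proof cases
      case 1
      then show ?thesis by (auto simp: boundary_simplex_def intro: exI[of _ 0])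
    next
      case 2
      then show ?thesis by (auto simp: boundary_simplex_def chain_lin_simps intro: exI[of _ 1])
    qed
  qed (auto simp: aug_boundary_simplex_eq_sum boundary_simplex_def intro: exI[of _ 0])
  then obtain a :: "'v list \<Rightarrow> 'k" where a:
    "\<And>\<sigma>. aug_boundary_simplex \<sigma> = boundary_simplex \<sigma> + Poly_Mapping.single [] (a \<sigma>)"
    by metis
  show ?thesis
  proof
    show "aug_boundary c = boundary c + Poly_Mapping.single [] (\<Sum>\<sigma>\<in>Poly_Mapping.keys c. Poly_Mapping.lookup c \<sigma> * a \<sigma>)"
      by (simp add: aug_boundary_def boundary_eq_chain_ext chain_ext_def a scale_chain_algebra sum.distrib
          single_chain_sum)
  qed
qed

text \<open>Coning contracts the augmented complex: it is a chain homotopy between the identity and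
  zero. On tuples this is the defining recursion.\<close>

lemma aug_boundary_cone: "aug_boundary (cone_chain x c) = c - cone_chain x (aug_boundary c)"
proof (rule chain_linear_eqI[where f = "\<lambda>c. aug_boundary (cone_chain x c)"])
  show "chain_linear (\<lambda>c. aug_boundary (cone_chain x c))"
    by (rule chain_linear_comp[OF aug_boundary_linear cone_linear])
  show "chain_linear (\<lambda>c. c - cone_chain x (aug_boundary c))"
    by (rule chain_linear_diff[OF chain_linear_id chain_linear_comp[OF cone_linear aug_boundary_linear]])
qed simp

lemma aug_boundary_aug_boundary [simp]: "aug_boundary (aug_boundary c) = 0"
proof -
  have simplex: "aug_boundary (aug_boundary_simplex \<sigma>) = 0" for \<sigma> :: "'a list"
    by (induction \<sigma>) (simp_all add: chain_lin_simps aug_boundary_cone)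
  have "aug_boundary (aug_boundary c) = (\<lambda>c. scale_chain 0 c) c"
    by (rule chain_linear_eqI[OF chain_linear_comp[OF aug_boundary_linear aug_boundary_linear]])
      (auto simp: chain_linear_def simplex)
  then show ?thesis by simp
qed

lemma keys_aug_boundary_simplex:
  "\<tau> \<in> Poly_Mapping.keys (aug_boundary_simplex \<sigma> :: 'v list \<Rightarrow>\<^sub>0 'k::field) \<Longrightarrow>
     set \<tau> \<subseteq> set \<sigma> \<and> length \<sigma> = Suc (length \<tau>)"
proof (induction \<sigma> arbitrary: \<tau>)
  case (Cons x \<sigma>)
  then consider "\<tau> \<in> Poly_Mapping.keys (Poly_Mapping.single \<sigma> (1::'k))"
    | "\<tau> \<in> Poly_Mapping.keys (cone_chain x (aug_boundary_simplex \<sigma>) :: 'v list \<Rightarrow>\<^sub>0 'k)"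
    using Poly_Mapping.keys_diff[of "Poly_Mapping.single \<sigma> (1::'k)" "cone_chain x (aug_boundary_simplex \<sigma>)"]
    by auto
  then show ?case
  proof cases
    case 2
    then obtain \<rho> where "\<rho> \<in> Poly_Mapping.keys (aug_boundary_simplex \<sigma> :: 'v list \<Rightarrow>\<^sub>0 'k)" "\<tau> = x # \<rho>"
      using keys_cone[of x "aug_boundary_simplex \<sigma> :: 'v list \<Rightarrow>\<^sub>0 'k"] by auto
    with Cons.IH[of \<rho>] show ?thesis by auto
  qed auto
qed simp


subsection \<open>Contiguous simplicial maps\<close>

definition asc :: "'v set set \<Rightarrow> bool" where
  "asc K \<longleftrightarrow> {} \<notin> K \<and> (\<forall>S\<in>K. \<forall>S'\<subseteq>S. S' \<noteq> {} \<longrightarrow> S' \<in> K)"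

definition simplicial_map :: "'v set set \<Rightarrow> 'w set set \<Rightarrow> ('v \<Rightarrow> 'w) \<Rightarrow> bool" where
  "simplicial_map K L p \<longleftrightarrow> (\<forall>S\<in>K. p ` S \<in> L)"

definition contiguous :: "'v set set \<Rightarrow> 'w set set \<Rightarrow> ('v \<Rightarrow> 'w) \<Rightarrow> ('v \<Rightarrow> 'w) \<Rightarrow> bool" where
  "contiguous K L p q \<longleftrightarrow> (\<forall>S\<in>K. p ` S \<union> q ` S \<in> L)"

lemma simplicial_chainsD:
  "c \<in> simplicial_chains K k \<Longrightarrow> \<sigma> \<in> Poly_Mapping.keys c \<Longrightarrow> set \<sigma> \<in> K"
  "c \<in> simplicial_chains K k \<Longrightarrow> \<sigma> \<in> Poly_Mapping.keys c \<Longrightarrow> int (length \<sigma>) = k + 1"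
  by (auto simp: simplicial_chains_def)

lemma simplicial_chains_subspace:
  "0 \<in> simplicial_chains K k"
  "c \<in> simplicial_chains K k \<Longrightarrow> d \<in> simplicial_chains K k \<Longrightarrow> c + d \<in> simplicial_chains K k"
  "c \<in> simplicial_chains K k \<Longrightarrow> scale_chain a c \<in> simplicial_chains K k"
  using Poly_Mapping.keys_add[of c d] keys_scale_chain[of a c]
  by (auto simp: simplicial_chains_def subset_eq)

lemma push_chain_in_simplicial_chains:
  assumes "simplicial_map K L p" "c \<in> simplicial_chains K k"
  shows "push_chain p c \<in> simplicial_chains L k"
  unfolding simplicial_chains_def
proof (safe del: iffI)
  fix \<tau> assume "\<tau> \<in> Poly_Mapping.keys (push_chain p c)"
  then obtain \<sigma> where "\<sigma> \<in> Poly_Mapping.keys c" "\<tau> = map p \<sigma>"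
    using keys_push_chain[of p c] by auto
  then show "set \<tau> \<in> L" "int (length \<tau>) = k + 1"
    using assms simplicial_chainsD[OF assms(2)] by (auto simp: simplicial_map_def)
qed

lemma aug_boundary_push_chain:
  fixes c :: "'a list \<Rightarrow>\<^sub>0 'c::field"
  shows "aug_boundary (push_chain p c) = push_chain p (aug_boundary c)"
proof -
  have cone_chain: "push_chain p (cone_chain x c) = cone_chain (p x) (push_chain p c)" for x :: 'a and c :: "'a list \<Rightarrow>\<^sub>0 'c"
    by (rule chain_linear_eqI[where f = "\<lambda>c. push_chain p (cone_chain x c)",
        OF chain_linear_comp[OF push_chain_linear cone_linear]
          chain_linear_comp[OF cone_linear push_chain_linear]]) simp
  have simplex: "aug_boundary_simplex (map p \<sigma>) = push_chain p (aug_boundary_simplex \<sigma> :: 'a list \<Rightarrow>\<^sub>0 'c)" for \<sigma>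
    by (induction \<sigma>) (simp_all add: chain_lin_simps cone_chain)
  show ?thesis
    by (rule chain_linear_eqI[where f = "\<lambda>c. aug_boundary (push_chain p c)",
        OF chain_linear_comp[OF aug_boundary_linear push_chain_linear]
          chain_linear_comp[OF push_chain_linear aug_boundary_linear]]) (simp add: simplex)
qed

lemma boundary_push_chain:
  fixes c :: "'a list \<Rightarrow>\<^sub>0 'c::field"
  shows "boundary (push_chain p c) = push_chain p (boundary c)"
proof -
  have simplex: "push_chain p (boundary_simplex \<sigma>) = (boundary_simplex (map p \<sigma>) :: 'b list \<Rightarrow>\<^sub>0 'c)" for \<sigma>
    by (auto simp: boundary_simplex_def chain_lin_simps chain_linear_sum[OF push_chain_linear]
        take_map drop_map)
  show ?thesis
    by (rule chain_linear_eqI[where f = "\<lambda>c. boundary (push_chain p c)",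
        OF chain_linear_comp[OF boundary_linear push_chain_linear]
          chain_linear_comp[OF push_chain_linear boundary_linear]])
      (simp add: boundary_eq_chain_ext simplex)
qed

lemma boundary_eq_aug_boundary:
  assumes "\<And>\<sigma>. \<sigma> \<in> Poly_Mapping.keys c \<Longrightarrow> 2 \<le> length \<sigma>"
  shows "boundary c = aug_boundary c"
proof (rule chain_linear_eqI[OF boundary_linear aug_boundary_linear])
  fix \<sigma> assume "\<sigma> \<in> Poly_Mapping.keys c"
  then have "\<not> length \<sigma> \<le> 1" using assms by fastforce
  then show "boundary (Poly_Mapping.single \<sigma> 1) = aug_boundary (Poly_Mapping.single \<sigma> 1)"
    by (simp add: boundary_eq_chain_ext boundary_simplex_def aug_boundary_simplex_eq_sum)
qed

text \<open>A chain homotopy for the augmented boundary gives one for the boundary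
  as soon as it kills the empty tuple.\<close>

lemma homotopic_cycles:
  assumes z: "boundary z = 0" and lin: "chain_linear P" and nil: "P (Poly_Mapping.single [] 1) = 0"
    and homotopy: "aug_boundary (P z) + P (aug_boundary z) = q - p"
    and len: "\<And>\<sigma>. \<sigma> \<in> Poly_Mapping.keys (P z) \<Longrightarrow> 2 \<le> length \<sigma>"
  shows "boundary (P z) = q - p"
proof -
  obtain a where "aug_boundary z = boundary z + Poly_Mapping.single [] a"
    using aug_boundary_eq_boundary by blast
  then have "aug_boundary z = scale_chain a (Poly_Mapping.single [] 1)"
    by (simp add: z)
  then have "P (aug_boundary z) = 0"
    by (simp only: chain_linearD(2)[OF lin] nil scale_chain_simps(1))
  with homotopy show ?thesis
    by (simp add: boundary_eq_aug_boundary[OF len])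
qed

text \<open>Recursive form of the alternating sum of the tuples
  \<open>p x0, ..., p xi, q xi, ..., q xn\<close>, the usual triangulation of a prism.\<close>

fun prism_simplex :: "('v \<Rightarrow> 'w) \<Rightarrow> ('v \<Rightarrow> 'w) \<Rightarrow> 'v list \<Rightarrow> ('w list \<Rightarrow>\<^sub>0 'k::field)" where
  "prism_simplex p q [] = 0"
| "prism_simplex p q (x # \<sigma>) =
     Poly_Mapping.single (p x # q x # map q \<sigma>) 1 - cone_chain (p x) (prism_simplex p q \<sigma>)"

definition prism :: "('v \<Rightarrow> 'w) \<Rightarrow> ('v \<Rightarrow> 'w) \<Rightarrow> ('v list \<Rightarrow>\<^sub>0 'k::field) \<Rightarrow> ('w list \<Rightarrow>\<^sub>0 'k)" where
  "prism p q = chain_ext (prism_simplex p q)"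

lemma prism_linear: "chain_linear (prism p q)"
  by (simp add: prism_def chain_linear_ext)

lemma prism_single [simp]: "prism p q (Poly_Mapping.single \<sigma> a) = scale_chain a (prism_simplex p q \<sigma>)"
  by (simp add: prism_def)

lemma prism_cone:
  "prism p q (cone_chain x c) = cone_chain (p x) (cone_chain (q x) (push_chain q c)) - cone_chain (p x) (prism p q c)"
  by (rule chain_linear_eqI[where f = "\<lambda>c. prism p q (cone_chain x c)",
      OF chain_linear_comp[OF prism_linear cone_linear]
        chain_linear_diff[OF
          chain_linear_comp[OF cone_linear chain_linear_comp[OF cone_linear push_chain_linear]]
          chain_linear_comp[OF cone_linear prism_linear]]])
     simp

lemma prism_homotopy:
  fixes c :: "'v list \<Rightarrow>\<^sub>0 'k::field"
  shows "aug_boundary (prism p q c) + prism p q (aug_boundary c) = push_chain q c - push_chain p c"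
proof -
  have simplex: "aug_boundary (prism_simplex p q \<sigma>) + prism p q (aug_boundary_simplex \<sigma>)
      = Poly_Mapping.single (map q \<sigma>) 1 - (Poly_Mapping.single (map p \<sigma>) 1 :: _ \<Rightarrow>\<^sub>0 'k)" for \<sigma> :: "'v list"
  proof (induction \<sigma>)
    case (Cons x \<sigma>)
    \<comment> \<open>The cone formulas isolate a cone over the expression for \<sigma>. After the
      induction hypothesis is inserted, the two cones over \<open>map q \<sigma>\<close> cancel and
      the cone over \<open>map p \<sigma>\<close> is the missing term.\<close>
    have "aug_boundary (prism_simplex p q (x # \<sigma>)) + prism p q (aug_boundary_simplex (x # \<sigma>)) =
        Poly_Mapping.single (map q (x # \<sigma>)) 1
        - cone_chain (p x) (Poly_Mapping.single (map q \<sigma>) 1)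
        + cone_chain (p x) (aug_boundary (prism_simplex p q \<sigma>) + prism p q (aug_boundary_simplex \<sigma>) :: _ \<Rightarrow>\<^sub>0 'k)"
      using aug_boundary_push_chain[of q "Poly_Mapping.single \<sigma> (1::'k)"]
      by (simp add: chain_lin_simps chain_linearD[OF prism_linear] aug_boundary_cone prism_cone
          algebra_simps)
    then show ?case
      unfolding Cons by (simp add: chain_lin_simps)
  qed (simp add: chain_linearD[OF prism_linear] chain_lin_simps)
  show ?thesis
    by (rule chain_linear_eqI[where f = "\<lambda>c. aug_boundary (prism p q c) + prism p q (aug_boundary c)",
        OF chain_linear_add[OF chain_linear_comp[OF aug_boundary_linear prism_linear]
            chain_linear_comp[OF prism_linear aug_boundary_linear]]
          chain_linear_diff[OF push_chain_linear push_chain_linear]])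
       (simp add: simplex)
qed

lemma keys_prism_simplex:
  "\<tau> \<in> Poly_Mapping.keys (prism_simplex p q \<sigma> :: 'w list \<Rightarrow>\<^sub>0 'k::field) \<Longrightarrow>
     set \<tau> \<subseteq> p ` set \<sigma> \<union> q ` set \<sigma> \<and> length \<tau> = Suc (length \<sigma>)"
proof (induction \<sigma> arbitrary: \<tau>)
  case (Cons x \<sigma>)
  then consider "\<tau> \<in> Poly_Mapping.keys (Poly_Mapping.single (p x # q x # map q \<sigma>) (1::'k))"
    | "\<tau> \<in> Poly_Mapping.keys (cone_chain (p x) (prism_simplex p q \<sigma>) :: 'w list \<Rightarrow>\<^sub>0 'k)"
    using Poly_Mapping.keys_diff[of "Poly_Mapping.single (p x # q x # map q \<sigma>) (1::'k)"
        "cone_chain (p x) (prism_simplex p q \<sigma>)"]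
    by auto
  then show ?case
  proof cases
    case 2
    then obtain \<rho> where "\<rho> \<in> Poly_Mapping.keys (prism_simplex p q \<sigma> :: 'w list \<Rightarrow>\<^sub>0 'k)" "\<tau> = p x # \<rho>"
      using keys_cone[of "p x" "prism_simplex p q \<sigma> :: 'w list \<Rightarrow>\<^sub>0 'k"] by auto
    with Cons.IH[of \<rho>] show ?thesis by auto
  qed auto
qed simp

lemma keys_prism:
  "\<tau> \<in> Poly_Mapping.keys (prism p q c) \<Longrightarrow>
     \<exists>\<sigma>\<in>Poly_Mapping.keys c. set \<tau> \<subseteq> p ` set \<sigma> \<union> q ` set \<sigma> \<and> length \<tau> = Suc (length \<sigma>)"
  unfolding prism_def
  by (drule subsetD[OF keys_chain_ext]) (use keys_prism_simplex in blast)

text \<open>The prism over a simplex \<open>S\<close> has its vertices in \<open>p\<close> S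
  \<union> q \<open>S\<close>, which contiguity makes a simplex of \<open>L\<close>. Hence the prism
  over \<open>z\<close> is a chain of \<open>L\<close>, and it bounds the difference of the two
  images.\<close>

lemma contiguous_homologous:
  assumes L: "asc L" and K: "{} \<notin> K" and pq: "contiguous K L p q" and z: "z \<in> cycles K k"
  shows "push_chain q z - push_chain p z \<in> boundaries L k"
proof -
  have zc: "z \<in> simplicial_chains K k" and bz: "boundary z = 0"
    using z by (auto simp: cycles_def)
  have key: "set \<tau> \<in> L \<and> int (length \<tau>) = k + 1 + 1 \<and> 2 \<le> length \<tau>"
    if \<tau>_key: "\<tau> \<in> Poly_Mapping.keys (prism p q z)" for \<tau>
  proof -
    obtain \<sigma> where \<sigma>: "\<sigma> \<in> Poly_Mapping.keys z"
      and \<tau>: "set \<tau> \<subseteq> p ` set \<sigma> \<union> q ` set \<sigma>" "length \<tau> = Suc (length \<sigma>)"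
      using keys_prism[OF \<tau>_key] by blast
    have "set \<sigma> \<in> K" "int (length \<sigma>) = k + 1"
      using simplicial_chainsD[OF zc \<sigma>] by auto
    moreover have "length \<sigma> \<noteq> 0" using \<open>set \<sigma> \<in> K\<close> K by auto
    have "set \<tau> \<noteq> {}" using \<tau> by auto
    moreover have "p ` set \<sigma> \<union> q ` set \<sigma> \<in> L"
      using pq \<open>set \<sigma> \<in> K\<close> by (simp add: contiguous_def)
    then have "set \<tau> \<in> L"
      using L \<tau> \<open>set \<tau> \<noteq> {}\<close> unfolding asc_def by blast
    ultimately show ?thesis
      using \<tau> by (cases \<sigma>) auto
  qed
  have "boundary (prism p q z) = push_chain q z - push_chain p z"
    using homotopic_cycles[OF bz prism_linear _ prism_homotopy, of p q] key by simp
  moreover have "prism p q z \<in> simplicial_chains L (k + 1)"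
    using key by (auto simp: simplicial_chains_def)
  ultimately show ?thesis
    unfolding boundaries_def by (metis image_eqI)
qed

section \<open>Cycles and boundaries as subspaces, and their images under simplicial maps\<close>

lemma boundaries_subspace:
  "0 \<in> boundaries K k"
  "c \<in> boundaries K k \<Longrightarrow> d \<in> boundaries K k \<Longrightarrow> c + d \<in> boundaries K k"
  "c \<in> boundaries K k \<Longrightarrow> scale_chain a c \<in> boundaries K k"
proof -
  show "0 \<in> boundaries K k"
    unfolding boundaries_def
    by (rule image_eqI[of _ _ 0]) (simp_all add: simplicial_chains_subspace chain_lin_simps)
  show "c + d \<in> boundaries K k" if cd: "c \<in> boundaries K k" "d \<in> boundaries K k"
  proof -
    obtain c' d' where "c' \<in> simplicial_chains K (k + 1)" "c = boundary c'"
      "d' \<in> simplicial_chains K (k + 1)" "d = boundary d'"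
      using cd by (auto simp: boundaries_def)
    then show ?thesis
      unfolding boundaries_def
      by (intro image_eqI[of _ _ "c' + d'"]) (simp_all add: simplicial_chains_subspace chain_lin_simps)
  qed
  show "scale_chain a c \<in> boundaries K k" if c: "c \<in> boundaries K k"
  proof -
    obtain c' where "c' \<in> simplicial_chains K (k + 1)" "c = boundary c'"
      using c by (auto simp: boundaries_def)
    then show ?thesis
      unfolding boundaries_def
      by (intro image_eqI[of _ _ "scale_chain a c'"]) (simp_all add: simplicial_chains_subspace chain_lin_simps)
  qed
qed

lemma boundaries_uminus: "c \<in> boundaries K k \<Longrightarrow> - c \<in> boundaries K k"
  using boundaries_subspace(3)[of c K k "-1"] by (simp add: scale_chain_algebra)

lemma boundaries_diff: "c \<in> boundaries K k \<Longrightarrow> d \<in> boundaries K k \<Longrightarrow> c - d \<in> boundaries K k"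
  using boundaries_subspace(2)[OF _ boundaries_uminus] by fastforce

lemma cycles_subspace:
  "0 \<in> cycles K k"
  "c \<in> cycles K k \<Longrightarrow> d \<in> cycles K k \<Longrightarrow> c + d \<in> cycles K k"
  "c \<in> cycles K k \<Longrightarrow> scale_chain a c \<in> cycles K k"
  by (auto simp: cycles_def simplicial_chains_subspace chain_lin_simps)

lemma push_chain_cycles:
  assumes "simplicial_map K L p" "z \<in> cycles K k"
  shows "push_chain p z \<in> cycles L k"
  using assms push_chain_in_simplicial_chains[OF assms(1)]
  by (auto simp: cycles_def boundary_push_chain chain_lin_simps)

lemma push_chain_boundaries:
  assumes "simplicial_map K L p" "z \<in> boundaries K k"
  shows "push_chain p z \<in> boundaries L k"
proof -
  obtain c where "c \<in> simplicial_chains K (k + 1)" "z = boundary c"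
    using assms(2) by (auto simp: boundaries_def)
  then show ?thesis
    using push_chain_in_simplicial_chains[OF assms(1)]
    by (auto simp: boundaries_def simp flip: boundary_push_chain)
qed


subsection \<open>Subdivision\<close>

text \<open>As a congruence rule for recursive definitions this restricts the recursive calls under
  \<open>chain_ext\<close> to tuples that occur in the chain. For a boundary these are shorter, so
  the definitions below terminate by length.\<close>

lemma chain_ext_cong [fundef_cong]:
  "c = d \<Longrightarrow> (\<And>\<sigma>. \<sigma> \<in> Poly_Mapping.keys d \<Longrightarrow> f \<sigma> = g \<sigma>) \<Longrightarrow> chain_ext f c = chain_ext g d"
  unfolding chain_ext_def by (intro sum.cong) auto

lemma keys_aug_boundary_simplex_length:
  "\<tau> \<in> Poly_Mapping.keys (aug_boundary_simplex \<sigma> :: 'v list \<Rightarrow>\<^sub>0 'k::field) \<Longrightarrow> length \<tau> < length \<sigma>"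
  by (drule keys_aug_boundary_simplex) simp

text \<open>The new vertex \<open>b \<sigma>\<close> is arbitrary: the chain homotopy needs no geometric realization.\<close>

function subdiv_simplex :: "('v list \<Rightarrow> 'v) \<Rightarrow> 'v list \<Rightarrow> ('v list \<Rightarrow>\<^sub>0 'k::field)" where
  "subdiv_simplex b \<sigma> = (if \<sigma> = [] then Poly_Mapping.single [] 1
     else cone_chain (b \<sigma>) (chain_ext (subdiv_simplex b) (aug_boundary_simplex \<sigma>)))"
  by auto
termination
  by (relation "Wellfounded.measure (length \<circ> snd)") (simp_all add: keys_aug_boundary_simplex_length)

function subdiv_htpy_simplex :: "('v list \<Rightarrow> 'v) \<Rightarrow> 'v list \<Rightarrow> ('v list \<Rightarrow>\<^sub>0 'k::field)" where
  "subdiv_htpy_simplex b \<sigma> = (if \<sigma> = [] then 0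
     else cone_chain (b \<sigma>) (Poly_Mapping.single \<sigma> 1 - chain_ext (subdiv_htpy_simplex b) (aug_boundary_simplex \<sigma>)))"
  by auto
termination
  by (relation "Wellfounded.measure (length \<circ> snd)") (simp_all add: keys_aug_boundary_simplex_length)

declare subdiv_simplex.simps [simp del] subdiv_htpy_simplex.simps [simp del]

definition subdiv :: "('v list \<Rightarrow> 'v) \<Rightarrow> ('v list \<Rightarrow>\<^sub>0 'k::field) \<Rightarrow> ('v list \<Rightarrow>\<^sub>0 'k)" where
  "subdiv b = chain_ext (subdiv_simplex b)"

definition subdiv_htpy :: "('v list \<Rightarrow> 'v) \<Rightarrow> ('v list \<Rightarrow>\<^sub>0 'k::field) \<Rightarrow> ('v list \<Rightarrow>\<^sub>0 'k)" where
  "subdiv_htpy b = chain_ext (subdiv_htpy_simplex b)"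

lemma subdiv_linear: "chain_linear (subdiv b)"
  by (simp add: subdiv_def chain_linear_ext)

lemma subdiv_htpy_linear: "chain_linear (subdiv_htpy b)"
  by (simp add: subdiv_htpy_def chain_linear_ext)

lemma aug_boundary_aug_boundary_simplex: "aug_boundary (aug_boundary_simplex \<sigma>) = 0"
  using aug_boundary_aug_boundary[of "Poly_Mapping.single \<sigma> 1"] by simp

lemma aug_boundary_subdiv:
  fixes c :: "'v list \<Rightarrow>\<^sub>0 'k::field"
  shows "aug_boundary (subdiv b c) = subdiv b (aug_boundary c)"
proof -
  note lin = chain_linear_comp[OF aug_boundary_linear subdiv_linear, of b]
    chain_linear_comp[OF subdiv_linear aug_boundary_linear, of b]
  have simplex: "aug_boundary (subdiv_simplex b \<sigma>) = subdiv b (aug_boundary_simplex \<sigma> :: 'v list \<Rightarrow>\<^sub>0 'k)" for \<sigma>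
  proof (induction \<sigma> rule: length_induct)
    case (1 \<sigma>)
    show ?case
    proof (cases "\<sigma> = []")
      case True
      then show ?thesis
        by (simp add: subdiv_simplex.simps chain_linearD[OF subdiv_linear])
    next
      case False
      let ?d = "aug_boundary_simplex \<sigma> :: 'v list \<Rightarrow>\<^sub>0 'k"
      \<comment> \<open>Linearity extends the induction hypothesis from the faces to
        \<open>?d\<close>. As \<open>?d\<close> is a cycle, its subdivision is one too, and the
        correction term in the boundary of the cone vanishes.\<close>
      have "aug_boundary (subdiv b ?d) = subdiv b (aug_boundary ?d)"
        by (rule chain_linear_eqI[where f = "\<lambda>c. aug_boundary (subdiv b c)", OF lin])
          (use 1 keys_aug_boundary_simplex_length in \<open>auto simp: subdiv_def\<close>)
      then have "aug_boundary (subdiv b ?d) = 0"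
        by (simp add: aug_boundary_aug_boundary_simplex chain_linearD[OF subdiv_linear])
      then show ?thesis
        using False
        by (simp add: subdiv_simplex.simps[of b \<sigma>] aug_boundary_cone chain_lin_simps flip: subdiv_def)
    qed
  qed
  show ?thesis
    by (rule chain_linear_eqI[where f = "\<lambda>c. aug_boundary (subdiv b c)", OF lin])
      (simp add: simplex subdiv_def[THEN fun_cong, of b "Poly_Mapping.single _ _"])
qed

text \<open>Write D for the homotopy. The boundary of the cone over \<sigma> - D(d \<sigma>) is this
  chain minus the cone over d \<sigma> - d D(d \<sigma>). By the induction hypothesis on faces the
  latter chain is the subdivision of d \<sigma>, and the cone over it is by definition the
  subdivision of \<sigma>.\<close>

lemma subdiv_homotopy:
  fixes c :: "'v list \<Rightarrow>\<^sub>0 'k::field"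
  shows "aug_boundary (subdiv_htpy b c) + subdiv_htpy b (aug_boundary c) = c - subdiv b c"
proof -
  note lin = chain_linear_add[OF chain_linear_comp[OF aug_boundary_linear subdiv_htpy_linear, of b]
      chain_linear_comp[OF subdiv_htpy_linear aug_boundary_linear, of b]]
    chain_linear_diff[OF chain_linear_id subdiv_linear, of b]
  note eqI = chain_linear_eqI[where f = "\<lambda>c. aug_boundary (subdiv_htpy b c) + subdiv_htpy b (aug_boundary c)", OF lin]
  have simplex: "aug_boundary (subdiv_htpy_simplex b \<sigma>) + subdiv_htpy b (aug_boundary_simplex \<sigma>)
      = Poly_Mapping.single \<sigma> 1 - (subdiv_simplex b \<sigma> :: 'v list \<Rightarrow>\<^sub>0 'k)" for \<sigma>
  proof (induction \<sigma> rule: length_induct)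
    case (1 \<sigma>)
    show ?case
    proof (cases "\<sigma> = []")
      case True
      then show ?thesis
        by (simp add: subdiv_simplex.simps subdiv_htpy_simplex.simps chain_lin_simps
            chain_linearD[OF subdiv_htpy_linear])
    next
      case False
      let ?d = "aug_boundary_simplex \<sigma> :: 'v list \<Rightarrow>\<^sub>0 'k"
      have "aug_boundary (subdiv_htpy b ?d) + subdiv_htpy b (aug_boundary ?d) = ?d - subdiv b ?d"
        by (rule eqI)
          (use 1 keys_aug_boundary_simplex_length in \<open>auto simp: subdiv_def subdiv_htpy_def\<close>)
      then have *: "aug_boundary (subdiv_htpy b ?d) = ?d - subdiv b ?d"
        by (simp add: aug_boundary_aug_boundary_simplex chain_linearD[OF subdiv_htpy_linear])
      show ?thesis
        using False
        by (simp add: subdiv_simplex.simps[of b \<sigma>] subdiv_htpy_simplex.simps[of b \<sigma>]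
            aug_boundary_cone chain_lin_simps * flip: subdiv_def subdiv_htpy_def)
    qed
  qed
  show ?thesis
    by (rule eqI)
      (simp add: simplex subdiv_def[THEN fun_cong, of b "Poly_Mapping.single _ _"]
        subdiv_htpy_def[THEN fun_cong, of b "Poly_Mapping.single _ _"])
qed

section \<open>Iterated subdivision\<close>

primrec subdiv_htpy_iter :: "nat \<Rightarrow> ('v list \<Rightarrow> 'v) \<Rightarrow> ('v list \<Rightarrow>\<^sub>0 'k::field) \<Rightarrow> ('v list \<Rightarrow>\<^sub>0 'k)" where
  "subdiv_htpy_iter 0 b c = 0"
| "subdiv_htpy_iter (Suc n) b c = subdiv_htpy_iter n b c + subdiv_htpy b ((subdiv b ^^ n) c)"

lemma subdiv_iter_linear: "chain_linear (subdiv b ^^ n)"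
proof (induction n)
  case (Suc n)
  then show ?case using chain_linear_comp[OF subdiv_linear Suc, of b] by (simp add: comp_def)
qed (simp add: chain_linear_def)

lemma subdiv_htpy_iter_linear: "chain_linear (subdiv_htpy_iter n b)"
proof (induction n)
  case (Suc n)
  then show ?case
    using chain_linear_add[OF Suc chain_linear_comp[OF subdiv_htpy_linear subdiv_iter_linear]]
    by (simp add: chain_linear_def)
qed (simp add: chain_linear_def)

lemma aug_boundary_subdiv_iter: "aug_boundary ((subdiv b ^^ n) c) = (subdiv b ^^ n) (aug_boundary c)"
  by (induction n) (simp_all add: aug_boundary_subdiv)

text \<open>The one-step homotopies, applied to the successive subdivisions, telescope.\<close>

lemma subdiv_iter_homotopy:
  "aug_boundary (subdiv_htpy_iter n b c) + subdiv_htpy_iter n b (aug_boundary c) = c - (subdiv b ^^ n) c"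
proof (induction n)
  case (Suc n)
  have "aug_boundary (subdiv_htpy b ((subdiv b ^^ n) c)) + subdiv_htpy b ((subdiv b ^^ n) (aug_boundary c))
      = (subdiv b ^^ n) c - (subdiv b ^^ Suc n) c"
    using subdiv_homotopy[of b "(subdiv b ^^ n) c"] by (simp add: aug_boundary_subdiv_iter)
  then show ?case
    using Suc by (simp add: chain_lin_simps algebra_simps)
qed (simp add: chain_lin_simps)

section \<open>Supports of subdivided chains\<close>

lemma keys_subdiv_simplex:
  fixes b :: "'v::real_vector list \<Rightarrow> 'v"
  assumes b: "\<And>\<sigma>. \<sigma> \<noteq> [] \<Longrightarrow> b \<sigma> \<in> convex hull (set \<sigma>)"
  shows "\<tau> \<in> Poly_Mapping.keys (subdiv_simplex b \<sigma> :: 'v list \<Rightarrow>\<^sub>0 'k::field) \<Longrightarrow>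
     set \<tau> \<subseteq> convex hull (set \<sigma>) \<and> length \<tau> = length \<sigma>"
proof (induction \<sigma> arbitrary: \<tau> rule: length_induct)
  case (1 \<sigma>)
  show ?case
  proof (cases "\<sigma> = []")
    case True
    then show ?thesis using 1(2) by (simp add: subdiv_simplex.simps)
  next
    case False
    then have "\<tau> \<in> Poly_Mapping.keys (cone_chain (b \<sigma>) (chain_ext (subdiv_simplex b) (aug_boundary_simplex \<sigma>)) :: 'v list \<Rightarrow>\<^sub>0 'k)"
      using 1(2) by (simp add: subdiv_simplex.simps)
    then obtain \<tau>' where "\<tau>' \<in> Poly_Mapping.keys (chain_ext (subdiv_simplex b) (aug_boundary_simplex \<sigma>) :: 'v list \<Rightarrow>\<^sub>0 'k)"
      and \<tau>: "\<tau> = b \<sigma> # \<tau>'"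
      by (drule_tac subsetD[OF keys_cone]) auto
    then obtain \<rho> where \<rho>: "\<rho> \<in> Poly_Mapping.keys (aug_boundary_simplex \<sigma> :: 'v list \<Rightarrow>\<^sub>0 'k)"
      and \<tau>1: "\<tau>' \<in> Poly_Mapping.keys (subdiv_simplex b \<rho> :: 'v list \<Rightarrow>\<^sub>0 'k)"
      by (drule_tac subsetD[OF keys_chain_ext]) auto
    note \<tau>' = \<tau>1 \<tau>
    have \<rho>': "set \<rho> \<subseteq> set \<sigma>" "length \<sigma> = Suc (length \<rho>)"
      using keys_aug_boundary_simplex[OF \<rho>] by auto
    moreover have "set \<tau>' \<subseteq> convex hull (set \<rho>)" "length \<tau>' = length \<rho>"
      using 1(1)[rule_format, of \<rho> \<tau>', OF _ \<tau>1] \<rho>' by auto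
    ultimately show ?thesis
      using \<tau>'(2) b[OF False] hull_mono[of "set \<rho>" "set \<sigma>" convex] by auto
  qed
qed

lemma keys_subdiv_htpy_simplex:
  fixes b :: "'v::real_vector list \<Rightarrow> 'v"
  assumes b: "\<And>\<sigma>. \<sigma> \<noteq> [] \<Longrightarrow> b \<sigma> \<in> convex hull (set \<sigma>)"
  shows "\<tau> \<in> Poly_Mapping.keys (subdiv_htpy_simplex b \<sigma> :: 'v list \<Rightarrow>\<^sub>0 'k::field) \<Longrightarrow>
     set \<tau> \<subseteq> convex hull (set \<sigma>) \<and> length \<tau> = Suc (length \<sigma>)"
proof (induction \<sigma> arbitrary: \<tau> rule: length_induct)
  case (1 \<sigma>)
  show ?case
  proof (cases "\<sigma> = []")
    case True
    then show ?thesis using 1(2) by (simp add: subdiv_htpy_simplex.simps)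
  next
    case False
    let ?c = "chain_ext (subdiv_htpy_simplex b) (aug_boundary_simplex \<sigma>) :: 'v list \<Rightarrow>\<^sub>0 'k"
    have "\<tau> \<in> Poly_Mapping.keys (cone_chain (b \<sigma>) (Poly_Mapping.single \<sigma> 1 - ?c))"
      using False 1(2) by (simp add: subdiv_htpy_simplex.simps)
    then obtain \<tau>' where \<tau>': "\<tau>' \<in> Poly_Mapping.keys (Poly_Mapping.single \<sigma> 1 - ?c)" "\<tau> = b \<sigma> # \<tau>'"
      by (drule_tac subsetD[OF keys_cone]) auto
    then consider "\<tau>' = \<sigma>" | "\<tau>' \<in> Poly_Mapping.keys ?c"
      using Poly_Mapping.keys_diff[of "Poly_Mapping.single \<sigma> 1" ?c] by (auto split: if_splits)
    then have "set \<tau>' \<subseteq> convex hull (set \<sigma>) \<and> length \<tau>' = length \<sigma>"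
    proof cases
      case 2
      then obtain \<rho> where \<rho>: "\<rho> \<in> Poly_Mapping.keys (aug_boundary_simplex \<sigma> :: 'v list \<Rightarrow>\<^sub>0 'k)"
        and \<tau>'': "\<tau>' \<in> Poly_Mapping.keys (subdiv_htpy_simplex b \<rho> :: 'v list \<Rightarrow>\<^sub>0 'k)"
        by (drule_tac subsetD[OF keys_chain_ext]) auto
      have \<rho>': "set \<rho> \<subseteq> set \<sigma>" "length \<sigma> = Suc (length \<rho>)"
        using keys_aug_boundary_simplex[OF \<rho>] by auto
      moreover have "set \<tau>' \<subseteq> convex hull (set \<rho>)" "length \<tau>' = Suc (length \<rho>)"
        using 1(1)[rule_format, of \<rho> \<tau>', OF _ \<tau>''] \<rho>' by auto
      ultimately show ?thesis
        using hull_mono[of "set \<rho>" "set \<sigma>" convex] by auto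
    qed (simp add: hull_subset)
    then show ?thesis
      using \<tau>'(2) b[OF False] by simp
  qed
qed

section \<open>Mesh of the barycentric subdivision\<close>

definition barycenter :: "'v::real_vector list \<Rightarrow> 'v" where
  "barycenter \<sigma> = (1 / real (length \<sigma>)) *\<^sub>R (\<Sum>i<length \<sigma>. \<sigma> ! i)"

lemma barycenter_in_hull:
  assumes "\<sigma> \<noteq> []" shows "barycenter \<sigma> \<in> convex hull (set \<sigma>)"
  unfolding barycenter_def scaleR_sum_right
  by (rule convex_sum) (use assms in \<open>auto intro: hull_inc\<close>)

text \<open>Tuples may repeat a vertex, so entries are averaged with multiplicity. For an entry x of
  a tuple of length n, one of the n summands of the barycenter minus x vanishes and the others have
  norm at most \<open>d\<close>, whence the factor (n - 1) / n. A ball around the barycenter that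
  contains the entries contains their hull.\<close>

lemma dist_barycenter_le:
  fixes \<sigma> :: "'v::real_normed_vector list"
  assumes d: "\<And>x y. x \<in> set \<sigma> \<Longrightarrow> y \<in> set \<sigma> \<Longrightarrow> dist x y \<le> d" and y: "y \<in> convex hull (set \<sigma>)"
  shows "dist (barycenter \<sigma>) y \<le> (1 - 1 / real (length \<sigma>)) * d"
proof -
  let ?n = "length \<sigma>"
  have ne: "\<sigma> \<noteq> []" using y by auto
  then have n: "real ?n > 0" by simp
  have "dist (barycenter \<sigma>) x \<le> (1 - 1 / real ?n) * d" if x: "x \<in> set \<sigma>" for x
  proof -
    obtain j where j: "j < ?n" "x = \<sigma> ! j" using x by (auto simp: in_set_conv_nth)
    have "barycenter \<sigma> - x = (1 / real ?n) *\<^sub>R ((\<Sum>i<?n. \<sigma> ! i) - real ?n *\<^sub>R x)"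
      using n by (simp add: barycenter_def scaleR_diff_right)
    also have "(\<Sum>i<?n. \<sigma> ! i) - real ?n *\<^sub>R x = (\<Sum>i<?n. \<sigma> ! i - x)"
      by (simp add: sum_subtractf sum_constant_scaleR)
    also have "\<dots> = (\<Sum>i\<in>{..<?n} - {j}. \<sigma> ! i - x)"
      using j by (subst sum.remove[of _ j]) auto
    finally have eq: "dist (barycenter \<sigma>) x = (1 / real ?n) * norm (\<Sum>i\<in>{..<?n} - {j}. \<sigma> ! i - x)"
      by (simp add: dist_norm)
    have "norm (\<Sum>i\<in>{..<?n} - {j}. \<sigma> ! i - x) \<le> (\<Sum>i\<in>{..<?n} - {j}. d)"
      using x d by (intro sum_norm_le) (auto simp flip: dist_norm)
    also have "\<dots> = (real ?n - 1) * d"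
      using j by (simp add: of_nat_diff Suc_leI)
    finally have "(1 / real ?n) * norm (\<Sum>i\<in>{..<?n} - {j}. \<sigma> ! i - x) \<le> (1 / real ?n) * ((real ?n - 1) * d)"
      by (rule mult_left_mono) simp
    also have "\<dots> = (1 - 1 / real ?n) * d"
      using n by (simp add: field_simps)
    finally show ?thesis
      unfolding eq .
  qed
  then have "set \<sigma> \<subseteq> cball (barycenter \<sigma>) ((1 - 1 / real ?n) * d)"
    by auto
  then have "convex hull (set \<sigma>) \<subseteq> cball (barycenter \<sigma>) ((1 - 1 / real ?n) * d)"
    by (rule hull_minimal) simp
  with y show ?thesis by auto
qed

text \<open>Either one of the two vertices is the new barycenter, or both lie in the subdivision of
  a face. The face is shorter, so its contraction factor is smaller.\<close>

lemma subdiv_simplex_mesh: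
  fixes \<sigma> :: "'v::real_normed_vector list"
  assumes "\<tau> \<in> Poly_Mapping.keys (subdiv_simplex barycenter \<sigma> :: 'v list \<Rightarrow>\<^sub>0 'k::field)"
    and "\<And>x y. x \<in> set \<sigma> \<Longrightarrow> y \<in> set \<sigma> \<Longrightarrow> dist x y \<le> d" and "x \<in> set \<tau>" "y \<in> set \<tau>"
  shows "dist x y \<le> (1 - 1 / real (length \<sigma>)) * d"
  using assms
proof (induction \<sigma> arbitrary: \<tau> x y rule: length_induct)
  case (1 \<sigma>)
  show ?case
  proof (cases "\<sigma> = []")
    case True
    then show ?thesis using 1(2,4) by (simp add: subdiv_simplex.simps)
  next
    case False
    then have "\<tau> \<in> Poly_Mapping.keys (cone_chain (barycenter \<sigma>) (chain_ext (subdiv_simplex barycenter) (aug_boundary_simplex \<sigma>)) :: 'v list \<Rightarrow>\<^sub>0 'k)"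
      using 1(2) by (simp add: subdiv_simplex.simps)
    then obtain \<tau>' where "\<tau>' \<in> Poly_Mapping.keys (chain_ext (subdiv_simplex barycenter) (aug_boundary_simplex \<sigma>) :: 'v list \<Rightarrow>\<^sub>0 'k)"
      and \<tau>: "\<tau> = barycenter \<sigma> # \<tau>'"
      by (drule_tac subsetD[OF keys_cone]) auto
    then obtain \<rho> where \<rho>: "\<rho> \<in> Poly_Mapping.keys (aug_boundary_simplex \<sigma> :: 'v list \<Rightarrow>\<^sub>0 'k)"
      and \<tau>1: "\<tau>' \<in> Poly_Mapping.keys (subdiv_simplex barycenter \<rho> :: 'v list \<Rightarrow>\<^sub>0 'k)"
      by (drule_tac subsetD[OF keys_chain_ext]) auto
    note \<tau>' = \<tau>1 \<tau>
    have \<rho>': "set \<rho> \<subseteq> set \<sigma>" "length \<sigma> = Suc (length \<rho>)"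
      using keys_aug_boundary_simplex[OF \<rho>] by auto
    have hull: "set \<tau>' \<subseteq> convex hull (set \<rho>)" and len: "length \<tau>' = length \<rho>"
      using keys_subdiv_simplex[OF barycenter_in_hull \<tau>'(1)] by auto
    from hull have "set \<tau>' \<subseteq> convex hull (set \<sigma>)"
      using hull_mono[OF \<rho>'(1), of convex] by blast
    then have b: "dist (barycenter \<sigma>) u \<le> (1 - 1 / real (length \<sigma>)) * d" if "u \<in> set \<tau>'" for u
      using dist_barycenter_le[of \<sigma> d u] 1(3) that by blast
    have "0 \<le> d"
      using 1(3) False by (metis dist_self equals0I set_empty)
    have "dist u v \<le> (1 - 1 / real (length \<sigma>)) * d" if "u \<in> set \<tau>'" "v \<in> set \<tau>'" for u v
    proof -
      have "dist u v \<le> (1 - 1 / real (length \<rho>)) * d"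
        by (rule 1(1)[rule_format, OF _ \<tau>1 _ that])
          (use \<rho>' that 1(3) in auto)
      also have "\<dots> \<le> (1 - 1 / real (length \<sigma>)) * d"
      proof (rule mult_right_mono)
        have "0 < real (length \<rho>)"
          using that(1) len by (cases \<tau>') auto
        then have "1 / real (length \<sigma>) \<le> 1 / real (length \<rho>)"
          using \<rho>'(2) by (intro divide_left_mono) auto
        then show "1 - 1 / real (length \<rho>) \<le> 1 - 1 / real (length \<sigma>)"
          by simp
      qed fact
      finally show ?thesis .
    qed
    moreover have "0 \<le> (1 - 1 / real (length \<sigma>)) * d"
      using \<open>0 \<le> d\<close> False by (simp add: Suc_leI)
    ultimately show ?thesis
      using 1(4,5) \<tau>'(2) b by (auto simp: dist_commute)
  qed
qed

text \<open>Subdivision preserves the length of tuples, so every round contracts by the same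
  factor.\<close>

lemma keys_subdiv_iter:
  fixes c :: "'v::real_normed_vector list \<Rightarrow>\<^sub>0 'k::field"
  assumes "\<tau> \<in> Poly_Mapping.keys ((subdiv barycenter ^^ n) c)"
    and "\<And>\<sigma>. \<sigma> \<in> Poly_Mapping.keys c \<Longrightarrow> length \<sigma> = m"
    and "\<And>\<sigma> x y. \<sigma> \<in> Poly_Mapping.keys c \<Longrightarrow> x \<in> set \<sigma> \<Longrightarrow> y \<in> set \<sigma> \<Longrightarrow> dist x y \<le> d"
  shows "\<exists>\<sigma>\<in>Poly_Mapping.keys c. set \<tau> \<subseteq> convex hull (set \<sigma>) \<and> length \<tau> = m \<and>
    (\<forall>x\<in>set \<tau>. \<forall>y\<in>set \<tau>. dist x y \<le> (1 - 1 / real m) ^ n * d)"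
  using assms(1)
proof (induction n arbitrary: \<tau>)
  case 0
  then show ?case using assms(2,3) by (auto intro!: bexI[of _ \<tau>] hull_inc)
next
  case (Suc n)
  then have "\<tau> \<in> Poly_Mapping.keys (subdiv barycenter ((subdiv barycenter ^^ n) c))"
    by simp
  then obtain \<rho> where \<rho>: "\<rho> \<in> Poly_Mapping.keys ((subdiv barycenter ^^ n) c)"
    and \<tau>: "\<tau> \<in> Poly_Mapping.keys (subdiv_simplex barycenter \<rho> :: 'v list \<Rightarrow>\<^sub>0 'k)"
    unfolding subdiv_def by (drule_tac subsetD[OF keys_chain_ext]) auto
  obtain \<sigma> where \<sigma>: "\<sigma> \<in> Poly_Mapping.keys c" "set \<rho> \<subseteq> convex hull (set \<sigma>)" "length \<rho> = m"
    "\<And>x y. x \<in> set \<rho> \<Longrightarrow> y \<in> set \<rho> \<Longrightarrow> dist x y \<le> (1 - 1 / real m) ^ n * d"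
    by (rule bexE[OF Suc.IH[OF \<rho>]]) (auto intro: that)
  have "set \<tau> \<subseteq> convex hull (set \<rho>)" "length \<tau> = length \<rho>"
    using keys_subdiv_simplex[OF barycenter_in_hull \<tau>] by auto
  moreover have "convex hull (set \<rho>) \<subseteq> convex hull (set \<sigma>)"
    using \<sigma>(2) by (simp add: hull_minimal)
  moreover have "dist x y \<le> (1 - 1 / real m) ^ Suc n * d" if "x \<in> set \<tau>" "y \<in> set \<tau>" for x y
    using subdiv_simplex_mesh[OF \<tau> \<sigma>(4) that] \<sigma>(3) by (simp add: mult.assoc)
  ultimately show ?case
    using \<sigma>(1,3) by (intro bexI[of _ \<sigma>]) auto
qed

lemma keys_subdiv_htpy_iter:
  fixes c :: "'v::real_normed_vector list \<Rightarrow>\<^sub>0 'k::field"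
  assumes "\<tau> \<in> Poly_Mapping.keys (subdiv_htpy_iter n barycenter c)"
    and len: "\<And>\<sigma>. \<sigma> \<in> Poly_Mapping.keys c \<Longrightarrow> length \<sigma> = m"
  shows "\<exists>\<sigma>\<in>Poly_Mapping.keys c. set \<tau> \<subseteq> convex hull (set \<sigma>) \<and> length \<tau> = Suc m"
  using assms(1)
proof (induction n)
  case 0
  then show ?case by (simp only: subdiv_htpy_iter.simps keys_zero empty_iff)
next
  case (Suc n)
  then consider "\<tau> \<in> Poly_Mapping.keys (subdiv_htpy_iter n barycenter c)"
    | "\<tau> \<in> Poly_Mapping.keys (subdiv_htpy barycenter ((subdiv barycenter ^^ n) c))"
    using Poly_Mapping.keys_add[of "subdiv_htpy_iter n barycenter c"
        "subdiv_htpy barycenter ((subdiv barycenter ^^ n) c)"] by auto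
  then show ?case
  proof cases
    case 2
    then obtain \<rho> where \<rho>: "\<rho> \<in> Poly_Mapping.keys ((subdiv barycenter ^^ n) c)"
      and \<tau>: "\<tau> \<in> Poly_Mapping.keys (subdiv_htpy_simplex barycenter \<rho> :: 'v list \<Rightarrow>\<^sub>0 'k)"
      unfolding subdiv_htpy_def by (drule_tac subsetD[OF keys_chain_ext]) auto
    \<comment> \<open>A common bound on the diameters of the finitely many tuples of
      \<open>c\<close>, as \<open>keys_subdiv_iter\<close> demands one.\<close>
    define d where "d = Max (insert 0 (\<Union>\<sigma>\<in>Poly_Mapping.keys c. \<Union>x\<in>set \<sigma>. (\<lambda>y. dist x y) ` set \<sigma>))"
    have d: "dist x y \<le> d" if "\<sigma> \<in> Poly_Mapping.keys c" "x \<in> set \<sigma>" "y \<in> set \<sigma>" for \<sigma> x y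
      unfolding d_def using that by (intro Max_ge) auto
    obtain \<sigma> where \<sigma>: "\<sigma> \<in> Poly_Mapping.keys c" "set \<rho> \<subseteq> convex hull (set \<sigma>)" "length \<rho> = m"
    proof -
      have "\<exists>\<sigma>\<in>Poly_Mapping.keys c. set \<rho> \<subseteq> convex hull (set \<sigma>) \<and> length \<rho> = m \<and>
          (\<forall>x\<in>set \<rho>. \<forall>y\<in>set \<rho>. dist x y \<le> (1 - 1 / real m) ^ n * d)"
        by (rule keys_subdiv_iter[OF \<rho>]) (use len d in auto)
      then show ?thesis
        using that by blast
    qed
    have "set \<tau> \<subseteq> convex hull (set \<rho>)" "length \<tau> = Suc (length \<rho>)"
      using keys_subdiv_htpy_simplex[OF barycenter_in_hull \<tau>] by auto
    moreover have "convex hull (set \<rho>) \<subseteq> convex hull (set \<sigma>)"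
      using \<sigma>(2) by (simp add: hull_minimal)
    ultimately show ?thesis
      using \<sigma>(1,3) by (intro bexI[OF _ \<sigma>(1)]) auto
  next
    case 1
    then show ?thesis by (rule Suc.IH)
  qed
qed


subsection \<open>Ranks of linear maps\<close>

lemma submoduleI':
  assumes "vectorspace K V" "N \<subseteq> carrier V" "\<zero>\<^bsub>V\<^esub> \<in> N"
    "\<And>v w. v \<in> N \<Longrightarrow> w \<in> N \<Longrightarrow> v \<oplus>\<^bsub>V\<^esub> w \<in> N"
    "\<And>c v. c \<in> carrier K \<Longrightarrow> v \<in> N \<Longrightarrow> c \<odot>\<^bsub>V\<^esub> v \<in> N"
  shows "subspace K N V"
  using assms unfolding subspace_def submodule_def vectorspace_def by auto

lemma subspaceD:
  assumes "subspace K N V"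
  shows "vectorspace K V" "N \<subseteq> carrier V" "\<zero>\<^bsub>V\<^esub> \<in> N"
    "v \<in> N \<Longrightarrow> w \<in> N \<Longrightarrow> v \<oplus>\<^bsub>V\<^esub> w \<in> N"
    "c \<in> carrier K \<Longrightarrow> v \<in> N \<Longrightarrow> c \<odot>\<^bsub>V\<^esub> v \<in> N"
  using assms unfolding subspace_def submodule_def by auto

definition subdim where "subdim K V S = vectorspace.dim K (V\<lparr>carrier := S\<rparr>)"
definition finsub where "finsub K V S \<longleftrightarrow> subspace K S V \<and> vectorspace.fin_dim K (V\<lparr>carrier := S\<rparr>)"

lemma linear_mapI:
  assumes "vectorspace K V" "vectorspace K W" "T \<in> carrier V \<rightarrow> carrier W"
    "\<And>x y. x \<in> carrier V \<Longrightarrow> y \<in> carrier V \<Longrightarrow> T (x \<oplus>\<^bsub>V\<^esub> y) = T x \<oplus>\<^bsub>W\<^esub> T y"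
    "\<And>a x. a \<in> carrier K \<Longrightarrow> x \<in> carrier V \<Longrightarrow> T (a \<odot>\<^bsub>V\<^esub> x) = a \<odot>\<^bsub>W\<^esub> T x"
  shows "linear_map K V W T"
  using assms unfolding linear_map_def mod_hom_def mod_hom_axioms_def module_hom_def vectorspace_def
  by auto

lemma linear_mapD:
  assumes "linear_map K V W T"
  shows "vectorspace K V" "vectorspace K W" "T \<in> carrier V \<rightarrow> carrier W"
    "x \<in> carrier V \<Longrightarrow> y \<in> carrier V \<Longrightarrow> T (x \<oplus>\<^bsub>V\<^esub> y) = T x \<oplus>\<^bsub>W\<^esub> T y"
    "a \<in> carrier K \<Longrightarrow> x \<in> carrier V \<Longrightarrow> T (a \<odot>\<^bsub>V\<^esub> x) = a \<odot>\<^bsub>W\<^esub> T x"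
    "T \<zero>\<^bsub>V\<^esub> = \<zero>\<^bsub>W\<^esub>"
proof -
  interpret linear_map K V W T by fact
  show "vectorspace K V" "vectorspace K W" "T \<zero>\<^bsub>V\<^esub> = \<zero>\<^bsub>W\<^esub>" "T \<in> carrier V \<rightarrow> carrier W"
    using T_im by (auto, unfold_locales)
  show "x \<in> carrier V \<Longrightarrow> y \<in> carrier V \<Longrightarrow> T (x \<oplus>\<^bsub>V\<^esub> y) = T x \<oplus>\<^bsub>W\<^esub> T y"
    "a \<in> carrier K \<Longrightarrow> x \<in> carrier V \<Longrightarrow> T (a \<odot>\<^bsub>V\<^esub> x) = a \<odot>\<^bsub>W\<^esub> T x"
    by auto
qed

lemma subspace_carrier: "vectorspace K V \<Longrightarrow> subspace K (carrier V) V"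
  unfolding vectorspace_def
  by (intro submoduleI') (auto simp: vectorspace_def Module.module_def module_axioms_def
      intro: abelian_monoid.zero_closed abelian_monoid.a_closed abelian_group.axioms)

lemma linear_map_restrict:
  assumes T: "linear_map K V W T" and S: "subspace K S V"
  shows "linear_map K (V\<lparr>carrier := S\<rparr>) W T"
proof -
  note D = linear_mapD[OF T] and S' = subspaceD[OF S]
  show ?thesis
    by (rule linear_mapI) (use D S' vectorspace.subspace_is_vs[OF S'(1) S] in \<open>auto simp: subset_eq\<close>)
qed

lemma subspace_image:
  assumes T: "linear_map K V W T" and S: "subspace K S V"
  shows "subspace K (T ` S) W"
proof -
  interpret T: linear_map K "V\<lparr>carrier := S\<rparr>" W T
    by (rule linear_map_restrict) fact+
  show ?thesis using T.imT_is_subspace by (simp add: T.im_def)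
qed

lemma subspace_subset:
  assumes S: "subspace K S V" and S': "subspace K S' V" and "S \<subseteq> S'"
  shows "subspace K S (V\<lparr>carrier := S'\<rparr>)"
proof (rule submoduleI')
  show "vectorspace K (V\<lparr>carrier := S'\<rparr>)"
    by (rule vectorspace.subspace_is_vs[OF subspaceD(1)[OF S] S'])
qed (use subspaceD[OF S] \<open>S \<subseteq> S'\<close> in auto)

text \<open>An independent subset of \<open>S\<close> is independent in the whole space, so its size
  is bounded by the dimension; a maximal one is a basis of \<open>S\<close>. If the dimensions
  agree, it is a basis of the whole space as well.\<close>

lemma (in vectorspace) fin_dim_subspace:
  assumes fd: "fin_dim" and S: "subspace K S V"
  shows "vectorspace.fin_dim K (vs S)" "vectorspace.dim K (vs S) \<le> dim"
    "vectorspace.dim K (vs S) = dim \<Longrightarrow> S = carrier V"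
proof -
  interpret S: vectorspace K "vs S"
    by (rule subspace_is_vs[OF S])
  have sub: "submodule K S V" using S by simp
  have SV: "S \<subseteq> carrier V" using subspaceD[OF S] by simp
  have li: "lin_indpt A" if "A \<subseteq> S" "S.lin_indpt A" for A
    using span_li_not_depend(2)[OF that(1) sub] that(2) by simp
  have "\<exists>A. finite A \<and> maximal A (\<lambda>A. A \<subseteq> carrier (vs S) \<and> S.lin_indpt A)"
  proof (rule maximal_exists[where N = dim and B = "{}"])
    show "finite A \<and> card A \<le> dim" if "A \<subseteq> carrier (vs S) \<and> S.lin_indpt A" for A
      using li_le_dim[OF fd, of A] li[of A] that SV by auto
    show "{} \<subseteq> carrier (vs S) \<and> S.lin_indpt {}"
      by (simp add: S.lin_dep_def)
  qed
  then obtain A where A: "finite A" "maximal A (\<lambda>A. A \<subseteq> carrier (vs S) \<and> S.lin_indpt A)"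
    by blast
  have B: "S.basis A" by (rule S.max_li_is_basis[OF A(2)])
  then have A': "A \<subseteq> S" "S.lin_indpt A" "S.gen_set A" "S.dim = card A"
    using S.dim_basis[OF A(1)] by (auto simp: S.basis_def)
  then show "S.fin_dim" "S.dim \<le> dim"
    using A li_le_dim[OF fd, of A] li[of A] SV by (auto simp: S.fin_dim_def)
  assume "S.dim = dim"
  then have "basis A"
    using A' A(1) SV li by (intro dim_li_is_basis[OF fd]) auto
  then have "span A = carrier V" by (simp add: basis_def)
  moreover have "span A = S.span A"
    using span_li_not_depend(1)[OF A'(1) sub] by simp
  ultimately show "S = carrier V"
    using A'(3) by simp
qed

lemma finsub_mono:
  assumes S: "subspace K S V" and S': "finsub K V S'" and sub: "S \<subseteq> S'"
  shows "finsub K V S" "subdim K V S \<le> subdim K V S'"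
    "subdim K V S = subdim K V S' \<Longrightarrow> S = S'"
proof -
  have S'': "subspace K S' V" and fin: "vectorspace.fin_dim K (V\<lparr>carrier := S'\<rparr>)"
    using S' by (auto simp: finsub_def)
  interpret V': vectorspace K "V\<lparr>carrier := S'\<rparr>"
    using vectorspace.subspace_is_vs[OF subspaceD(1)[OF S] S''] .
  have sub': "subspace K S (V\<lparr>carrier := S'\<rparr>)"
    by (rule subspace_subset[OF S S'' sub])
  note dim = V'.fin_dim_subspace[OF fin sub', simplified]
  show "finsub K V S" "subdim K V S \<le> subdim K V S'" "subdim K V S = subdim K V S' \<Longrightarrow> S = S'"
    using S dim by (auto simp: finsub_def subdim_def)
qed

lemma finsub_carrier: "vectorspace K V \<Longrightarrow> vectorspace.fin_dim K V \<Longrightarrow> finsub K V (carrier V)"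
  by (simp add: finsub_def subspace_carrier)

lemma image_rank_nullity:
  assumes T: "linear_map K V W T" and S: "finsub K V S"
  shows "finsub K W (T ` S)"
    "subdim K W (T ` S) + subdim K V {x \<in> S. T x = \<zero>\<^bsub>W\<^esub>} = subdim K V S"
    "subspace K {x \<in> S. T x = \<zero>\<^bsub>W\<^esub>} V"
proof -
  have S': "subspace K S V" and fin: "vectorspace.fin_dim K (V\<lparr>carrier := S\<rparr>)"
    using S by (auto simp: finsub_def)
  interpret T: linear_map K "V\<lparr>carrier := S\<rparr>" W T
    by (rule linear_map_restrict[OF T S'])
  have im: "T.im = T ` S" and ker: "T.ker = {x \<in> S. T x = \<zero>\<^bsub>W\<^esub>}"
    by (auto simp: T.im_def T.ker_def)
  show "subdim K W (T ` S) + subdim K V {x \<in> S. T x = \<zero>\<^bsub>W\<^esub>} = subdim K V S"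
    using T.rank_nullity[OF fin] by (simp add: subdim_def im ker)
  have sub: "subspace K (T ` S) W"
    by (rule subspace_image[OF T S'])
  interpret I: vectorspace K "W\<lparr>carrier := T ` S\<rparr>"
    by (rule vectorspace.subspace_is_vs[OF linear_mapD(2)[OF T] sub])
  have "linear_map K (V\<lparr>carrier := S\<rparr>) (W\<lparr>carrier := T ` S\<rparr>) T"
    by (rule linear_mapI)
      (use T.V.vectorspace_axioms I.vectorspace_axioms subspaceD(2)[OF S'] linear_mapD(4,5)[OF T]
       in \<open>auto simp: subset_eq\<close>)
  then have "I.fin_dim"
    by (rule linear_map.rank_nullity_main(2)) (use fin in auto)
  then show "finsub K W (T ` S)"
    using sub by (simp add: finsub_def)
  note D = linear_mapD[OF T]
  interpret W: vectorspace K W by (rule D(2))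
  show "subspace K {x \<in> S. T x = \<zero>\<^bsub>W\<^esub>} V"
    by (rule submoduleI') (use D subspaceD[OF S'] in \<open>auto simp: subset_eq\<close>)
qed

text \<open>By rank-nullity this compares the kernel of \<open>T\<close> on \<open>J\<close> with its kernel on \<open>I\<close>.\<close>

lemma subdim_image_diff_le:
  assumes T: "linear_map K V W T" and I: "finsub K V I" and J: "subspace K J V" and "J \<subseteq> I"
  shows "int (subdim K W (T ` I)) - int (subdim K W (T ` J)) \<le> int (subdim K V I) - int (subdim K V J)"
proof -
  have J': "finsub K V J"
    by (rule finsub_mono[OF J I \<open>J \<subseteq> I\<close>])
  have "finsub K V {x \<in> I. T x = \<zero>\<^bsub>W\<^esub>}"
    by (rule finsub_mono[OF image_rank_nullity(3)[OF T I] I]) auto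
  then have "subdim K V {x \<in> J. T x = \<zero>\<^bsub>W\<^esub>} \<le> subdim K V {x \<in> I. T x = \<zero>\<^bsub>W\<^esub>}"
    by (rule finsub_mono[OF image_rank_nullity(3)[OF T J']]) (use \<open>J \<subseteq> I\<close> in auto)
  then show ?thesis
    using image_rank_nullity(2)[OF T I] image_rank_nullity(2)[OF T J'] by linarith
qed

lemma subdim_image_le:
  assumes T: "linear_map K V W T" and I: "finsub K V I"
  shows "subdim K W (T ` I) \<le> subdim K V I"
  using image_rank_nullity(2)[OF T I] by linarith

text \<open>From the index on at which the dimension is least, nested subspaces have equal dimension
  and so coincide.\<close>

lemma decreasing_subspaces_stabilize:
  assumes S: "\<And>n. subspace K (S n) V" and S0: "finsub K V (S 0)"
    and dec: "\<And>n. S (Suc n) \<subseteq> S n"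
  shows "\<exists>N. \<forall>n\<ge>N. S n = S N"
proof -
  have le: "S n \<subseteq> S m" if "m \<le> n" for m n
    using that by (induction rule: dec_induct) (use dec in blast)+
  have fin: "finsub K V (S n)" for n
    using finsub_mono(1)[OF S S0 le] by simp
  define N where "N = (ARG_MIN (\<lambda>n. subdim K V (S n)) n. True)"
  have N: "subdim K V (S N) \<le> subdim K V (S n)" for n
    unfolding N_def by (rule arg_min_nat_le) simp
  have "S n = S N" if "N \<le> n" for n
    using finsub_mono(2,3)[OF S fin le[OF that]] N[of n] by simp
  then show ?thesis by blast
qed

text \<open>\<open>V\<close> may be infinite-dimensional, so rank-nullity cannot be applied to
  \<open>T\<close>. By the kernel condition \<open>T\<close> factors through the image of
  \<open>g\<close>, which is a subspace of the finite-dimensional \<open>E\<close>, and rank-nullity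
  applies to the second factor.\<close>

lemma finsub_image_factor:
  assumes g: "linear_map K V E g" and T: "linear_map K V W T"
    and ker: "\<And>x. x \<in> carrier V \<Longrightarrow> g x = \<zero>\<^bsub>E\<^esub> \<Longrightarrow> T x = \<zero>\<^bsub>W\<^esub>"
    and E: "finsub K E (carrier E)"
  shows "finsub K W (T ` carrier V)"
proof -
  note G = linear_mapD[OF g] and TD = linear_mapD[OF T]
  interpret V: vectorspace K V by (rule G(1))
  interpret E: vectorspace K E by (rule G(2))
  interpret W: vectorspace K W by (rule TD(2))
  define I where "I = g ` carrier V"
  have subI: "subspace K I E"
    unfolding I_def by (rule subspace_image[OF g subspace_carrier[OF G(1)]])
  have I: "finsub K E I"
    by (rule finsub_mono[OF subI E]) (use G(3) in \<open>auto simp: I_def\<close>)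
  have eq: "T x = T y" if xy: "x \<in> carrier V" "y \<in> carrier V" "g x = g y" for x y
  proof -
    have m: "\<ominus>\<^bsub>V\<^esub> y = (\<ominus>\<^bsub>K\<^esub> \<one>\<^bsub>K\<^esub>) \<odot>\<^bsub>V\<^esub> y"
      using V.smult_minus_1_back xy by simp
    let ?m = "\<ominus>\<^bsub>K\<^esub> \<one>\<^bsub>K\<^esub>"
    have c: "?m \<in> carrier K" "?m \<odot>\<^bsub>V\<^esub> y \<in> carrier V"
      using xy by auto
    have "g (x \<oplus>\<^bsub>V\<^esub> ?m \<odot>\<^bsub>V\<^esub> y) = g y \<oplus>\<^bsub>E\<^esub> ?m \<odot>\<^bsub>E\<^esub> g y"
      using G(4)[OF xy(1) c(2)] G(5)[OF c(1) xy(2)] xy(3) by simp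
    also have "\<dots> = \<zero>\<^bsub>E\<^esub>"
      using G(3) xy(2) E.smult_minus_1[of "g y"] by (auto simp: Pi_iff E.M.r_neg)
    finally have "T (x \<oplus>\<^bsub>V\<^esub> ?m \<odot>\<^bsub>V\<^esub> y) = \<zero>\<^bsub>W\<^esub>"
      using ker xy(1) c by auto
    then have "T x \<oplus>\<^bsub>W\<^esub> ?m \<odot>\<^bsub>W\<^esub> T y = \<zero>\<^bsub>W\<^esub>"
      using TD(4)[OF xy(1) c(2)] TD(5)[OF c(1) xy(2)] by simp
    then have "T x \<oplus>\<^bsub>W\<^esub> \<ominus>\<^bsub>W\<^esub> T y = \<zero>\<^bsub>W\<^esub>"
      using W.smult_minus_1[of "T y"] TD(3) xy(2) by (auto simp: Pi_iff)
    then show ?thesis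
      using TD(3) xy W.M.minus_equality by (metis PiE W.M.a_inv_closed W.M.minus_minus)
  qed
  \<comment> \<open>The induced map on the image of \<open>g\<close>; \<open>eq\<close> says that
    the chosen preimage does not matter.\<close>
  define T' where "T' y = T (SOME x. x \<in> carrier V \<and> g x = y)" for y
  have T': "T' (g x) = T x" if "x \<in> carrier V" for x
    unfolding T'_def
    by (rule eq) (use that someI[of "\<lambda>z. z \<in> carrier V \<and> g z = g x" x] in auto)
  have vsI: "vectorspace K (E\<lparr>carrier := I\<rparr>)"
    by (rule vectorspace.subspace_is_vs[OF G(2) subI])
  have lin: "linear_map K (E\<lparr>carrier := I\<rparr>) W T'"
  proof (rule linear_mapI[OF vsI TD(2)])
    show "T' \<in> carrier (E\<lparr>carrier := I\<rparr>) \<rightarrow> carrier W"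
      using T' TD(3) by (auto simp: I_def)
    show "T' (x \<oplus>\<^bsub>E\<lparr>carrier := I\<rparr>\<^esub> y) = T' x \<oplus>\<^bsub>W\<^esub> T' y"
      if xy: "x \<in> carrier (E\<lparr>carrier := I\<rparr>)" "y \<in> carrier (E\<lparr>carrier := I\<rparr>)" for x y
    proof -
      obtain a b where "a \<in> carrier V" "x = g a" "b \<in> carrier V" "y = g b"
        using xy by (auto simp: I_def)
      then show ?thesis
        using T'[of "a \<oplus>\<^bsub>V\<^esub> b"] G(4) TD(4) T' by simp
    qed
    show "T' (a \<odot>\<^bsub>E\<lparr>carrier := I\<rparr>\<^esub> x) = a \<odot>\<^bsub>W\<^esub> T' x"
      if ax: "a \<in> carrier K" "x \<in> carrier (E\<lparr>carrier := I\<rparr>)" for a x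
    proof -
      obtain b where "b \<in> carrier V" "x = g b"
        using ax by (auto simp: I_def)
      then show ?thesis
        using T'[of "a \<odot>\<^bsub>V\<^esub> b"] G(5) TD(5) T' ax by simp
    qed
  qed
  have "finsub K (E\<lparr>carrier := I\<rparr>) (carrier (E\<lparr>carrier := I\<rparr>))"
    using I vsI by (intro finsub_carrier) (auto simp: finsub_def)
  from image_rank_nullity(1)[OF lin this] have "finsub K W (T' ` I)"
    by simp
  moreover have "T' ` I = T ` carrier V"
    using T' by (auto simp: I_def image_image)
  ultimately show ?thesis by simp
qed


subsection \<open>Homology of nerves\<close>

lemma coeff_field_simps [simp]:
  "carrier coeff_field = UNIV" "x \<otimes>\<^bsub>coeff_field\<^esub> y = x * y" "x \<oplus>\<^bsub>coeff_field\<^esub> y = x + y"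
  "\<one>\<^bsub>coeff_field\<^esub> = 1" "\<zero>\<^bsub>coeff_field\<^esub> = 0"
  by (simp_all add: coeff_field_def)

lemma field_coeff_field: "Ring.field (coeff_field :: 'k::field ring)"
proof (rule cring.cring_fieldI2)
  have "\<exists>y. x + y = 0" for x :: 'k
    by (rule exI[of _ "- x"]) simp
  then show "cring (coeff_field :: 'k ring)"
    by (intro cringI abelian_groupI Group.comm_monoidI) (simp_all add: algebra_simps)
  show "\<exists>b\<in>carrier coeff_field. a \<otimes>\<^bsub>coeff_field\<^esub> b = \<one>\<^bsub>coeff_field\<^esub>"
    if "a \<in> carrier coeff_field" "a \<noteq> \<zero>\<^bsub>coeff_field\<^esub>" for a :: 'k
    by (rule bexI[of _ "inverse a"]) (use that in simp_all)
qed simp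

definition hom_class :: "'v set set \<Rightarrow> int \<Rightarrow> ('v list \<Rightarrow>\<^sub>0 'k::field) \<Rightarrow> ('v list \<Rightarrow>\<^sub>0 'k) set" where
  "hom_class K k z = {z + b | b. b \<in> boundaries K k}"

lemma hom_class_eq_iff: "hom_class K k z = hom_class K k z' \<longleftrightarrow> z - z' \<in> boundaries K k"
proof
  assume eq: "hom_class K k z = hom_class K k z'"
  have "z \<in> hom_class K k z"
    unfolding hom_class_def using boundaries_subspace(1) by force
  then obtain b where "b \<in> boundaries K k" "z = z' + b"
    unfolding eq by (auto simp: hom_class_def)
  then show "z - z' \<in> boundaries K k" by simp
next
  assume d: "z - z' \<in> boundaries K k"
  show "hom_class K k z = hom_class K k z'"
  proof (intro equalityI subsetI)
    fix x assume "x \<in> hom_class K k z"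
    then obtain b where "b \<in> boundaries K k" "x = z + b" by (auto simp: hom_class_def)
    then have "x = z' + ((z - z') + b)" "(z - z') + b \<in> boundaries K k"
      using boundaries_subspace(2)[OF d] by auto
    then show "x \<in> hom_class K k z'" unfolding hom_class_def by blast
  next
    fix x assume "x \<in> hom_class K k z'"
    then obtain b where "b \<in> boundaries K k" "x = z' + b" by (auto simp: hom_class_def)
    then have "x = z + (b - (z - z'))" "b - (z - z') \<in> boundaries K k"
      using boundaries_diff[OF _ d] by auto
    then show "x \<in> hom_class K k z" unfolding hom_class_def by blast
  qed
qed

lemma carrier_simplicial_homology: "carrier (simplicial_homology k K) = hom_class K k ` cycles K k"
  by (auto simp: simplicial_homology_def hom_class_def)

lemma zero_simplicial_homology: "\<zero>\<^bsub>simplicial_homology k K\<^esub> = hom_class K k 0"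
  by (simp add: simplicial_homology_def hom_class_def)

lemma add_simplicial_homology:
  "hom_class K k z \<oplus>\<^bsub>simplicial_homology k K\<^esub> hom_class K k z' = hom_class K k (z + z')"
proof -
  have "{c + d |c d. c \<in> hom_class K k z \<and> d \<in> hom_class K k z'} = hom_class K k (z + z')"
  proof (intro equalityI subsetI)
    fix x assume "x \<in> {c + d |c d. c \<in> hom_class K k z \<and> d \<in> hom_class K k z'}"
    then obtain b b' where "b \<in> boundaries K k" "b' \<in> boundaries K k" "x = (z + b) + (z' + b')"
      unfolding hom_class_def by blast
    then have "x = (z + z') + (b + b')" "b + b' \<in> boundaries K k"
      using boundaries_subspace(2) by auto
    then show "x \<in> hom_class K k (z + z')" unfolding hom_class_def by blast
  next
    fix x assume "x \<in> hom_class K k (z + z')"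
    then obtain b where "b \<in> boundaries K k" "x = z + z' + b" unfolding hom_class_def by blast
    then have "x = (z + 0) + (z' + b)" by simp
    with \<open>b \<in> _\<close> boundaries_subspace(1)[of K k]
    show "x \<in> {c + d |c d. c \<in> hom_class K k z \<and> d \<in> hom_class K k z'}"
      unfolding hom_class_def by blast
  qed
  then show ?thesis by (simp add: simplicial_homology_def)
qed

lemma smult_simplicial_homology:
  "a \<odot>\<^bsub>simplicial_homology k K\<^esub> hom_class K k z = hom_class K k (scale_chain a z)"
proof -
  have "{scale_chain a c + b |c b. c \<in> hom_class K k z \<and> b \<in> boundaries K k} = hom_class K k (scale_chain a z)"
  proof (intro equalityI subsetI)
    fix x assume "x \<in> {scale_chain a c + b |c b. c \<in> hom_class K k z \<and> b \<in> boundaries K k}"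
    then obtain b b' where "b \<in> boundaries K k" "b' \<in> boundaries K k" "x = scale_chain a (z + b) + b'"
      unfolding hom_class_def by blast
    then have "x = scale_chain a z + (scale_chain a b + b')" "scale_chain a b + b' \<in> boundaries K k"
      by (auto simp: scale_chain_algebra boundaries_subspace)
    then show "x \<in> hom_class K k (scale_chain a z)" unfolding hom_class_def by blast
  next
    fix x assume "x \<in> hom_class K k (scale_chain a z)"
    then obtain b where "b \<in> boundaries K k" "x = scale_chain a (z + 0) + b"
      unfolding hom_class_def by auto
    with boundaries_subspace(1)[of K k]
    show "x \<in> {scale_chain a c + b |c b. c \<in> hom_class K k z \<and> b \<in> boundaries K k}"
      unfolding hom_class_def by blast
  qed
  then show ?thesis by (simp add: simplicial_homology_def)
qed

lemma simplicial_induced_hom_class: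
  assumes p: "simplicial_map K L p"
  shows "simplicial_induced k L p (hom_class K k z) = hom_class L k (push_chain p z)"
proof (intro equalityI subsetI)
  fix x assume "x \<in> simplicial_induced k L p (hom_class K k z)"
  then obtain b b' where "b \<in> boundaries K k" "b' \<in> boundaries L k" "x = push_chain p (z + b) + b'"
    unfolding hom_class_def simplicial_induced_def by blast
    then have "x = push_chain p z + (push_chain p b + b')" "push_chain p b + b' \<in> boundaries L k"
    using push_chain_boundaries[OF p, of b k] by (auto simp: chain_lin_simps intro: boundaries_subspace(2))
  then show "x \<in> hom_class L k (push_chain p z)" unfolding hom_class_def by blast
next
  fix x assume "x \<in> hom_class L k (push_chain p z)"
  then obtain b where "b \<in> boundaries L k" "x = push_chain p (z + 0) + b"
    unfolding hom_class_def by auto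
  with boundaries_subspace(1)[of K k]
  show "x \<in> simplicial_induced k L p (hom_class K k z)"
    unfolding hom_class_def simplicial_induced_def by blast
qed

lemmas simplicial_homology_simps =
  carrier_simplicial_homology zero_simplicial_homology add_simplicial_homology smult_simplicial_homology

lemma vectorspace_simplicial_homology:
  "vectorspace coeff_field (simplicial_homology k K :: ('k::field, _) module)"
proof (rule vs_criteria)
  let ?H = "simplicial_homology k K :: ('k, _) module"
  show "\<forall>v\<in>carrier ?H. \<exists>neg_v\<in>carrier ?H. v \<oplus>\<^bsub>?H\<^esub> neg_v = \<zero>\<^bsub>?H\<^esub>"
  proof
    fix v assume "v \<in> carrier ?H"
    then obtain z where z: "z \<in> cycles K k" "v = hom_class K k z" by (auto simp: simplicial_homology_simps)
    have "hom_class K k (scale_chain (-1) z) \<in> carrier ?H"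
      using cycles_subspace(3)[OF z(1)] by (simp add: simplicial_homology_simps)
    moreover have "v \<oplus>\<^bsub>?H\<^esub> hom_class K k (scale_chain (-1) z) = \<zero>\<^bsub>?H\<^esub>"
      by (simp add: z simplicial_homology_simps scale_chain_algebra)
    ultimately show "\<exists>neg_v\<in>carrier ?H. v \<oplus>\<^bsub>?H\<^esub> neg_v = \<zero>\<^bsub>?H\<^esub>" by blast
  qed
  have rep: "\<exists>z. z \<in> cycles K k \<and> v = hom_class K k z" if "v \<in> carrier ?H" for v
    using that by (auto simp: simplicial_homology_simps)
  show "\<zero>\<^bsub>?H\<^esub> \<in> carrier ?H"
    using cycles_subspace(1) by (auto simp: simplicial_homology_simps)
  show "\<forall>v w. v \<in> carrier ?H \<and> w \<in> carrier ?H \<longrightarrow> v \<oplus>\<^bsub>?H\<^esub> w \<in> carrier ?H"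
    by (auto simp: simplicial_homology_simps intro!: imageI cycles_subspace(2))
  show "\<forall>c v. c \<in> carrier coeff_field \<and> v \<in> carrier ?H \<longrightarrow> c \<odot>\<^bsub>?H\<^esub> v \<in> carrier ?H"
    by (auto simp: simplicial_homology_simps intro!: imageI cycles_subspace(3))
qed (auto simp: field_coeff_field simplicial_homology_simps scale_chain_algebra add_ac)

lemma simplicial_induced_linear:
  assumes p: "simplicial_map K L p"
  shows "linear_map coeff_field (simplicial_homology k K :: ('k::field, _) module)
    (simplicial_homology k L) (simplicial_induced k L p)"
  by (rule linear_mapI[OF vectorspace_simplicial_homology vectorspace_simplicial_homology])
    (auto simp: simplicial_homology_simps simplicial_induced_hom_class[OF p] chain_lin_simps
      push_chain_cycles[OF p])

lemma simplicial_induced_contiguous: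
  assumes "asc L" "asc K" "contiguous K L p q" "simplicial_map K L p" "simplicial_map K L q"
    and "x \<in> carrier (simplicial_homology k K)"
  shows "simplicial_induced k L p x = simplicial_induced k L q x"
proof -
  obtain z where z: "z \<in> cycles K k" "x = hom_class K k z"
    using assms by (auto simp: simplicial_homology_simps)
  have "contiguous K L q p" using assms(3) by (simp add: contiguous_def Un_commute)
  then have "push_chain p z - push_chain q z \<in> boundaries L k"
    using contiguous_homologous[of L K q p z k] assms z by (auto simp: asc_def)
  then show ?thesis
    by (simp add: z simplicial_induced_hom_class assms hom_class_eq_iff)
qed

lemma simplicial_induced_comp:
  assumes "simplicial_map K L p" "simplicial_map L M q" "x \<in> carrier (simplicial_homology k K)"
  shows "simplicial_induced k M q (simplicial_induced k L p x) = simplicial_induced k M (q \<circ> p) x"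
    and "simplicial_map K M (q \<circ> p)"
proof -
  show "simplicial_map K M (q \<circ> p)"
    using assms(1,2) unfolding simplicial_map_def by (metis image_comp)
  then show "simplicial_induced k M q (simplicial_induced k L p x) = simplicial_induced k M (q \<circ> p) x"
    using assms by (auto simp: simplicial_homology_simps simplicial_induced_hom_class push_chain_comp)
qed

section \<open>Finite-dimensionality of the homology of a finite complex\<close>

definition chain_space :: "'v list set \<Rightarrow> ('k::field, 'v list \<Rightarrow>\<^sub>0 'k) module" where
  "chain_space F = \<lparr>carrier = {c. Poly_Mapping.keys c \<subseteq> F}, monoid.mult = undefined, one = undefined,
     zero = 0, add = (+), smult = scale_chain\<rparr>"

lemma vectorspace_chain_space: "vectorspace coeff_field (chain_space F :: ('k::field, _) module)"
proof (rule vs_criteria)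
  let ?C = "chain_space F :: ('k, _) module"
  show "\<forall>v\<in>carrier ?C. \<exists>neg_v\<in>carrier ?C. v \<oplus>\<^bsub>?C\<^esub> neg_v = \<zero>\<^bsub>?C\<^esub>"
  proof
    fix v assume "v \<in> carrier ?C"
    then show "\<exists>neg_v\<in>carrier ?C. v \<oplus>\<^bsub>?C\<^esub> neg_v = \<zero>\<^bsub>?C\<^esub>"
      by (intro bexI[of _ "- v"]) (simp_all add: chain_space_def)
  qed
  show "\<forall>v w. v \<in> carrier ?C \<and> w \<in> carrier ?C \<longrightarrow> v \<oplus>\<^bsub>?C\<^esub> w \<in> carrier ?C"
    using Poly_Mapping.keys_add by (fastforce simp: chain_space_def)
  show "\<forall>c v. c \<in> carrier coeff_field \<and> v \<in> carrier ?C \<longrightarrow> c \<odot>\<^bsub>?C\<^esub> v \<in> carrier ?C"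
    using keys_scale_chain by (fastforce simp: chain_space_def)
qed (auto simp: field_coeff_field chain_space_def scale_chain_algebra add_ac)

lemma finsub_chain_space:
  assumes "finite F"
  shows "finsub coeff_field (chain_space F :: ('k::field, _) module) (carrier (chain_space F))"
proof (rule finsub_carrier[OF vectorspace_chain_space])
  let ?C = "chain_space F :: ('k, _) module"
  interpret C: vectorspace coeff_field ?C by (rule vectorspace_chain_space)
  define A where "A = (\<lambda>\<sigma>. Poly_Mapping.single \<sigma> (1::'k)) ` F"
  have A: "finite A" "A \<subseteq> carrier ?C"
    using assms by (auto simp: A_def chain_space_def)
  have sub: "subspace coeff_field (C.span A) ?C"
    by (rule C.span_is_subspace[OF A(2)])
  note D = subspaceD[OF sub]
  have "c \<in> C.span A" if "c \<in> carrier ?C" for c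
  proof -
    have mem: "sum f I \<in> C.span A" if "\<And>i. i \<in> I \<Longrightarrow> f i \<in> C.span A"
      for f :: "_ \<Rightarrow> _ \<Rightarrow>\<^sub>0 'k" and I :: "'a list set"
      using that
      by (induction I rule: infinite_finite_induct)
        (use D(3,4) in \<open>auto simp: chain_space_def\<close>)
    have "Poly_Mapping.single \<sigma> a \<in> C.span A" if "\<sigma> \<in> F" for \<sigma> and a :: 'k
    proof -
      have "Poly_Mapping.single \<sigma> 1 \<in> C.span A"
        using C.in_own_span[OF A(2)] that by (auto simp: A_def)
      then show ?thesis
        using D(5)[of a "Poly_Mapping.single \<sigma> 1"] by (simp add: chain_space_def)
    qed
    then have "(\<Sum>\<sigma>\<in>Poly_Mapping.keys c. Poly_Mapping.single \<sigma> (Poly_Mapping.lookup c \<sigma>)) \<in> C.span A"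
      using that by (intro mem) (auto simp: chain_space_def)
    then show ?thesis by (simp flip: chain_expand)
  qed
  then have "C.gen_set A" using D(2) by auto
  then show "C.fin_dim" using A by (auto simp: C.fin_dim_def)
qed

text \<open>Although tuples may repeat vertices, a finite vertex set has only finitely many tuples
  of a given length. Homology is the image of the cycles under \<open>hom_class K k\<close>.\<close>

lemma finsub_simplicial_homology:
  fixes K :: "'v set set"
  assumes "finite (\<Union>K)"
  shows "finsub coeff_field (simplicial_homology k K :: ('k::field, _) module) (carrier (simplicial_homology k K))"
proof -
  define F where "F = {\<sigma>. set \<sigma> \<in> K \<and> int (length \<sigma>) = k + 1}"
  have "F \<subseteq> {\<sigma>. set \<sigma> \<subseteq> \<Union>K \<and> length \<sigma> = nat (k + 1)}" by (auto simp: F_def)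
  then have "finite F"
    by (rule finite_subset) (rule finite_lists_length_eq[OF assms])
  let ?C = "chain_space F :: ('k, _) module"
  have chains: "simplicial_chains K k = carrier ?C"
    by (auto simp: simplicial_chains_def chain_space_def F_def)
  have sub: "subspace coeff_field (cycles K k) ?C"
  proof (rule submoduleI'[OF vectorspace_chain_space])
    show "cycles K k \<subseteq> carrier ?C" by (auto simp: cycles_def chains)
  qed (simp_all add: chain_space_def cycles_subspace)
  have fin: "finsub coeff_field ?C (cycles K k)"
    by (rule finsub_mono(1)[OF sub finsub_chain_space[OF \<open>finite F\<close>] subspaceD(2)[OF sub]])
  let ?Z = "?C\<lparr>carrier := cycles K k\<rparr>"
  have Z: "vectorspace coeff_field ?Z"
    by (rule vectorspace.subspace_is_vs[OF vectorspace_chain_space sub])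
  have lin: "linear_map coeff_field ?Z (simplicial_homology k K) (hom_class K k)"
    by (rule linear_mapI[OF Z vectorspace_simplicial_homology])
      (auto simp: simplicial_homology_simps chain_space_def)
  have "finsub coeff_field ?Z (carrier ?Z)"
    using fin by (intro finsub_carrier[OF Z]) (simp add: finsub_def)
  from image_rank_nullity(1)[OF lin this] show ?thesis
    by (simp add: carrier_simplicial_homology)
qed

section \<open>Nerves and the maps between them\<close>

lemma asc_nerve: "asc (nerve \<U>)"
  unfolding asc_def
proof (intro conjI ballI allI impI)
  show "{} \<notin> nerve \<U>" by (simp add: nerve_def)
  fix S S' assume "S \<in> nerve \<U>" "S' \<subseteq> S" "S' \<noteq> {}"
  moreover from this have "\<Inter>S \<subseteq> \<Inter>S'" by blast
  ultimately show "S' \<in> nerve \<U>"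
    by (auto simp: nerve_def intro: finite_subset)
qed

text \<open>Refinement maps are the case where \<open>\<rho>\<close> is the identity. A general \<open>\<rho>\<close>, which need not be
  continuous, compares covers of different spaces.\<close>

definition tracks :: "('a \<Rightarrow> 'b) \<Rightarrow> 'a set set \<Rightarrow> 'b set set \<Rightarrow> ('a set \<Rightarrow> 'b set) \<Rightarrow> bool" where
  "tracks \<rho> \<U> \<V> p \<longleftrightarrow> (\<forall>U\<in>\<U>. p U \<in> \<V> \<and> \<rho> ` U \<subseteq> p U)"

lemma refinement_map_iff_tracks: "refinement_map \<U> \<V> p \<longleftrightarrow> tracks (\<lambda>x. x) \<U> \<V> p"
  by (auto simp: refinement_map_def tracks_def)

text \<open>If x is common to the members of a simplex, then \<open>\<rho> x\<close> is common to
  their images under \<open>p\<close> and under \<open>q\<close> together.\<close>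

lemma tracks_contiguous:
  assumes "tracks \<rho> \<U> \<V> p" "tracks \<rho> \<U> \<V> q"
  shows "contiguous (nerve \<U>) (nerve \<V>) p q"
  unfolding contiguous_def
proof
  fix S assume "S \<in> nerve \<U>"
  then have S: "S \<subseteq> \<U>" "finite S" "S \<noteq> {}" "\<Inter>S \<noteq> {}"
    by (auto simp: nerve_def)
  then obtain x where x: "x \<in> \<Inter>S"
    by blast
  have pq: "p U \<in> \<V>" "q U \<in> \<V>" "\<rho> x \<in> p U" "\<rho> x \<in> q U" if "U \<in> S" for U
  proof -
    have "U \<in> \<U>" "\<rho> x \<in> \<rho> ` U" using S(1) x that by auto
    then show "p U \<in> \<V>" "q U \<in> \<V>" "\<rho> x \<in> p U" "\<rho> x \<in> q U"
      using assms unfolding tracks_def by blast+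
  qed
  then have "\<rho> x \<in> \<Inter>(p ` S \<union> q ` S)"
    by auto
  then have "\<Inter>(p ` S \<union> q ` S) \<noteq> {}"
    by blast
  then show "p ` S \<union> q ` S \<in> nerve \<V>"
    using S pq by (auto simp: nerve_def)
qed

lemma tracks_simplicial_map: "tracks \<rho> \<U> \<V> p \<Longrightarrow> simplicial_map (nerve \<U>) (nerve \<V>) p"
  using tracks_contiguous[of \<rho> \<U> \<V> p p] by (simp add: contiguous_def simplicial_map_def)

lemma tracks_comp: "tracks \<rho> \<U> \<V> p \<Longrightarrow> tracks \<rho>' \<V> \<W> q \<Longrightarrow> tracks (\<rho>' \<circ> \<rho>) \<U> \<W> (q \<circ> p)"
  unfolding tracks_def by fastforce

lemma tracks_induced_eq:
  assumes "tracks \<rho> \<U> \<V> p" "tracks \<rho> \<U> \<V> q" "x \<in> carrier (simplicial_homology k (nerve \<U>))"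
  shows "simplicial_induced k (nerve \<V>) p x = simplicial_induced k (nerve \<V>) q x"
  by (rule simplicial_induced_contiguous[OF asc_nerve asc_nerve tracks_contiguous[OF assms(1,2)]
        tracks_simplicial_map[OF assms(1)] tracks_simplicial_map[OF assms(2)] assms(3)])

lemma tracks_induced_comp:
  assumes "tracks \<rho> \<U> \<V> p" "tracks \<rho>' \<V> \<W> q" "x \<in> carrier (simplicial_homology k (nerve \<U>))"
  shows "simplicial_induced k (nerve \<W>) q (simplicial_induced k (nerve \<V>) p x)
    = simplicial_induced k (nerve \<W>) (q \<circ> p) x"
  by (rule simplicial_induced_comp(1)[OF tracks_simplicial_map[OF assms(1)] tracks_simplicial_map[OF assms(2)] assms(3)])

lemma tracks_induced_carrier:
  assumes "tracks \<rho> \<U> \<V> p" "x \<in> carrier (simplicial_homology k (nerve \<U>))"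
  shows "simplicial_induced k (nerve \<V>) p x \<in> carrier (simplicial_homology k (nerve \<V>))"
  using linear_mapD(3)[OF simplicial_induced_linear[OF tracks_simplicial_map[OF assms(1)]]] assms(2)
  by auto


subsection \<open>Functoriality of Cech homology\<close>

abbreviation nerve_homology :: "int \<Rightarrow> 'a set set \<Rightarrow> ('k::field, ('a set list \<Rightarrow>\<^sub>0 'k) set) module" where
  "nerve_homology k \<U> \<equiv> simplicial_homology k (nerve \<U>)"

lemma cech_carrierD:
  assumes "c \<in> carrier (cech_homology k A)"
  shows "\<U> \<in> open_covers A \<Longrightarrow> c \<U> \<in> carrier (nerve_homology k \<U>)"
    and "\<U> \<in> open_covers A \<Longrightarrow> \<V> \<in> open_covers A \<Longrightarrow> tracks (\<lambda>x. x) \<U> \<V> p \<Longrightarrow>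
      simplicial_induced k (nerve \<V>) p (c \<U>) = c \<V>"
    and "c \<in> extensional (open_covers A)"
  using assms by (auto simp: cech_homology_def PiE_iff refinement_map_iff_tracks)

lemma cech_carrierI:
  assumes "c \<in> extensional (open_covers A)"
    and "\<And>\<U>. \<U> \<in> open_covers A \<Longrightarrow> c \<U> \<in> carrier (nerve_homology k \<U>)"
    and "\<And>\<U> \<V> p. \<U> \<in> open_covers A \<Longrightarrow> \<V> \<in> open_covers A \<Longrightarrow> tracks (\<lambda>x. x) \<U> \<V> p \<Longrightarrow>
      simplicial_induced k (nerve \<V>) p (c \<U>) = c \<V>"
  shows "c \<in> carrier (cech_homology k A)"
  using assms by (auto simp: cech_homology_def PiE_iff refinement_map_iff_tracks)

lemma cech_eqI:
  assumes "c \<in> extensional (open_covers A)" "d \<in> extensional (open_covers A)"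
    and "\<And>\<U>. \<U> \<in> open_covers A \<Longrightarrow> c \<U> = d \<U>"
  shows "c = d"
  using assms by (rule extensionalityI)

lemma cech_ops:
  "\<U> \<in> open_covers A \<Longrightarrow> (c \<oplus>\<^bsub>cech_homology k A\<^esub> d) \<U> = c \<U> \<oplus>\<^bsub>nerve_homology k \<U>\<^esub> d \<U>"
  "\<U> \<in> open_covers A \<Longrightarrow> (a \<odot>\<^bsub>cech_homology k A\<^esub> c) \<U> = a \<odot>\<^bsub>nerve_homology k \<U>\<^esub> c \<U>"
  "\<U> \<in> open_covers A \<Longrightarrow> \<zero>\<^bsub>cech_homology k A\<^esub> \<U> = \<zero>\<^bsub>nerve_homology k \<U>\<^esub>"
  "c \<oplus>\<^bsub>cech_homology k A\<^esub> d \<in> extensional (open_covers A)"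
  "a \<odot>\<^bsub>cech_homology k A\<^esub> c \<in> extensional (open_covers A)"
  "\<zero>\<^bsub>cech_homology k A\<^esub> \<in> extensional (open_covers A)"
  by (auto simp: cech_homology_def)

lemma tracks_induced_linear:
  fixes \<rho> :: "'a \<Rightarrow> 'b"
  assumes "tracks \<rho> \<U> \<V> p"
  shows "linear_map coeff_field (nerve_homology k \<U> :: ('k::field, _) module) (nerve_homology k \<V>)
    (simplicial_induced k (nerve \<V>) p)"
  by (rule simplicial_induced_linear[OF tracks_simplicial_map[OF assms]])

lemma vectorspace_cech: "vectorspace coeff_field (cech_homology k A :: ('k::field, _) module)"
proof (rule vs_criteria)
  let ?C = "cech_homology k A :: ('k, _) module"
  let ?H = "\<lambda>\<U>. nerve_homology k \<U> :: ('k, _) module"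
  have vs: "vectorspace coeff_field (?H \<U>)" for \<U> :: "'a set set"
    by (rule vectorspace_simplicial_homology)
  note mod = vectorspace.axioms(1)[OF vs]
  note grp = Module.module.axioms(2)[OF mod]
  note mon = abelian_group.axioms(1)[OF grp]
  show add: "\<forall>v w. v \<in> carrier ?C \<and> w \<in> carrier ?C \<longrightarrow> v \<oplus>\<^bsub>?C\<^esub> w \<in> carrier ?C"
  proof (intro allI impI)
    fix v w assume vw: "v \<in> carrier ?C \<and> w \<in> carrier ?C"
    then have v: "v \<in> carrier ?C" and w: "w \<in> carrier ?C" by auto
    show "v \<oplus>\<^bsub>?C\<^esub> w \<in> carrier ?C"
    proof (rule cech_carrierI)
      show "simplicial_induced k (nerve \<V>) p ((v \<oplus>\<^bsub>?C\<^esub> w) \<U>) = (v \<oplus>\<^bsub>?C\<^esub> w) \<V>"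
        if "\<U> \<in> open_covers A" "\<V> \<in> open_covers A" "tracks (\<lambda>x. x) \<U> \<V> p" for \<U> \<V> p
        using linear_mapD(4)[OF tracks_induced_linear[OF that(3)] cech_carrierD(1)[OF v that(1)] cech_carrierD(1)[OF w that(1)]]
        by (simp add: cech_ops that cech_carrierD(2)[OF v that] cech_carrierD(2)[OF w that])
    qed (simp_all add: cech_ops abelian_monoid.a_closed[OF mon] cech_carrierD[OF v] cech_carrierD[OF w])
  qed
  show smult: "\<forall>a v. a \<in> carrier coeff_field \<and> v \<in> carrier ?C \<longrightarrow> a \<odot>\<^bsub>?C\<^esub> v \<in> carrier ?C"
  proof (intro allI impI)
    fix v and a :: 'k assume "a \<in> carrier coeff_field \<and> v \<in> carrier ?C"
    then have v: "v \<in> carrier ?C" by auto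
    show "a \<odot>\<^bsub>?C\<^esub> v \<in> carrier ?C"
    proof (rule cech_carrierI)
      show "simplicial_induced k (nerve \<V>) p ((a \<odot>\<^bsub>?C\<^esub> v) \<U>) = (a \<odot>\<^bsub>?C\<^esub> v) \<V>"
        if "\<U> \<in> open_covers A" "\<V> \<in> open_covers A" "tracks (\<lambda>x. x) \<U> \<V> p" for \<U> \<V> p
        using linear_mapD(5)[OF tracks_induced_linear[OF that(3)] _ cech_carrierD(1)[OF v that(1)], of a]
        by (simp add: cech_ops that cech_carrierD(2)[OF v that])
    qed (simp_all add: cech_ops Module.module.smult_closed[OF mod] cech_carrierD[OF v])
  qed
  show "\<zero>\<^bsub>?C\<^esub> \<in> carrier ?C"
  proof (rule cech_carrierI)
    show "simplicial_induced k (nerve \<V>) p (\<zero>\<^bsub>?C\<^esub> \<U>) = \<zero>\<^bsub>?C\<^esub> \<V>"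
      if "\<U> \<in> open_covers A" "\<V> \<in> open_covers A" "tracks (\<lambda>x. x) \<U> \<V> p" for \<U> \<V> p
      using linear_mapD(6)[OF tracks_induced_linear[OF that(3)]] by (simp add: cech_ops that)
  qed (simp_all add: cech_ops abelian_monoid.zero_closed[OF mon])
  show "\<forall>v\<in>carrier ?C. \<exists>neg_v\<in>carrier ?C. v \<oplus>\<^bsub>?C\<^esub> neg_v = \<zero>\<^bsub>?C\<^esub>"
  proof
    fix v assume v: "v \<in> carrier ?C"
    let ?m = "(- 1) \<odot>\<^bsub>?C\<^esub> v"
    have "(v \<oplus>\<^bsub>?C\<^esub> ?m) \<U> = \<zero>\<^bsub>?C\<^esub> \<U>" if \<U>: "\<U> \<in> open_covers A" for \<U>
    proof -
      obtain z where "z \<in> cycles (nerve \<U>) k" "v \<U> = hom_class (nerve \<U>) k z"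
        using cech_carrierD(1)[OF v \<U>] by (auto simp: simplicial_homology_simps)
      then show ?thesis
        by (simp add: cech_ops \<U> simplicial_homology_simps scale_chain_algebra)
    qed
    then have "v \<oplus>\<^bsub>?C\<^esub> ?m = \<zero>\<^bsub>?C\<^esub>"
      by (intro cech_eqI[where A = A]) (simp_all add: cech_ops)
    moreover have "?m \<in> carrier ?C" using smult v by simp
    ultimately show "\<exists>neg_v\<in>carrier ?C. v \<oplus>\<^bsub>?C\<^esub> neg_v = \<zero>\<^bsub>?C\<^esub>" by blast
  qed
  note H = cech_carrierD(1)
  show "\<forall>v w. v \<in> carrier ?C \<and> w \<in> carrier ?C \<longrightarrow> v \<oplus>\<^bsub>?C\<^esub> w = w \<oplus>\<^bsub>?C\<^esub> v"
    by (intro allI impI cech_eqI[where A = A]) (auto simp: cech_ops H abelian_monoid.a_comm[OF mon])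
  show "\<forall>v w x. v \<in> carrier ?C \<and> w \<in> carrier ?C \<and> x \<in> carrier ?C \<longrightarrow>
      v \<oplus>\<^bsub>?C\<^esub> w \<oplus>\<^bsub>?C\<^esub> x = v \<oplus>\<^bsub>?C\<^esub> (w \<oplus>\<^bsub>?C\<^esub> x)"
    by (intro allI impI cech_eqI[where A = A]) (auto simp: cech_ops H abelian_monoid.a_assoc[OF mon])
  show "\<forall>v\<in>carrier ?C. v \<oplus>\<^bsub>?C\<^esub> \<zero>\<^bsub>?C\<^esub> = v"
    by (intro ballI cech_eqI[where A = A]) (auto simp: cech_ops H cech_carrierD(3) abelian_monoid.r_zero[OF mon])
  show "\<forall>a b v. a \<in> carrier coeff_field \<and> b \<in> carrier coeff_field \<and> v \<in> carrier ?C \<longrightarrow>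
      (a \<otimes>\<^bsub>coeff_field\<^esub> b) \<odot>\<^bsub>?C\<^esub> v = a \<odot>\<^bsub>?C\<^esub> (b \<odot>\<^bsub>?C\<^esub> v)"
    using Module.module.smult_assoc1[OF mod]
    by (intro allI impI cech_eqI[where A = A]) (auto simp: cech_ops H)
  show "\<forall>v\<in>carrier ?C. \<one>\<^bsub>coeff_field\<^esub> \<odot>\<^bsub>?C\<^esub> v = v"
    using Module.module.smult_one[OF mod]
    by (intro ballI cech_eqI[where A = A]) (auto simp: cech_ops H cech_carrierD(3))
  show "\<forall>a b v. a \<in> carrier coeff_field \<and> b \<in> carrier coeff_field \<and> v \<in> carrier ?C \<longrightarrow>
      (a \<oplus>\<^bsub>coeff_field\<^esub> b) \<odot>\<^bsub>?C\<^esub> v = a \<odot>\<^bsub>?C\<^esub> v \<oplus>\<^bsub>?C\<^esub> b \<odot>\<^bsub>?C\<^esub> v"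
    using Module.module.smult_l_distr[OF mod]
    by (intro allI impI cech_eqI[where A = A]) (auto simp: cech_ops H)
  show "\<forall>a v w. a \<in> carrier coeff_field \<and> v \<in> carrier ?C \<and> w \<in> carrier ?C \<longrightarrow>
      a \<odot>\<^bsub>?C\<^esub> (v \<oplus>\<^bsub>?C\<^esub> w) = a \<odot>\<^bsub>?C\<^esub> v \<oplus>\<^bsub>?C\<^esub> a \<odot>\<^bsub>?C\<^esub> w"
    using Module.module.smult_r_distr[OF mod]
    by (intro allI impI cech_eqI[where A = A]) (auto simp: cech_ops H)
qed (rule field_coeff_field)

lemma open_covers_restrict:
  assumes "A = subtopology B S" "\<V> \<in> open_covers B"
  shows "restrict_cover A \<V> \<in> open_covers A"
  unfolding open_covers_def
proof (intro CollectI conjI ballI)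
  fix U assume "U \<in> restrict_cover A \<V>"
  then obtain V where V: "V \<in> \<V>" "U = V \<inter> topspace A" by (auto simp: restrict_cover_def)
  have "openin B V" using V assms by (auto simp: open_covers_def)
  then show "openin A U"
    using V(2) assms(1) by (metis openin_subtopology_Int openin_topspace openin_Int inf_commute openin_subtopology topspace_subtopology inf.left_commute inf_assoc)
next
  show "\<Union> (restrict_cover A \<V>) = topspace A"
    using assms by (auto simp: restrict_cover_def open_covers_def)
qed

lemma restrict_cover_tracks:
  shows "\<exists>p. tracks (\<lambda>x. x) (restrict_cover A \<V>) \<V> p"
proof -
  have "\<forall>U\<in>restrict_cover A \<V>. \<exists>V. V \<in> \<V> \<and> U \<subseteq> V"
    by (auto simp: restrict_cover_def)
  then obtain p where "\<forall>U\<in>restrict_cover A \<V>. p U \<in> \<V> \<and> U \<subseteq> p U" by metis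
  then show ?thesis by (auto simp: tracks_def)
qed

lemma open_coversD:
  "\<U> \<in> open_covers A \<Longrightarrow> U \<in> \<U> \<Longrightarrow> openin A U" "\<U> \<in> open_covers A \<Longrightarrow> \<Union>\<U> = topspace A"
  "\<U> \<in> open_covers A \<Longrightarrow> U \<in> \<U> \<Longrightarrow> U \<subseteq> topspace A"
  by (auto simp: open_covers_def)

text \<open>The definition evaluates the class at the restricted cover and along a chosen map. Here
  any cover of the subspace that refines \<V>, and any refinement map, serve equally well; later
  arguments take covers of small mesh.\<close>

lemma cech_inclusion_eq:
  assumes A: "A = subtopology B S" and c: "c \<in> carrier (cech_homology k A)"
    and \<V>: "\<V> \<in> open_covers B" and \<W>: "\<W> \<in> open_covers A" and p: "tracks (\<lambda>x. x) \<W> \<V> p"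
  shows "cech_inclusion k A B c \<V> = simplicial_induced k (nerve \<V>) p (c \<W>)"
proof -
  let ?R = "restrict_cover A \<V>"
  define q where "q = (SOME p. refinement_map ?R \<V> p)"
  have q: "tracks (\<lambda>x. x) ?R \<V> q"
    unfolding q_def refinement_map_iff_tracks by (rule someI_ex[OF restrict_cover_tracks])
  have R: "?R \<in> open_covers A" by (rule open_covers_restrict[OF A \<V>])
  define s where "s W = p W \<inter> topspace A" for W
  have s: "tracks (\<lambda>x. x) \<W> ?R s"
    using p open_coversD(3)[OF \<W>] unfolding tracks_def s_def restrict_cover_def by auto
  have c\<W>: "c \<W> \<in> carrier (nerve_homology k \<W>)" by (rule cech_carrierD(1)[OF c \<W>])
  have "cech_inclusion k A B c \<V> = simplicial_induced k (nerve \<V>) q (c ?R)"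
    using \<V> by (simp add: cech_inclusion_def q_def)
  also have "c ?R = simplicial_induced k (nerve ?R) s (c \<W>)"
    using cech_carrierD(2)[OF c \<W> R s] by simp
  also have "simplicial_induced k (nerve \<V>) q \<dots> = simplicial_induced k (nerve \<V>) (q \<circ> s) (c \<W>)"
    by (rule tracks_induced_comp[OF s q c\<W>])
  also have "\<dots> = simplicial_induced k (nerve \<V>) p (c \<W>)"
    using tracks_comp[OF s q] by (intro tracks_induced_eq[OF _ p c\<W>]) (simp add: comp_def)
  finally show ?thesis .
qed

lemma cech_inclusion_ext: "cech_inclusion k A B c \<in> extensional (open_covers B)"
  by (simp add: cech_inclusion_def)

lemma cech_inclusion_linear:
  assumes A: "A = subtopology B S"
  shows "linear_map coeff_field (cech_homology k A :: ('k::field, _) module) (cech_homology k B) (cech_inclusion k A B)"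
proof (rule linear_mapI[OF vectorspace_cech vectorspace_cech])
  let ?A = "cech_homology k A :: ('k, _) module" and ?B = "cech_homology k B :: ('k, _) module"
  note R = open_covers_restrict[OF A]
  have cl: "cech_inclusion k A B c \<in> carrier ?B" if c: "c \<in> carrier ?A" for c
  proof (rule cech_carrierI[OF cech_inclusion_ext])
    show "cech_inclusion k A B c \<V> \<in> carrier (nerve_homology k \<V>)" if \<V>: "\<V> \<in> open_covers B" for \<V>
    proof -
      obtain p where p: "tracks (\<lambda>x. x) (restrict_cover A \<V>) \<V> p" using restrict_cover_tracks by blast
      show ?thesis
        unfolding cech_inclusion_eq[OF A c \<V> R[OF \<V>] p]
        by (rule tracks_induced_carrier[OF p cech_carrierD(1)[OF c R[OF \<V>]]])
    qed
    show "simplicial_induced k (nerve \<V>') r (cech_inclusion k A B c \<V>) = cech_inclusion k A B c \<V>'"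
      if \<V>: "\<V> \<in> open_covers B" "\<V>' \<in> open_covers B" and r: "tracks (\<lambda>x. x) \<V> \<V>' r" for \<V> \<V>' r
    proof -
      obtain p where p: "tracks (\<lambda>x. x) (restrict_cover A \<V>) \<V> p" using restrict_cover_tracks by blast
      have rp: "tracks (\<lambda>x. x) (restrict_cover A \<V>) \<V>' (r \<circ> p)"
        using tracks_comp[OF p r] by (simp add: comp_def)
      show ?thesis
        unfolding cech_inclusion_eq[OF A c \<V>(1) R[OF \<V>(1)] p] cech_inclusion_eq[OF A c \<V>(2) R[OF \<V>(1)] rp]
        by (rule tracks_induced_comp[OF p r cech_carrierD(1)[OF c R[OF \<V>(1)]]])
    qed
  qed
  then show "cech_inclusion k A B \<in> carrier ?A \<rightarrow> carrier ?B" by blast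
  interpret VA: vectorspace coeff_field ?A by (rule vectorspace_cech)
  show "cech_inclusion k A B (c \<oplus>\<^bsub>?A\<^esub> d) = cech_inclusion k A B c \<oplus>\<^bsub>?B\<^esub> cech_inclusion k A B d"
    if cd: "c \<in> carrier ?A" "d \<in> carrier ?A" for c d
  proof (rule cech_eqI[OF cech_inclusion_ext cech_ops(4)])
    fix \<V> assume \<V>: "\<V> \<in> open_covers B"
    obtain p where p: "tracks (\<lambda>x. x) (restrict_cover A \<V>) \<V> p" using restrict_cover_tracks by blast
    have "c \<oplus>\<^bsub>?A\<^esub> d \<in> carrier ?A" using cd by simp
    from cech_inclusion_eq[OF A this \<V> R[OF \<V>] p]
    show "cech_inclusion k A B (c \<oplus>\<^bsub>?A\<^esub> d) \<V> = (cech_inclusion k A B c \<oplus>\<^bsub>?B\<^esub> cech_inclusion k A B d) \<V>"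
      using cech_inclusion_eq[OF A cd(1) \<V> R[OF \<V>] p] cech_inclusion_eq[OF A cd(2) \<V> R[OF \<V>] p]
        linear_mapD(4)[OF tracks_induced_linear[OF p] cech_carrierD(1)[OF cd(1) R[OF \<V>]] cech_carrierD(1)[OF cd(2) R[OF \<V>]]]
      by (simp add: cech_ops \<V> R[OF \<V>])
  qed
  show "cech_inclusion k A B (a \<odot>\<^bsub>?A\<^esub> c) = a \<odot>\<^bsub>?B\<^esub> cech_inclusion k A B c"
    if ac: "a \<in> carrier coeff_field" "c \<in> carrier ?A" for a :: 'k and c
  proof (rule cech_eqI[OF cech_inclusion_ext cech_ops(5)])
    fix \<V> assume \<V>: "\<V> \<in> open_covers B"
    obtain p where p: "tracks (\<lambda>x. x) (restrict_cover A \<V>) \<V> p" using restrict_cover_tracks by blast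
    have "a \<odot>\<^bsub>?A\<^esub> c \<in> carrier ?A" using ac by simp
    from cech_inclusion_eq[OF A this \<V> R[OF \<V>] p]
    show "cech_inclusion k A B (a \<odot>\<^bsub>?A\<^esub> c) \<V> = (a \<odot>\<^bsub>?B\<^esub> cech_inclusion k A B c) \<V>"
      using cech_inclusion_eq[OF A ac(2) \<V> R[OF \<V>] p]
        linear_mapD(5)[OF tracks_induced_linear[OF p] ac(1) cech_carrierD(1)[OF ac(2) R[OF \<V>]]]
      by (simp add: cech_ops \<V> R[OF \<V>])
  qed
qed

lemma cech_inclusion_carrier:
  "A = subtopology B S \<Longrightarrow> c \<in> carrier (cech_homology k A) \<Longrightarrow> cech_inclusion k A B c \<in> carrier (cech_homology k B)"
  using linear_mapD(3)[OF cech_inclusion_linear] by blast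

lemma cech_inclusion_comp:
  assumes A: "A = subtopology B S" and B: "B = subtopology C S'" and A': "A = subtopology C S''"
    and c: "c \<in> carrier (cech_homology k A)"
  shows "cech_inclusion k B C (cech_inclusion k A B c) = cech_inclusion k A C c"
proof (rule cech_eqI[OF cech_inclusion_ext cech_inclusion_ext])
  fix \<V> assume \<V>: "\<V> \<in> open_covers C"
  have \<W>: "restrict_cover B \<V> \<in> open_covers B" by (rule open_covers_restrict[OF B \<V>])
  have \<W>': "restrict_cover A (restrict_cover B \<V>) \<in> open_covers A" by (rule open_covers_restrict[OF A \<W>])
  obtain p where p: "tracks (\<lambda>x. x) (restrict_cover B \<V>) \<V> p" using restrict_cover_tracks by blast
  obtain q where q: "tracks (\<lambda>x. x) (restrict_cover A (restrict_cover B \<V>)) (restrict_cover B \<V>) q"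
    using restrict_cover_tracks by blast
  have pq: "tracks (\<lambda>x. x) (restrict_cover A (restrict_cover B \<V>)) \<V> (p \<circ> q)"
    using tracks_comp[OF q p] by (simp add: comp_def)
  show "cech_inclusion k B C (cech_inclusion k A B c) \<V> = cech_inclusion k A C c \<V>"
    unfolding cech_inclusion_eq[OF B cech_inclusion_carrier[OF A c] \<V> \<W> p] cech_inclusion_eq[OF A c \<W> \<W>' q]
      cech_inclusion_eq[OF A' c \<V> \<W>' pq]
    by (rule tracks_induced_comp[OF q p cech_carrierD(1)[OF c \<W>']])
qed

lemma cech_inclusion_refl:
  assumes c: "c \<in> carrier (cech_homology k A)"
  shows "cech_inclusion k A A c = c"
proof (rule cech_eqI[OF cech_inclusion_ext cech_carrierD(3)[OF c]])
  fix \<V> assume \<V>: "\<V> \<in> open_covers A"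
  have p: "tracks (\<lambda>x. x) \<V> \<V> (\<lambda>x. x)" by (simp add: tracks_def)
  show "cech_inclusion k A A c \<V> = c \<V>"
    using cech_inclusion_eq[OF subtopology_topspace[symmetric] c \<V> \<V> p] cech_carrierD(2)[OF c \<V> \<V> p] by simp
qed


subsection \<open>Continuity of Cech homology\<close>

text \<open>The images of the later spaces in \<open>V m\<close> decrease and stabilize. The
  connecting maps are surjective between the stable images, so a thread can be built upwards from
  any element of the stable image in \<open>V 0\<close>.\<close>

lemma mittag_leffler_thread:
  fixes V :: "nat \<Rightarrow> ('k, 'v) module"
  assumes lin: "\<And>m n. m \<le> n \<Longrightarrow> linear_map K (V n) (V m) (f m n)"
    and comp: "\<And>l m n x. l \<le> m \<Longrightarrow> m \<le> n \<Longrightarrow> x \<in> carrier (V n) \<Longrightarrow> f l m (f m n x) = f l n x"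
    and fin: "\<And>m n. m < n \<Longrightarrow> finsub K (V m) (f m n ` carrier (V n))"
    and g: "\<And>n x. x \<in> carrier (V n) \<Longrightarrow> g 0 (f 0 n x) = g n x"
    and x: "\<And>n. x \<in> g n ` carrier (V n)"
  shows "\<exists>y. (\<forall>n. y n \<in> carrier (V n) \<and> f n (Suc n) (y (Suc n)) = y n) \<and> g 0 (y 0) = x"
proof -
  define I where "I m n = f m n ` carrier (V n)" for m n
  have cl: "f m n z \<in> carrier (V m)" if "m \<le> n" "z \<in> carrier (V n)" for m n z
    using linear_mapD(3)[OF lin[OF that(1)]] that(2) by auto
  have ex: "\<exists>N>m. \<forall>n\<ge>N. I m n = I m N" for m
  proof -
    have sub: "subspace K (I m n) (V m)" if "m \<le> n" for n
      unfolding I_def using subspace_image[OF lin[OF that]] linear_mapD(1)[OF lin[OF that]]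
      by (simp add: subspace_carrier)
    \<comment> \<open>The sequence starts at \<open>Suc m\<close> because only the images from
      strictly later spaces are known to be finite-dimensional.\<close>
    have "\<exists>N. \<forall>n\<ge>N. I m (Suc m + n) = I m (Suc m + N)"
    proof (rule decreasing_subspaces_stabilize[where K = K and V = "V m"])
      show "subspace K (I m (Suc m + n)) (V m)" for n by (rule sub) simp
      show "finsub K (V m) (I m (Suc m + 0))" unfolding I_def by (rule fin) simp
      show "I m (Suc m + Suc n) \<subseteq> I m (Suc m + n)" for n
      proof
        fix z assume "z \<in> I m (Suc m + Suc n)"
        then obtain w where w: "w \<in> carrier (V (Suc m + Suc n))" "z = f m (Suc m + Suc n) w" by (auto simp: I_def)
        then have "z = f m (Suc m + n) (f (Suc m + n) (Suc m + Suc n) w)" by (simp add: comp)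
        then show "z \<in> I m (Suc m + n)" unfolding I_def using cl[OF _ w(1), of "Suc m + n"] by simp
      qed
    qed
    then obtain N where N: "\<And>n. n \<ge> N \<Longrightarrow> I m (Suc m + n) = I m (Suc m + N)" by blast
    have st: "I m n = I m (Suc m + N)" if mn: "Suc m + N \<le> n" for n
    proof -
      have "N \<le> n - Suc m" "Suc m + (n - Suc m) = n" using mn by auto
      then show ?thesis using N by metis
    qed
    show ?thesis by (intro exI[of _ "Suc m + N"] conjI allI impI) (simp, rule st)
  qed
  have "\<exists>N. \<forall>m. m < N m \<and> (\<forall>n\<ge>N m. I m n = I m (N m))"
    by (rule choice, rule allI, rule ex)
  then obtain N where N: "\<And>m. m < N m" "\<And>m n. N m \<le> n \<Longrightarrow> I m n = I m (N m)" by blast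
  have step: "\<exists>y'. y' \<in> I (Suc m) (N (Suc m)) \<and> f m (Suc m) y' = y" if y: "y \<in> I m (N m)" for m y
  proof -
    \<comment> \<open>At this index both image sequences are stable, so one preimage of
      \<open>y\<close> in \<open>V n\<close> supplies a lift that lies in the stable image of the
      next space.\<close>
    define n where "n = max (N m) (N (Suc m))"
    have n: "N m \<le> n" "N (Suc m) \<le> n" by (auto simp: n_def)
    have "y \<in> I m n" using y N(2)[OF n(1)] by simp
    then obtain z where z: "z \<in> carrier (V n)" "y = f m n z" by (auto simp: I_def)
    have "f (Suc m) n z \<in> I (Suc m) (N (Suc m))" using z N(2)[OF n(2)] by (auto simp: I_def)
    moreover have "f m (Suc m) (f (Suc m) n z) = y" using z n N(1)[of "Suc m"] by (simp add: comp)
    ultimately show ?thesis by blast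
  qed
  \<comment> \<open>The preimage of \<open>x\<close> is taken at level \<open>N 0\<close> so that
    its image in \<open>V 0\<close> lies in the stable image.\<close>
  obtain z where z: "z \<in> carrier (V (N 0))" "x = g (N 0) z" using x by blast
  have z0: "f 0 (N 0) z \<in> I 0 (N 0) \<and> g 0 (f 0 (N 0) z) = x"
    using z g by (simp add: I_def)
  have "\<exists>y. \<forall>n. (y n \<in> I n (N n) \<and> (n = 0 \<longrightarrow> g 0 (y n) = x)) \<and> f n (Suc n) (y (Suc n)) = y n"
    by (rule dependent_nat_choice) (use z0 step in auto)
  then obtain y where y: "\<And>n. y n \<in> I n (N n)" "\<And>n. f n (Suc n) (y (Suc n)) = y n" "g 0 (y 0) = x"
    by blast
  have "y n \<in> carrier (V n)" for n
    using y(1)[of n] cl N(1)[of n] by (auto simp: I_def intro!: cl less_imp_le)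
  then show ?thesis using y by blast
qed

lemma subtopology_of_subset:
  "S \<subseteq> S' \<Longrightarrow> subtopology X S = subtopology (subtopology X S') S"
  by (simp add: subtopology_subtopology Int_absorb1)

text \<open>Covers of different subspaces become comparable once they are replaced by open sets of
  \<open>X\<close>. All open sets with admissible trace are taken, which spares a choice for each
  member.\<close>

lemma open_cover_extend:
  assumes \<U>: "\<U> \<in> open_covers (subtopology X S)"
  shows "\<exists>\<V>. (\<forall>V\<in>\<V>. openin X V) \<and> topspace X \<inter> S \<subseteq> \<Union>\<V> \<and>
    (\<forall>V\<in>\<V>. \<exists>U\<in>\<U>. V \<inter> S \<inter> topspace X \<subseteq> U)"
proof -
  define \<V> where "\<V> = {V. openin X V \<and> (\<exists>U\<in>\<U>. V \<inter> S \<inter> topspace X \<subseteq> U)}"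
  have "topspace X \<inter> S \<subseteq> \<Union>\<V>"
  proof
    fix x assume x: "x \<in> topspace X \<inter> S"
    then obtain U where U: "U \<in> \<U>" "x \<in> U" using open_coversD(2)[OF \<U>] by auto
    then obtain V where V: "openin X V" "U = V \<inter> S"
      using open_coversD(1)[OF \<U>] by (auto simp: openin_subtopology)
    then have "V \<in> \<V>" unfolding \<V>_def using U by blast
    then show "x \<in> \<Union>\<V>" using U V by auto
  qed
  then show ?thesis by (intro exI[of _ \<V>]) (simp add: \<V>_def)
qed

lemma tracks_exists:
  assumes "\<And>Z. Z \<in> \<Z> \<Longrightarrow> \<exists>W\<in>\<W>. \<rho> ` Z \<subseteq> W"
  shows "\<exists>r. tracks \<rho> \<Z> \<W> r"
proof -
  have "\<forall>Z\<in>\<Z>. \<exists>W. W \<in> \<W> \<and> \<rho> ` Z \<subseteq> W" using assms by blast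
  from bchoice[OF this] show ?thesis unfolding tracks_def .
qed

text \<open>The neighbourhoods \<open>S n\<close> shrink to \<open>SA\<close>; covers of \<open>SA\<close> are compared with covers of \<open>S n\<close>
  through a map \<open>\<rho>\<close> onto \<open>SA\<close> that moves points only slightly.\<close>

locale cech_shrinking =
  fixes X :: "'a topology" and S :: "nat \<Rightarrow> 'a set" and SA :: "'a set" and \<rho> :: "'a \<Rightarrow> 'a"
  assumes subA: "\<And>n. SA \<subseteq> S n" and dec: "\<And>n. S (Suc n) \<subseteq> S n"
    and fixed: "\<And>x. x \<in> topspace X \<Longrightarrow> x \<in> SA \<Longrightarrow> \<rho> x = x"
    and refine: "\<And>\<V>. (\<And>V. V \<in> \<V> \<Longrightarrow> openin X V) \<Longrightarrow> topspace X \<inter> SA \<subseteq> \<Union>\<V> \<Longrightarrow>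
      \<exists>n. \<exists>\<W>\<in>open_covers (subtopology X (S n)). \<forall>W\<in>\<W>. \<rho> ` W \<subseteq> topspace X \<inter> SA \<and> (\<exists>V\<in>\<V>. W \<union> \<rho> ` W \<subseteq> V)"
begin

abbreviation "A \<equiv> subtopology X SA"
abbreviation "An n \<equiv> subtopology X (S n)"

lemma dec': "m \<le> n \<Longrightarrow> S n \<subseteq> S m"
proof (induction n rule: dec_induct)
  case (step n)
  then show ?case using dec[of n] by simp
qed simp

lemma A_sub: "A = subtopology (An n) SA"
  using subA by (rule subtopology_of_subset)

lemma An_sub: "m \<le> n \<Longrightarrow> An n = subtopology (An m) (S n)"
  using dec' by (rule subtopology_of_subset)

lemma exists_tracks:
  assumes \<U>: "\<U> \<in> open_covers A"
  shows "\<exists>n \<W> \<phi>. \<W> \<in> open_covers (An n) \<and> tracks \<rho> \<W> \<U> \<phi>"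
proof -
  from open_cover_extend[OF \<U>] obtain \<V> where
    "(\<forall>V\<in>\<V>. openin X V) \<and> topspace X \<inter> SA \<subseteq> \<Union>\<V> \<and> (\<forall>V\<in>\<V>. \<exists>U\<in>\<U>. V \<inter> SA \<inter> topspace X \<subseteq> U)" ..
  then have \<V>: "\<And>V. V \<in> \<V> \<Longrightarrow> openin X V" "topspace X \<inter> SA \<subseteq> \<Union>\<V>"
    "\<And>V. V \<in> \<V> \<Longrightarrow> \<exists>U\<in>\<U>. V \<inter> SA \<inter> topspace X \<subseteq> U" by simp_all
  obtain n \<W> where \<W>: "\<W> \<in> open_covers (An n)"
    "\<forall>W\<in>\<W>. \<rho> ` W \<subseteq> topspace X \<inter> SA \<and> (\<exists>V\<in>\<V>. W \<union> \<rho> ` W \<subseteq> V)"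
  proof -
    have "\<exists>n. \<exists>\<W>\<in>open_covers (An n). \<forall>W\<in>\<W>. \<rho> ` W \<subseteq> topspace X \<inter> SA \<and> (\<exists>V\<in>\<V>. W \<union> \<rho> ` W \<subseteq> V)"
      by (rule refine) (fact \<V>)+
    then show ?thesis using that by blast
  qed
  have "\<exists>U\<in>\<U>. \<rho> ` W \<subseteq> U" if W: "W \<in> \<W>" for W
  proof -
    obtain V where V: "V \<in> \<V>" "W \<union> \<rho> ` W \<subseteq> V" "\<rho> ` W \<subseteq> topspace X \<inter> SA" using bspec[OF \<W>(2) W] by blast
    obtain U where "U \<in> \<U>" "V \<inter> SA \<inter> topspace X \<subseteq> U" using \<V>(3)[OF V(1)] by blast
    then show ?thesis using V(2,3) by blast
  qed
  from tracks_exists[OF this] show ?thesis using \<W>(1) by blast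
qed

text \<open>Each component of \<open>x\<close> factors through a cover of some \<open>S n\<close>:
  restricting that cover to \<open>SA\<close> and following the \<rho>-tracking map gives a
  refinement map, since \<rho> fixes the points of \<open>SA\<close>. At the cover of
  \<open>S n\<close> the class is that of the inclusion of \<open>x\<close>, which is zero.\<close>

lemma inclusion_injective:
  assumes x: "x \<in> carrier (cech_homology k A :: ('k::field, _) module)"
    and zero: "\<And>n. cech_inclusion k A (An n) x = \<zero>\<^bsub>cech_homology k (An n)\<^esub>"
  shows "x = \<zero>\<^bsub>cech_homology k A\<^esub>"
proof (rule cech_eqI[OF cech_carrierD(3)[OF x] cech_ops(6)])
  fix \<U> assume \<U>: "\<U> \<in> open_covers A"
  obtain n \<W> \<phi> where \<W>: "\<W> \<in> open_covers (An n)" and \<phi>: "tracks \<rho> \<W> \<U> \<phi>"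
    using exists_tracks[OF \<U>] by blast
  let ?R = "restrict_cover A \<W>"
  have R: "?R \<in> open_covers A" by (rule open_covers_restrict[OF A_sub \<W>])
  obtain p where p: "tracks (\<lambda>x. x) ?R \<W> p" using restrict_cover_tracks by blast
  have \<phi>p: "tracks (\<lambda>x. x) ?R \<U> (\<phi> \<circ> p)"
    unfolding tracks_def
  proof
    fix W assume W: "W \<in> ?R"
    then have pW: "p W \<in> \<W>" "W \<subseteq> p W" using p by (simp_all add: tracks_def)
    then have "\<phi> (p W) \<in> \<U>" "\<rho> ` p W \<subseteq> \<phi> (p W)" using \<phi> by (simp_all add: tracks_def)
    moreover have "x \<in> \<rho> ` p W" if xW: "x \<in> W" for x
    proof -
      have "x \<in> topspace A" using open_coversD(3)[OF R W] xW by blast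
      then have "\<rho> x = x" using fixed by simp
      moreover have "x \<in> p W" using xW pW(2) by blast
      ultimately show ?thesis by (metis imageI)
    qed
    ultimately have "W \<subseteq> \<phi> (p W)" by blast
    with \<open>\<phi> (p W) \<in> \<U>\<close> show "(\<phi> \<circ> p) W \<in> \<U> \<and> (\<lambda>x. x) ` W \<subseteq> (\<phi> \<circ> p) W" by simp
  qed
  have xR: "x ?R \<in> carrier (nerve_homology k ?R)" by (rule cech_carrierD(1)[OF x R])
  have "x \<U> = simplicial_induced k (nerve \<U>) (\<phi> \<circ> p) (x ?R)"
    using cech_carrierD(2)[OF x R \<U> \<phi>p] by simp
  also have "\<dots> = simplicial_induced k (nerve \<U>) \<phi> (simplicial_induced k (nerve \<W>) p (x ?R))"
    by (rule tracks_induced_comp[OF p \<phi> xR, symmetric])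
  also have "simplicial_induced k (nerve \<W>) p (x ?R) = cech_inclusion k A (An n) x \<W>"
    by (rule cech_inclusion_eq[OF A_sub x \<W> R p, symmetric])
  also have "\<dots> = \<zero>\<^bsub>nerve_homology k \<W>\<^esub>" using zero by (simp add: cech_ops \<W>)
  also have "simplicial_induced k (nerve \<U>) \<phi> \<dots> = \<zero>\<^bsub>nerve_homology k \<U>\<^esub>"
    by (rule linear_mapD(6)[OF tracks_induced_linear[OF \<phi>]])
  finally show "x \<U> = \<zero>\<^bsub>cech_homology k A\<^esub> \<U>" by (simp add: cech_ops \<U>)
qed

text \<open>The component of the limit class at a cover of \<open>SA\<close> is read off from a
  cover of some \<open>S n\<close> along a \<rho>-tracking map. The limit is compared with the
  thread only inside the larger space \<open>SB\<close>, where covers can be chosen so fine that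
  \<rho> keeps a set within the same member.\<close>

lemma thread_limit:
  fixes y :: "nat \<Rightarrow> 'a set set \<Rightarrow> ('a set list \<Rightarrow>\<^sub>0 'k::field) set"
  assumes y: "\<And>n. y n \<in> carrier (cech_homology k (An n))"
    and thread: "\<And>n. cech_inclusion k (An (Suc n)) (An n) (y (Suc n)) = y n"
    and SB: "S 0 \<subseteq> SB"
  shows "\<exists>z\<in>carrier (cech_homology k A). cech_inclusion k A (subtopology X SB) z
    = cech_inclusion k (An 0) (subtopology X SB) (y 0)"
proof -
  let ?B = "subtopology X SB"
  have thread': "cech_inclusion k (An n) (An m) (y n) = y m" if "m \<le> n" for m n
    using that
  proof (induction n rule: dec_induct)
    case base
    then show ?case by (rule cech_inclusion_refl[OF y])
  next
    case (step n)
    then show ?case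
      using cech_inclusion_comp[OF An_sub[of n "Suc n"] An_sub[of m n] An_sub[of m "Suc n"] y[of "Suc n"]] thread[of n]
      by simp
  qed
  define P where "P \<U> n \<W> \<phi> \<longleftrightarrow> \<W> \<in> open_covers (An n) \<and> tracks \<rho> \<W> \<U> \<phi>" for \<U> n \<W> \<phi>
  \<comment> \<open>Both values are pulled back to a common refinement on a later neighbourhood,
    where the two composite vertex maps track the same \<rho>.\<close>
  have indep: "simplicial_induced k (nerve \<U>) \<phi> (y n \<W>) = simplicial_induced k (nerve \<U>) \<phi>' (y n' \<W>')"
    if P1: "P \<U> n \<W> \<phi>" and P2: "P \<U> n' \<W>' \<phi>'" for \<U> n \<W> \<phi> n' \<W>' \<phi>'
  proof -
    define l where "l = max n n'"
    have l: "n \<le> l" "n' \<le> l" by (auto simp: l_def)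
    have \<W>: "\<W> \<in> open_covers (An n)" "tracks \<rho> \<W> \<U> \<phi>" and \<W>': "\<W>' \<in> open_covers (An n')" "tracks \<rho> \<W>' \<U> \<phi>'"
      using P1 P2 by (auto simp: P_def)
    define \<Z> where "\<Z> = (\<lambda>(U, V). U \<inter> V) ` (restrict_cover (An l) \<W> \<times> restrict_cover (An l) \<W>')"
    have R: "restrict_cover (An l) \<W> \<in> open_covers (An l)" "restrict_cover (An l) \<W>' \<in> open_covers (An l)"
      using open_covers_restrict[OF An_sub[OF l(1)] \<W>(1)] open_covers_restrict[OF An_sub[OF l(2)] \<W>'(1)] by auto
    have \<Z>: "\<Z> \<in> open_covers (An l)"
      unfolding open_covers_def
    proof (intro CollectI conjI ballI)
      show "openin (An l) U" if "U \<in> \<Z>" for U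
        using that open_coversD(1)[OF R(1)] open_coversD(1)[OF R(2)] by (auto simp: \<Z>_def)
      have "\<Union>\<Z> = \<Union>(restrict_cover (An l) \<W>) \<inter> \<Union>(restrict_cover (An l) \<W>')" by (auto simp: \<Z>_def)
      then show "\<Union>\<Z> = topspace (An l)" using open_coversD(2)[OF R(1)] open_coversD(2)[OF R(2)] by simp
    qed
    have "\<exists>r. tracks (\<lambda>x. x) \<Z> \<W> r"
      by (rule tracks_exists) (auto simp: \<Z>_def restrict_cover_def)
    then obtain r where r: "tracks (\<lambda>x. x) \<Z> \<W> r" ..
    have "\<exists>r. tracks (\<lambda>x. x) \<Z> \<W>' r"
      by (rule tracks_exists) (auto simp: \<Z>_def restrict_cover_def)
    then obtain r' where r': "tracks (\<lambda>x. x) \<Z> \<W>' r'" ..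
    have yZ: "y l \<Z> \<in> carrier (nerve_homology k \<Z>)" by (rule cech_carrierD(1)[OF y \<Z>])
    have "y n \<W> = simplicial_induced k (nerve \<W>) r (y l \<Z>)"
      using cech_inclusion_eq[OF An_sub[OF l(1)] y \<W>(1) \<Z> r] thread'[OF l(1)] by simp
    then have 1: "simplicial_induced k (nerve \<U>) \<phi> (y n \<W>) = simplicial_induced k (nerve \<U>) (\<phi> \<circ> r) (y l \<Z>)"
      using tracks_induced_comp[OF r \<W>(2) yZ] by simp
    have "y n' \<W>' = simplicial_induced k (nerve \<W>') r' (y l \<Z>)"
      using cech_inclusion_eq[OF An_sub[OF l(2)] y \<W>'(1) \<Z> r'] thread'[OF l(2)] by simp
    then have 2: "simplicial_induced k (nerve \<U>) \<phi>' (y n' \<W>') = simplicial_induced k (nerve \<U>) (\<phi>' \<circ> r') (y l \<Z>)"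
      using tracks_induced_comp[OF r' \<W>'(2) yZ] by simp
    show ?thesis
      unfolding 1 2 by (rule tracks_induced_eq[OF tracks_comp[OF r \<W>(2)] tracks_comp[OF r' \<W>'(2)] yZ])
  qed
  define z where "z = (\<lambda>\<U>\<in>open_covers A. SOME h. \<exists>n \<W> \<phi>. P \<U> n \<W> \<phi> \<and> h = simplicial_induced k (nerve \<U>) \<phi> (y n \<W>))"
  have z: "z \<U> = simplicial_induced k (nerve \<U>) \<phi> (y n \<W>)" if "\<U> \<in> open_covers A" "P \<U> n \<W> \<phi>" for \<U> n \<W> \<phi>
  proof -
    have "\<exists>n \<W> \<phi>. P \<U> n \<W> \<phi> \<and> z \<U> = simplicial_induced k (nerve \<U>) \<phi> (y n \<W>)"
      unfolding z_def restrict_apply'[OF that(1)] by (rule someI_ex) (use that(2) in blast)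
    then show ?thesis using indep that(2) by metis
  qed
  have zc: "z \<in> carrier (cech_homology k A)"
  proof (rule cech_carrierI)
    show "z \<in> extensional (open_covers A)" by (simp add: z_def)
    show "z \<U> \<in> carrier (nerve_homology k \<U>)" if \<U>: "\<U> \<in> open_covers A" for \<U>
    proof -
      obtain n \<W> \<phi> where P: "P \<U> n \<W> \<phi>" using exists_tracks[OF \<U>] by (auto simp: P_def)
      then show ?thesis
        unfolding z[OF \<U> P] P_def using cech_carrierD(1)[OF y[of n], of \<W>]
        by (intro tracks_induced_carrier[of \<rho>]) auto
    qed
    show "simplicial_induced k (nerve \<U>') p (z \<U>) = z \<U>'"
      if \<U>: "\<U> \<in> open_covers A" "\<U>' \<in> open_covers A" and p: "tracks (\<lambda>x. x) \<U> \<U>' p" for \<U> \<U>' p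
    proof -
      obtain n \<W> \<phi> where \<W>: "\<W> \<in> open_covers (An n)" and \<phi>: "tracks \<rho> \<W> \<U> \<phi>"
        using exists_tracks[OF \<U>(1)] by blast
      have P: "P \<U> n \<W> \<phi>" using \<W> \<phi> by (simp add: P_def)
      have P': "P \<U>' n \<W> (p \<circ> \<phi>)" using \<W> tracks_comp[OF \<phi> p] by (simp add: P_def comp_def)
      show ?thesis
        unfolding z[OF \<U>(1) P] z[OF \<U>(2) P']
        by (rule tracks_induced_comp[OF \<phi> p cech_carrierD(1)[OF y \<W>]])
    qed
  qed
  have An_B: "An n = subtopology ?B (S n)" for n
    using dec'[of 0 n] SB by (intro subtopology_of_subset) blast
  have A_B: "A = subtopology ?B SA"
    using subA[of 0] SB by (intro subtopology_of_subset) blast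
  have yB: "cech_inclusion k (An n) ?B (y n) = cech_inclusion k (An 0) ?B (y 0)" for n
    using cech_inclusion_comp[OF An_sub[of 0 n] An_B[of 0] An_B[of n] y[of n]] thread'[of 0 n] by simp
  have "cech_inclusion k A ?B z \<V> = cech_inclusion k (An 0) ?B (y 0) \<V>" if \<V>: "\<V> \<in> open_covers ?B" for \<V>
  proof -
    from open_cover_extend[OF \<V>] obtain \<V>' where
      "(\<forall>V\<in>\<V>'. openin X V) \<and> topspace X \<inter> SB \<subseteq> \<Union>\<V>' \<and> (\<forall>V\<in>\<V>'. \<exists>U\<in>\<V>. V \<inter> SB \<inter> topspace X \<subseteq> U)" ..
    then have \<V>': "\<And>V. V \<in> \<V>' \<Longrightarrow> openin X V" "topspace X \<inter> SB \<subseteq> \<Union>\<V>'"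
      "\<And>V. V \<in> \<V>' \<Longrightarrow> \<exists>U\<in>\<V>. V \<inter> SB \<inter> topspace X \<subseteq> U" by simp_all
    have cov: "topspace X \<inter> SA \<subseteq> \<Union>\<V>'" using \<V>'(2) SB subA[of 0] by blast
    obtain n \<W> where \<W>: "\<W> \<in> open_covers (An n)"
      "\<forall>W\<in>\<W>. \<rho> ` W \<subseteq> topspace X \<inter> SA \<and> (\<exists>V\<in>\<V>'. W \<union> \<rho> ` W \<subseteq> V)"
    proof -
      have "\<exists>n. \<exists>\<W>\<in>open_covers (An n). \<forall>W\<in>\<W>. \<rho> ` W \<subseteq> topspace X \<inter> SA \<and> (\<exists>V\<in>\<V>'. W \<union> \<rho> ` W \<subseteq> V)"
        by (rule refine) (fact \<V>' cov)+
      then show ?thesis using that by blast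
    qed
    have "\<exists>U. U \<in> \<V> \<and> W \<union> \<rho> ` W \<subseteq> U" if W: "W \<in> \<W>" for W
    proof -
      obtain V where V: "V \<in> \<V>'" "W \<union> \<rho> ` W \<subseteq> V" "\<rho> ` W \<subseteq> topspace X \<inter> SA" using bspec[OF \<W>(2) W] by blast
      obtain U where "U \<in> \<V>" "V \<inter> SB \<inter> topspace X \<subseteq> U" using \<V>'(3)[OF V(1)] by blast
      moreover have "W \<subseteq> topspace X \<inter> S n" using open_coversD(3)[OF \<W>(1) W] by simp
      ultimately show ?thesis using V(2,3) SB subA[of 0] dec'[of 0 n] by blast
    qed
    then have "\<forall>W\<in>\<W>. \<exists>U. U \<in> \<V> \<and> W \<union> \<rho> ` W \<subseteq> U" by simp
    from bchoice[OF this] obtain \<psi> where "\<forall>W\<in>\<W>. \<psi> W \<in> \<V> \<and> W \<union> \<rho> ` W \<subseteq> \<psi> W" ..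
    then have \<psi>: "\<And>W. W \<in> \<W> \<Longrightarrow> \<psi> W \<in> \<V> \<and> W \<union> \<rho> ` W \<subseteq> \<psi> W" by simp
    \<comment> \<open>One vertex map tracks both the identity, which computes the inclusion of
      \<open>y n\<close>, and \<rho>, which computes that of \<open>z\<close>. The two inclusions
      therefore agree at \<V>.\<close>
    have \<psi>1: "tracks (\<lambda>x. x) \<W> \<V> \<psi>" and \<psi>2: "tracks \<rho> \<W> \<V> \<psi>" using \<psi> by (auto simp: tracks_def)
    let ?R = "restrict_cover A \<V>"
    have R: "?R \<in> open_covers A" by (rule open_covers_restrict[OF A_B \<V>])
    define \<phi> where "\<phi> W = \<psi> W \<inter> topspace A" for W
    have \<phi>: "tracks \<rho> \<W> ?R \<phi>"
      using \<psi> \<W>(2) unfolding tracks_def \<phi>_def restrict_cover_def by auto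
    obtain p where p: "tracks (\<lambda>x. x) ?R \<V> p" using restrict_cover_tracks by blast
    have yW: "y n \<W> \<in> carrier (nerve_homology k \<W>)" by (rule cech_carrierD(1)[OF y \<W>(1)])
    have "P ?R n \<W> \<phi>" using \<phi> \<W>(1) by (simp add: P_def)
    then have "z ?R = simplicial_induced k (nerve ?R) \<phi> (y n \<W>)" by (rule z[OF R])
    then have "cech_inclusion k A ?B z \<V> = simplicial_induced k (nerve \<V>) (p \<circ> \<phi>) (y n \<W>)"
      using cech_inclusion_eq[OF A_B zc \<V> R p] tracks_induced_comp[OF \<phi> p yW] by simp
    also have "\<dots> = simplicial_induced k (nerve \<V>) \<psi> (y n \<W>)"
      using tracks_comp[OF \<phi> p] by (intro tracks_induced_eq[OF _ \<psi>2 yW]) (simp add: comp_def)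
    also have "\<dots> = cech_inclusion k (An n) ?B (y n) \<V>"
      by (rule cech_inclusion_eq[OF An_B y \<V> \<W>(1) \<psi>1, symmetric])
    also note yB
    finally show ?thesis .
  qed
  from cech_eqI[OF cech_inclusion_ext cech_inclusion_ext this] show ?thesis
    using zc by blast
qed

end


subsection \<open>Vietoris-Rips complexes\<close>

definition vietoris_rips :: "'m::metric_space set \<Rightarrow> real \<Rightarrow> 'm set set" where
  "vietoris_rips C d = {S. S \<noteq> {} \<and> finite S \<and> S \<subseteq> C \<and> (\<forall>x\<in>S. \<forall>y\<in>S. dist x y < d)}"

lemma asc_vietoris_rips: "asc (vietoris_rips C d)"
  unfolding asc_def vietoris_rips_def by (auto intro: finite_subset)

lemma dist_convex_hull_less:
  fixes S :: "'v::real_normed_vector set"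
  assumes d: "\<And>x y. x \<in> S \<Longrightarrow> y \<in> S \<Longrightarrow> dist x y < d"
    and x: "x \<in> convex hull S" and y: "y \<in> convex hull S"
  shows "dist x y < d"
proof -
  have *: "dist x y < d" if "x \<in> convex hull S" "\<And>z. z \<in> S \<Longrightarrow> dist z y < d" for x y
  proof -
    have "convex hull S \<subseteq> ball y d"
      using that(2) by (intro hull_minimal) (auto simp: dist_commute)
    with that(1) show ?thesis by (auto simp: dist_commute)
  qed
  have "dist z y < d" if "z \<in> S" for z
    using *[OF y, of z] d[OF _ that] by (simp add: dist_commute)
  then show ?thesis by (rule *[OF x])
qed

text \<open>Meets the condition of \<open>homotopic_cycles\<close> on the empty tuple.\<close>

lemma subdiv_htpy_iter_Nil: "subdiv_htpy_iter n b (Poly_Mapping.single [] (1::'b::field)) = 0"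
proof -
  have *: "(subdiv b ^^ n) (Poly_Mapping.single [] (1::'b)) = Poly_Mapping.single [] 1" for n
    by (induction n) (simp_all add: subdiv_def subdiv_simplex.simps)
  show ?thesis
    by (induction n) (simp_all add: subdiv_htpy_def subdiv_htpy_simplex.simps *)
qed

text \<open>The retraction of an open neighbourhood is merely continuous. On the closed tube around
  \<open>K\<close>, which is compact, it is uniformly continuous.\<close>

lemma compact_ENR_tube:
  fixes K :: "'m::euclidean_space set"
  assumes "compact K" "ENR K"
  shows "\<exists>N r. \<exists>d>0. (\<forall>x\<in>K. ball x d \<subseteq> N) \<and> uniformly_continuous_on N r \<and> r ` N \<subseteq> K \<and> (\<forall>x\<in>K. r x = x)"
proof -
  obtain U where U: "open U" "K retract_of U" using \<open>ENR K\<close> by (auto simp: ENR_def)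
  then obtain r where r: "retraction U K r" by (auto simp: retract_of_def)
  have KU: "K \<subseteq> U" using r by (simp add: retraction_def)
  obtain d where d: "0 < d" "(\<Union>x\<in>K. cball x d) \<subseteq> U"
    using compact_subset_open_imp_cball_epsilon_subset[OF assms(1) U(1) KU] by blast
  define N where "N = {x + y |x y. x \<in> K \<and> y \<in> cball 0 d}"
  have "compact N" unfolding N_def by (rule compact_sums[OF assms(1) compact_cball])
  have NU: "N \<subseteq> U"
  proof
    fix z assume "z \<in> N"
    then obtain x y where "x \<in> K" "y \<in> cball 0 d" "z = x + y" by (auto simp: N_def)
    then have "z \<in> cball x d" by (simp add: dist_norm)
    then show "z \<in> U" using d(2) \<open>x \<in> K\<close> by blast
  qed
  have "continuous_on N r" using r NU by (auto simp: retraction_def intro: continuous_on_subset)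
  then have "uniformly_continuous_on N r" using \<open>compact N\<close> by (rule compact_uniformly_continuous)
  moreover have "ball x d \<subseteq> N" if "x \<in> K" for x
  proof
    fix z assume "z \<in> ball x d"
    then show "z \<in> N" unfolding N_def using that
      by (intro CollectI exI[of _ x] exI[of _ "z - x"]) (simp add: dist_norm norm_minus_commute)
  qed
  moreover have "r x \<in> K" if "x \<in> N" for x
    using r NU that by (auto simp: retraction_def)
  moreover have "r x = x" if "x \<in> K" for x
    using r that by (simp add: retraction_def)
  ultimately show ?thesis using d(1) by (intro exI[of _ N] exI[of _ r] exI[of _ d]) auto
qed

text \<open>The point is that \<open>\<delta>0\<close> does not depend on the target scale \<open>\<epsilon>\<close>: the bounding chain at
  scale \<open>\<delta>0\<close> is subdivided in the ambient Euclidean space and then retracted to \<open>K\<close>.\<close>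

lemma vietoris_rips_local_filling:
  fixes K :: "'m::euclidean_space set"
  assumes K: "compact K" "ENR K" and "0 < \<epsilon>0"
  shows "\<exists>\<delta>0>0. \<forall>\<epsilon>>0. \<exists>\<delta>>0. \<forall>A B k. \<forall>z::'m list \<Rightarrow>\<^sub>0 'k::field.
    A \<subseteq> K \<longrightarrow> (\<forall>a\<in>A. \<forall>x\<in>K. dist a x < \<epsilon>0 \<longrightarrow> x \<in> B) \<longrightarrow>
    z \<in> cycles (vietoris_rips A \<delta>) k \<longrightarrow> z \<in> boundaries (vietoris_rips A \<delta>0) k \<longrightarrow>
    z \<in> boundaries (vietoris_rips B \<epsilon>) k"
proof -
  obtain N r d where Nrd: "0 < d \<and> (\<forall>x\<in>K. ball x d \<subseteq> N) \<and> uniformly_continuous_on N r \<and> r ` N \<subseteq> K \<and> (\<forall>x\<in>K. r x = x)"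
    using compact_ENR_tube[OF K] by (elim exE)
  then have d: "0 < d" "\<And>x. x \<in> K \<Longrightarrow> ball x d \<subseteq> N" and ucont: "uniformly_continuous_on N r"
    and rK: "\<And>x. x \<in> N \<Longrightarrow> r x \<in> K" and rid: "\<And>x. x \<in> K \<Longrightarrow> r x = x"
    by (simp_all add: image_subset_iff)
  have modulus: "\<exists>\<delta>>0. \<forall>x\<in>N. \<forall>y\<in>N. dist y x < \<delta> \<longrightarrow> dist (r y) (r x) < \<epsilon>" if "0 < \<epsilon>" for \<epsilon>
    using ucont that unfolding uniformly_continuous_on_def by simp
  obtain d0 where d0: "0 < d0" "\<And>x y. x \<in> N \<Longrightarrow> y \<in> N \<Longrightarrow> dist x y < d0 \<Longrightarrow> dist (r x) (r y) < \<epsilon>0"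
    using modulus[OF \<open>0 < \<epsilon>0\<close>] by blast
  \<comment> \<open>\<open>d\<close> keeps the hull of a simplex inside the tube; \<open>d0\<close>
    makes the retraction send it to within \<epsilon>0 of a vertex in \<open>A\<close>, hence into
    \<open>B\<close>.\<close>
  define \<delta>0 where "\<delta>0 = min d d0"
  have \<delta>0: "0 < \<delta>0" "\<delta>0 \<le> d" "\<delta>0 \<le> d0" using d d0 by (auto simp: \<delta>0_def)
  show ?thesis
  proof (rule exI[of _ \<delta>0], intro conjI allI impI)
    fix \<epsilon> :: real assume "0 < \<epsilon>"
    obtain d1 where d1: "0 < d1" "\<And>x y. x \<in> N \<Longrightarrow> y \<in> N \<Longrightarrow> dist x y < d1 \<Longrightarrow> dist (r x) (r y) < \<epsilon>"
      using modulus[OF \<open>0 < \<epsilon>\<close>] by blast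
    \<comment> \<open>Tuples of diameter below \<open>d1\<close> in the tube are retracted to tuples
      of diameter below \<epsilon>.\<close>
    define \<delta> where "\<delta> = min \<delta>0 d1"
    have \<delta>: "0 < \<delta>" "\<delta> \<le> \<delta>0" "\<delta> \<le> d1" using \<delta>0 d1 by (auto simp: \<delta>_def)
    show "\<exists>\<delta>>0. \<forall>A B k. \<forall>z::'m list \<Rightarrow>\<^sub>0 'k. A \<subseteq> K \<longrightarrow> (\<forall>a\<in>A. \<forall>x\<in>K. dist a x < \<epsilon>0 \<longrightarrow> x \<in> B) \<longrightarrow>
      z \<in> cycles (vietoris_rips A \<delta>) k \<longrightarrow> z \<in> boundaries (vietoris_rips A \<delta>0) k \<longrightarrow>
      z \<in> boundaries (vietoris_rips B \<epsilon>) k"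
    proof (intro exI[of _ \<delta>] conjI allI impI)
      fix A B :: "'m set" and k and z :: "'m list \<Rightarrow>\<^sub>0 'k"
      assume AK: "A \<subseteq> K" and AB: "\<forall>a\<in>A. \<forall>x\<in>K. dist a x < \<epsilon>0 \<longrightarrow> x \<in> B"
        and z: "z \<in> cycles (vietoris_rips A \<delta>) k" "z \<in> boundaries (vietoris_rips A \<delta>0) k"
      have zc: "z \<in> simplicial_chains (vietoris_rips A \<delta>) k" and bz: "boundary z = 0"
        using z by (auto simp: cycles_def)
      obtain w where w: "w \<in> simplicial_chains (vietoris_rips A \<delta>0) (k + 1)" "z = boundary w"
        using z(2) by (auto simp: boundaries_def)
      have small: "set \<tau> \<noteq> {} \<Longrightarrow> set (map r \<tau>) \<in> vietoris_rips B \<epsilon>"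
        if \<sigma>: "set \<sigma> \<in> vietoris_rips A \<delta>0" and \<tau>: "set \<tau> \<subseteq> convex hull (set \<sigma>)"
          and fine: "\<And>x y. x \<in> set \<tau> \<Longrightarrow> y \<in> set \<tau> \<Longrightarrow> dist x y < \<delta>" for \<sigma> \<tau> :: "'m list"
      proof -
        assume ne: "set \<tau> \<noteq> {}"
        have "set \<sigma> \<noteq> {}" using \<sigma> unfolding vietoris_rips_def by blast
        define a where "a = hd \<sigma>"
        have a: "a \<in> set \<sigma>" using \<open>set \<sigma> \<noteq> {}\<close> by (simp add: a_def)
        have aA: "a \<in> A" "a \<in> K" using \<sigma> a AK by (auto simp: vietoris_rips_def)
        have near: "dist a x < \<delta>0" if "x \<in> set \<tau>" for x
          by (rule dist_convex_hull_less[of "set \<sigma>"])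
            (use \<sigma> \<tau> that a in \<open>auto simp: vietoris_rips_def hull_inc\<close>)
        have N: "x \<in> N" if "x \<in> set \<tau>" for x
          using near[OF that] d(2)[OF aA(2)] \<delta>0(2) by auto
        have "a \<in> N" by (rule subsetD[OF d(2)[OF aA(2)]]) (simp add: d(1))
        have rB: "r x \<in> B" if "x \<in> set \<tau>" for x
        proof -
          have "dist (r a) (r x) < \<epsilon>0"
            using d0(2)[OF \<open>a \<in> N\<close> N[OF that]] near[OF that] \<delta>0(3) by simp
          then show ?thesis using AB aA rid rK[OF N[OF that]] by auto
        qed
        show ?thesis
          unfolding vietoris_rips_def using ne rB d1(2) N fine \<delta>(3) by fastforce
      qed
      show "z \<in> boundaries (vietoris_rips B \<epsilon>) k"
      proof (cases "k < 0")
        case True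
        have "\<sigma> \<notin> Poly_Mapping.keys z" for \<sigma>
        proof
          assume "\<sigma> \<in> Poly_Mapping.keys z"
          from simplicial_chainsD[OF zc this] True show False
            by (cases \<sigma>) (simp_all add: vietoris_rips_def)
        qed
        then have "Poly_Mapping.keys z = {}" by blast
        then have "z = 0" by simp
        then show ?thesis by (simp add: boundaries_subspace)
      next
        case False
        \<comment> \<open>The tuples of the filling \<open>w\<close> have m entries, those of the
          cycle \<open>z\<close> one less. For k \<ge> 0 this gives m \<ge> 2, where the augmented
          and the ordinary boundary of \<open>w\<close> agree.\<close>
        define m where "m = nat (k + 2)"
        have m: "2 \<le> m" "int m = k + 2" using False by (auto simp: m_def)
        have wlen: "length \<sigma> = m" if "\<sigma> \<in> Poly_Mapping.keys w" for \<sigma>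
          using simplicial_chainsD(2)[OF w(1) that] m by simp
        have zlen: "length \<sigma> = m - 1" if "\<sigma> \<in> Poly_Mapping.keys z" for \<sigma>
          using simplicial_chainsD(2)[OF zc that] m by simp
        have "\<exists>n. (1 - 1 / real m) ^ n < \<delta> / \<delta>0"
          by (rule real_arch_pow_inv) (use \<delta> \<delta>0 m in auto)
        then obtain n where n: "(1 - 1 / real m) ^ n * \<delta>0 < \<delta>"
          using \<delta>0 by (auto simp: field_simps)
        define P where "P = subdiv_htpy_iter n barycenter z"
        define W where "W = (subdiv barycenter ^^ n) w"
        have Pkey: "set (map r \<tau>) \<in> vietoris_rips B \<epsilon> \<and> length \<tau> = m" if \<tau>: "\<tau> \<in> Poly_Mapping.keys P" for \<tau>
        proof -
          obtain \<sigma> where \<sigma>: "\<sigma> \<in> Poly_Mapping.keys z" "set \<tau> \<subseteq> convex hull (set \<sigma>)" "length \<tau> = Suc (m - 1)"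
            using keys_subdiv_htpy_iter[OF \<tau>[unfolded P_def] zlen] by blast
          have VR: "set \<sigma> \<in> vietoris_rips A \<delta>" by (rule simplicial_chainsD(1)[OF zc \<sigma>(1)])
          have "set (map r \<tau>) \<in> vietoris_rips B \<epsilon>"
          proof (rule small[OF _ \<sigma>(2)])
            show "set \<sigma> \<in> vietoris_rips A \<delta>0" using VR \<delta>(2) by (fastforce simp: vietoris_rips_def)
            show "dist x y < \<delta>" if "x \<in> set \<tau>" "y \<in> set \<tau>" for x y
              by (rule dist_convex_hull_less[of "set \<sigma>"]) (use VR \<sigma>(2) that in \<open>auto simp: vietoris_rips_def\<close>)
            show "set \<tau> \<noteq> {}" using \<sigma>(3) by auto
          qed
          then show ?thesis using \<sigma>(3) m by simp
        qed
        have Wkey: "set (map r \<tau>) \<in> vietoris_rips B \<epsilon> \<and> length \<tau> = m" if \<tau>: "\<tau> \<in> Poly_Mapping.keys W" for \<tau>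
        proof -
          have dw: "dist x y \<le> \<delta>0" if "\<sigma> \<in> Poly_Mapping.keys w" "x \<in> set \<sigma>" "y \<in> set \<sigma>" for \<sigma> x y
            using simplicial_chainsD(1)[OF w(1) that(1)] that by (fastforce simp: vietoris_rips_def)
          have "\<exists>\<sigma>\<in>Poly_Mapping.keys w. set \<tau> \<subseteq> convex hull (set \<sigma>) \<and> length \<tau> = m \<and>
              (\<forall>x\<in>set \<tau>. \<forall>y\<in>set \<tau>. dist x y \<le> (1 - 1 / real m) ^ n * \<delta>0)"
            by (rule keys_subdiv_iter[OF \<tau>[unfolded W_def]]) (use wlen dw in auto)
          then obtain \<sigma> where \<sigma>: "\<sigma> \<in> Poly_Mapping.keys w" "set \<tau> \<subseteq> convex hull (set \<sigma>)" "length \<tau> = m"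
            "\<forall>x\<in>set \<tau>. \<forall>y\<in>set \<tau>. dist x y \<le> (1 - 1 / real m) ^ n * \<delta>0" by blast
          have "set (map r \<tau>) \<in> vietoris_rips B \<epsilon>"
          proof (rule small[OF simplicial_chainsD(1)[OF w(1) \<sigma>(1)] \<sigma>(2)])
            show "dist x y < \<delta>" if "x \<in> set \<tau>" "y \<in> set \<tau>" for x y
              using \<sigma>(4) that n by fastforce
            show "set \<tau> \<noteq> {}" using \<sigma>(3) m by auto
          qed
          then show ?thesis using \<sigma>(3) by simp
        qed
        have "boundary P = z - (subdiv barycenter ^^ n) z"
          unfolding P_def
          by (rule homotopic_cycles[OF bz subdiv_htpy_iter_linear subdiv_htpy_iter_Nil subdiv_iter_homotopy])
            (use Pkey m in \<open>auto simp: P_def\<close>)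
        moreover have "boundary W = (subdiv barycenter ^^ n) z"
        proof -
          have "boundary W = aug_boundary W"
            by (rule boundary_eq_aug_boundary) (use Wkey m in auto)
          also have "\<dots> = (subdiv barycenter ^^ n) (aug_boundary w)"
            unfolding W_def by (rule aug_boundary_subdiv_iter)
          also have "aug_boundary w = boundary w"
            by (rule boundary_eq_aug_boundary[symmetric]) (use wlen m in auto)
          finally show ?thesis by (simp add: w(2))
        qed
        \<comment> \<open>\<open>P\<close> joins \<open>z\<close> to its subdivision, and the
          subdivided filling \<open>W\<close> bounds that subdivision. The retraction fixes the
          vertices of \<open>z\<close>, so it carries this filling into \<open>B\<close> without
          changing its boundary.\<close>
        ultimately have bPW: "boundary (P + W) = z" by (simp add: chain_lin_simps)
        have "push_chain r z = push_chain (\<lambda>x. x) z"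
        proof (rule push_chain_cong)
          fix \<sigma> x assume "\<sigma> \<in> Poly_Mapping.keys z" "x \<in> set \<sigma>"
          then have "x \<in> A" using simplicial_chainsD(1)[OF zc] by (fastforce simp: vietoris_rips_def)
          then show "r x = x" using rid AK by auto
        qed
        then have "z = boundary (push_chain r (P + W))"
          by (simp add: boundary_push_chain bPW push_chain_id)
        moreover have "push_chain r (P + W) \<in> simplicial_chains (vietoris_rips B \<epsilon>) (k + 1)"
          unfolding simplicial_chains_def
        proof (intro CollectI ballI)
          fix \<tau>' assume "\<tau>' \<in> Poly_Mapping.keys (push_chain r (P + W))"
          then obtain \<tau> where "\<tau> \<in> Poly_Mapping.keys (P + W)" "\<tau>' = map r \<tau>"
            using keys_push_chain[of r "P + W"] by auto
          then show "set \<tau>' \<in> vietoris_rips B \<epsilon> \<and> int (length \<tau>') = k + 1 + 1"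
            using Poly_Mapping.keys_add[of P W] Pkey[of \<tau>] Wkey[of \<tau>] m by auto
        qed
        ultimately show ?thesis unfolding boundaries_def by (rule image_eqI)
      qed
    qed (rule \<delta>(1))
  qed (rule \<delta>0(1))
qed


subsection \<open>Finiteness of the rank\<close>

text \<open>For a common point x of a nerve simplex, all image vertices lie within \<open>d\<close>
  of \<open>h x\<close>, so they are pairwise less than \<open>2 * d\<close> apart.\<close>

lemma near_contiguous:
  fixes h :: "'a \<Rightarrow> 'm::metric_space"
  assumes p: "\<And>U x. U \<in> \<U> \<Longrightarrow> x \<in> U \<Longrightarrow> p U \<in> C \<and> dist (h x) (p U) < d"
    and q: "\<And>U x. U \<in> \<U> \<Longrightarrow> x \<in> U \<Longrightarrow> q U \<in> C \<and> dist (h x) (q U) < d"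
  shows "contiguous (nerve \<U>) (vietoris_rips C (2 * d)) p q"
  unfolding contiguous_def
proof
  fix S assume "S \<in> nerve \<U>"
  then have S: "S \<subseteq> \<U>" "finite S" "S \<noteq> {}" "\<Inter>S \<noteq> {}" by (auto simp: nerve_def)
  then obtain x where x: "x \<in> \<Inter>S" by blast
  have near: "y \<in> C \<and> dist (h x) y < d" if "y \<in> p ` S \<union> q ` S" for y
    using that S(1) x p[of _ x] q[of _ x] by blast
  have "dist y z < 2 * d" if "y \<in> p ` S \<union> q ` S" "z \<in> p ` S \<union> q ` S" for y z
    using near[OF that(1)] near[OF that(2)] dist_triangle3[of y z "h x"] by linarith
  moreover have "p ` S \<union> q ` S \<subseteq> C" using near by blast
  ultimately show "p ` S \<union> q ` S \<in> vietoris_rips C (2 * d)"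
    using S by (simp add: vietoris_rips_def)
qed

lemma near_simplicial:
  fixes h :: "'a \<Rightarrow> 'm::metric_space"
  assumes "\<And>U x. U \<in> \<U> \<Longrightarrow> x \<in> U \<Longrightarrow> p U \<in> C \<and> dist (h x) (p U) < d"
  shows "simplicial_map (nerve \<U>) (vietoris_rips C (2 * d)) p"
  using near_contiguous[of \<U> p C h d p] assms by (simp add: contiguous_def simplicial_map_def)

section \<open>Spaces embedded as compact neighbourhood retracts\<close>

locale embedded_space =
  fixes X :: "'a topology" and h :: "'a \<Rightarrow> 'm::euclidean_space" and K :: "'m set"
  assumes homeo: "homeomorphic_map X (top_of_set K) h" and compact: "compact K" and ENR: "ENR K"
begin

lemma inj_h: "inj_on h (topspace X)"
  using homeomorphic_imp_injective_map[OF homeo] .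

lemma h_image: "h ` topspace X = K"
  using homeomorphic_imp_surjective_map[OF homeo] by simp

lemma h_in: "x \<in> topspace X \<Longrightarrow> h x \<in> K"
  using h_image by blast

lemma open_h: "openin X V \<Longrightarrow> \<exists>G. open G \<and> h ` V = K \<inter> G"
  using homeomorphic_imp_open_map[OF homeo] unfolding open_map_def by (metis openin_open)

lemma openin_preimage: "open G \<Longrightarrow> openin X {x \<in> topspace X. h x \<in> G}"
  using homeomorphic_imp_continuous_map[OF homeo] openin_continuous_map_preimage[of X "top_of_set K" h "K \<inter> G"]
    h_in by (auto simp: openin_open_Int elim!: back_subst[of "openin X"])

lemma compact_image: "closedin X S \<Longrightarrow> compact (h ` S)"
proof -
  assume "closedin X S"
  then have "closedin (top_of_set K) (h ` S)"
    using homeomorphic_imp_closed_map[OF homeo] by (simp add: closed_map_def)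
  then show "compact (h ` S)" by (rule closedin_compact[OF compact])
qed

text \<open>A Lebesgue number in the metric pulled back along \<open>h\<close>. The sets cover only
  \<open>S\<close>, but the conclusion reaches all nearby points of \<open>X\<close>, which also
  provides collars.\<close>

lemma lebesgue_number:
  assumes \<V>: "\<And>V. V \<in> \<V> \<Longrightarrow> openin X V" and S: "S \<subseteq> topspace X" "compact (h ` S)" "S \<subseteq> \<Union>\<V>"
  shows "\<exists>ll>0. \<forall>a\<in>S. \<exists>V\<in>\<V>. \<forall>x\<in>topspace X. dist (h a) (h x) < ll \<longrightarrow> x \<in> V"
proof -
  define \<G> where "\<G> = {G. open G \<and> (\<exists>V\<in>\<V>. \<forall>x\<in>topspace X. h x \<in> G \<longrightarrow> x \<in> V)}"
  have "h ` S \<subseteq> \<Union>\<G>"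
  proof
    fix y assume "y \<in> h ` S"
    then obtain a where a: "a \<in> S" "y = h a" by blast
    then obtain V where V: "V \<in> \<V>" "a \<in> V" using S by blast
    obtain G where G: "open G" "h ` V = K \<inter> G" using open_h[OF \<V>[OF V(1)]] by blast
    have "x \<in> V" if x: "x \<in> topspace X" "h x \<in> G" for x
    proof -
      have "h x \<in> h ` V" using h_in G x by blast
      then obtain v where v: "v \<in> V" "h x = h v" by blast
      have "V \<subseteq> topspace X" using \<V>[OF V(1)] by (rule openin_subset)
      then show ?thesis using inj_onD[OF inj_h v(2)] v(1) x(1) by blast
    qed
    then have "G \<in> \<G>" unfolding \<G>_def using G(1) V(1) by blast
    moreover have "y \<in> G" using G(2) V(2) a(2) by blast
    ultimately show "y \<in> \<Union>\<G>" by blast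
  qed
  moreover have "open G" if "G \<in> \<G>" for G using that by (simp add: \<G>_def)
  ultimately obtain ll where ll: "0 < ll" "\<And>y. y \<in> h ` S \<Longrightarrow> \<exists>G\<in>\<G>. ball y ll \<subseteq> G"
    using Heine_Borel_lemma[OF S(2)] by metis
  have "\<exists>V\<in>\<V>. \<forall>x\<in>topspace X. dist (h a) (h x) < ll \<longrightarrow> x \<in> V" if "a \<in> S" for a
  proof -
    obtain G where G: "G \<in> \<G>" "ball (h a) ll \<subseteq> G" using ll(2)[of "h a"] \<open>a \<in> S\<close> by blast
    then obtain V where "V \<in> \<V>" "\<forall>x\<in>topspace X. h x \<in> G \<longrightarrow> x \<in> V" by (auto simp: \<G>_def)
    then show ?thesis using G(2) by (intro bexI[of _ V]) auto
  qed
  with ll(1) show ?thesis by blast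
qed

lemma small_cover:
  assumes S: "S \<subseteq> topspace X" "compact (h ` S)" and "0 < \<delta>"
  shows "\<exists>\<W>\<in>open_covers (subtopology X S). finite \<W> \<and> {} \<notin> \<W> \<and> (\<forall>W\<in>\<W>. \<forall>x\<in>W. \<forall>y\<in>W. dist (h x) (h y) < \<delta>)"
proof -
  obtain F where F: "finite F" "F \<subseteq> h ` S" "h ` S \<subseteq> (\<Union>y\<in>F. ball y (\<delta> / 2))"
    using compactE_image[OF S(2), of "h ` S" "\<lambda>y. ball y (\<delta> / 2)"] \<open>0 < \<delta>\<close> by force
  define W where "W y = {x \<in> topspace X. h x \<in> ball y (\<delta> / 2)} \<inter> S" for y
  \<comment> \<open>The empty set is removed so that a point can be picked in every member.\<close>
  define \<W> where "\<W> = W ` F - {{}}"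
  have "\<W> \<in> open_covers (subtopology X S)"
    unfolding open_covers_def
  proof (intro CollectI conjI ballI)
    show "openin (subtopology X S) U" if UW: "U \<in> \<W>" for U
    proof -
      obtain y where "U = {x \<in> topspace X. h x \<in> ball y (\<delta> / 2)} \<inter> S" using UW by (auto simp: \<W>_def W_def)
      then show ?thesis using openin_preimage[OF open_ball] unfolding openin_subtopology by blast
    qed
    have "\<Union>\<W> \<subseteq> topspace X \<inter> S" by (auto simp: \<W>_def W_def)
    moreover have "x \<in> \<Union>\<W>" if x: "x \<in> S" for x
    proof -
      obtain y where "y \<in> F" "h x \<in> ball y (\<delta> / 2)" using F(3) x by blast
      then have "x \<in> W y" "W y \<in> \<W>" using x S(1) by (auto simp: W_def \<W>_def)
      then show ?thesis by blast
    qed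
    ultimately show "\<Union>\<W> = topspace (subtopology X S)" by auto
  qed
  moreover have "dist (h x) (h y) < \<delta>" if xy: "U \<in> \<W>" "x \<in> U" "y \<in> U" for U x y
  proof -
    obtain z where "x \<in> W z" "y \<in> W z" using xy by (auto simp: \<W>_def)
    then have "dist z (h x) < \<delta> / 2" "dist z (h y) < \<delta> / 2" by (auto simp: W_def)
    then show ?thesis using dist_triangle3[of "h x" "h y" z] by linarith
  qed
  ultimately show ?thesis using F(1) by (intro bexI[of _ \<W>]) (auto simp: \<W>_def)
qed

text \<open>The inclusion kills every class that vanishes at one fixed finite cover \<U>. Such a
  class is represented at a much finer cover \<W> by a cycle \<open>z\<close>. Picking points in the
  members turns \<open>z\<close> into a Vietoris-Rips cycle of small mesh, and vanishing at \<U>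
  makes it bound at scale \<delta>0. Local filling lets it bound in \<open>SB\<close> at the
  Lebesgue scale of a given cover \<V>, where Vietoris-Rips simplices map to the nerve of
  \<V>.\<close>

theorem finsub_cech_image:
  assumes SA: "SA \<subseteq> topspace X" "compact (h ` SA)" and SB: "SB \<subseteq> topspace X" "compact (h ` SB)"
    and "0 < \<epsilon>" and collar: "\<And>a x. a \<in> SA \<Longrightarrow> x \<in> topspace X \<Longrightarrow> dist (h a) (h x) < \<epsilon> \<Longrightarrow> x \<in> SB"
  shows "finsub coeff_field (cech_homology k (subtopology X SB) :: ('k::field, _) module)
    (cech_inclusion k (subtopology X SA) (subtopology X SB) ` carrier (cech_homology k (subtopology X SA)))"
proof -
  let ?A = "subtopology X SA" and ?B = "subtopology X SB"
  obtain \<delta>0 where "0 < \<delta>0" and filling0: "\<forall>\<epsilon>'>0. \<exists>\<delta>>0. \<forall>A B k. \<forall>z::'m list \<Rightarrow>\<^sub>0 'k.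
    A \<subseteq> K \<longrightarrow> (\<forall>a\<in>A. \<forall>x\<in>K. dist a x < \<epsilon> \<longrightarrow> x \<in> B) \<longrightarrow>
    z \<in> cycles (vietoris_rips A \<delta>) k \<longrightarrow> z \<in> boundaries (vietoris_rips A \<delta>0) k \<longrightarrow>
    z \<in> boundaries (vietoris_rips B \<epsilon>') k"
    using vietoris_rips_local_filling[OF compact ENR \<open>0 < \<epsilon>\<close>] by (elim exE conjE) (rule that)
  have AK: "h ` SA \<subseteq> K"
    using SA(1) h_in by blast
  have AB: "\<forall>a\<in>h ` SA. \<forall>x\<in>K. dist a x < \<epsilon> \<longrightarrow> x \<in> h ` SB"
    unfolding h_image[symmetric] using collar by auto
  have filling: "\<exists>\<delta>>0. \<forall>z::'m list \<Rightarrow>\<^sub>0 'k. z \<in> cycles (vietoris_rips (h ` SA) \<delta>) k \<longrightarrow>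
      z \<in> boundaries (vietoris_rips (h ` SA) \<delta>0) k \<longrightarrow> z \<in> boundaries (vietoris_rips (h ` SB) \<epsilon>') k"
    if pos: "0 < \<epsilon>'" for \<epsilon>'
  proof -
    from filling0[rule_format, OF pos] obtain \<delta> where \<delta>: "0 < \<delta>"
      "\<forall>A B k. \<forall>z::'m list \<Rightarrow>\<^sub>0 'k. A \<subseteq> K \<longrightarrow> (\<forall>a\<in>A. \<forall>x\<in>K. dist a x < \<epsilon> \<longrightarrow> x \<in> B) \<longrightarrow>
        z \<in> cycles (vietoris_rips A \<delta>) k \<longrightarrow> z \<in> boundaries (vietoris_rips A \<delta>0) k \<longrightarrow>
        z \<in> boundaries (vietoris_rips B \<epsilon>') k" by (elim exE conjE) (rule that)
    show ?thesis
      by (rule exI[of _ \<delta>], intro conjI allI impI \<delta>(1))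
        (rule \<delta>(2)[rule_format, OF AK], use AB in auto)
  qed
  \<comment> \<open>Half of \<delta>0, since passing from a nerve to a Vietoris-Rips complex doubles
    the scale.\<close>
  obtain \<U> where \<U>: "\<U> \<in> open_covers ?A" "finite \<U>"
    "\<And>U x y. U \<in> \<U> \<Longrightarrow> x \<in> U \<Longrightarrow> y \<in> U \<Longrightarrow> dist (h x) (h y) < \<delta>0 / 2"
    using small_cover[OF SA, of "\<delta>0 / 2"] \<open>0 < \<delta>0\<close> by auto
  have SAB: "SA \<subseteq> SB"
  proof
    fix x assume "x \<in> SA"
    then show "x \<in> SB" using collar[of x x] SA(1) \<open>0 < \<epsilon>\<close> by auto
  qed
  then have ABs: "?A = subtopology ?B SA"
    by (rule subtopology_of_subset)
  define q where "q U = h (SOME x. x \<in> U)" for U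
  have q: "\<exists>x\<in>U. q U = h x" if "x \<in> U" for U x
    unfolding q_def using someI[of "\<lambda>x. x \<in> U", OF that] by blast
  have sub: "U \<subseteq> SA" if "\<W> \<in> open_covers ?A" "U \<in> \<W>" for \<W> U
    using open_coversD(3)[OF that] by auto
  have q\<U>: "q U \<in> h ` SA \<and> dist (h x) (q U) < \<delta>0 / 2" if "U \<in> \<U>" "x \<in> U" for U x
    using q[OF that(2)] \<U>(3)[OF that] sub[OF \<U>(1) that(1)] by auto
  have zero: "cech_inclusion k ?A ?B c = \<zero>\<^bsub>cech_homology k ?B\<^esub>"
    if c: "c \<in> carrier (cech_homology k ?A :: ('k, _) module)" and c0: "c \<U> = \<zero>\<^bsub>nerve_homology k \<U>\<^esub>" for c
  proof (rule cech_eqI[OF cech_inclusion_ext cech_ops(6)])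
    fix \<V> assume \<V>: "\<V> \<in> open_covers ?B"
    from open_cover_extend[OF \<V>] obtain \<V>' where
      "(\<forall>V\<in>\<V>'. openin X V) \<and> topspace X \<inter> SB \<subseteq> \<Union>\<V>' \<and> (\<forall>V\<in>\<V>'. \<exists>U\<in>\<V>. V \<inter> SB \<inter> topspace X \<subseteq> U)" ..
    then have \<V>': "\<And>V. V \<in> \<V>' \<Longrightarrow> openin X V" "SB \<subseteq> \<Union>\<V>'"
      "\<And>V. V \<in> \<V>' \<Longrightarrow> \<exists>U\<in>\<V>. V \<inter> SB \<inter> topspace X \<subseteq> U" using SB(1) by (simp_all add: Int_absorb1)
    obtain ll where ll: "0 < ll" "\<And>b. b \<in> SB \<Longrightarrow> \<exists>V\<in>\<V>'. \<forall>x\<in>topspace X. dist (h b) (h x) < ll \<longrightarrow> x \<in> V"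
      using lebesgue_number[OF \<V>'(1) SB \<V>'(2)] by blast
    from open_cover_extend[OF \<U>(1)] obtain \<U>' where
      "(\<forall>V\<in>\<U>'. openin X V) \<and> topspace X \<inter> SA \<subseteq> \<Union>\<U>' \<and> (\<forall>V\<in>\<U>'. \<exists>U\<in>\<U>. V \<inter> SA \<inter> topspace X \<subseteq> U)" ..
    then have \<U>': "\<And>V. V \<in> \<U>' \<Longrightarrow> openin X V" "SA \<subseteq> \<Union>\<U>'"
      "\<And>V. V \<in> \<U>' \<Longrightarrow> \<exists>U\<in>\<U>. V \<inter> SA \<inter> topspace X \<subseteq> U" using SA(1) by (simp_all add: Int_absorb1)
    obtain \<mu> where \<mu>: "0 < \<mu>" "\<And>b. b \<in> SA \<Longrightarrow> \<exists>V\<in>\<U>'. \<forall>x\<in>topspace X. dist (h b) (h x) < \<mu> \<longrightarrow> x \<in> V"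
      using lebesgue_number[OF \<U>'(1) SA \<U>'(2)] by blast
    have "\<exists>g. g \<in> \<V> \<and> (\<forall>x\<in>SB. dist y (h x) < ll \<longrightarrow> x \<in> g)" if y: "y \<in> h ` SB" for y
    proof -
      obtain b where b: "b \<in> SB" "y = h b" using y by blast
      obtain V where V: "V \<in> \<V>'" "\<forall>x\<in>topspace X. dist (h b) (h x) < ll \<longrightarrow> x \<in> V" using ll(2)[OF b(1)] by blast
      obtain U where U: "U \<in> \<V>" "V \<inter> SB \<inter> topspace X \<subseteq> U" using \<V>'(3)[OF V(1)] by blast
      have "x \<in> U" if "x \<in> SB" "dist y (h x) < ll" for x
        using U(2) V(2) that SB(1) b(2) by blast
      then show ?thesis using U(1) by blast
    qed
    then have "\<forall>y\<in>h ` SB. \<exists>g. g \<in> \<V> \<and> (\<forall>x\<in>SB. dist y (h x) < ll \<longrightarrow> x \<in> g)" by simp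
    \<comment> \<open>\<open>G y\<close> is a member of \<V> that contains all points of
      \<open>SB\<close> within the Lebesgue number of \<open>y\<close>; it turns Vietoris-Rips
      simplices at that scale into nerve simplices.\<close>
    from bchoice[OF this] obtain G where G0: "\<forall>y\<in>h ` SB. G y \<in> \<V> \<and> (\<forall>x\<in>SB. dist y (h x) < ll \<longrightarrow> x \<in> G y)" ..
    then have G: "y \<in> h ` SB \<Longrightarrow> G y \<in> \<V>" "y \<in> h ` SB \<Longrightarrow> x \<in> SB \<Longrightarrow> dist y (h x) < ll \<Longrightarrow> x \<in> G y" for x y
      using bspec[OF G0, of y] by blast+
    have G_simp: "simplicial_map (vietoris_rips (h ` SB) ll) (nerve \<V>) G"
      unfolding simplicial_map_def
    proof
      fix S assume "S \<in> vietoris_rips (h ` SB) ll"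
      then have S: "S \<noteq> {}" "finite S" "S \<subseteq> h ` SB" "\<And>x y. x \<in> S \<Longrightarrow> y \<in> S \<Longrightarrow> dist x y < ll"
        by (auto simp: vietoris_rips_def)
      obtain s where s: "s \<in> S" using S(1) by blast
      obtain b where b: "b \<in> SB" "s = h b" using S(3) s by blast
      have "b \<in> \<Inter>(G ` S)" using G(2) S(3,4) s b by auto
      then have "\<Inter>(G ` S) \<noteq> {}" by blast
      then show "G ` S \<in> nerve \<V>" using S G(1) by (auto simp: nerve_def)
    qed
    obtain \<delta> where \<delta>: "0 < \<delta>" and fill: "\<And>z::'m list \<Rightarrow>\<^sub>0 'k. z \<in> cycles (vietoris_rips (h ` SA) \<delta>) k \<Longrightarrow>
      z \<in> boundaries (vietoris_rips (h ` SA) \<delta>0) k \<Longrightarrow> z \<in> boundaries (vietoris_rips (h ` SB) ll) k"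
      using filling[OF ll(1)] by blast
    \<comment> \<open>The bounds serve, in turn, the cycle at scale \<delta>, the contiguity at
      scale \<delta>0, the refinement of \<V> by way of \<open>G\<close>, and the refinement of
      \<U>.\<close>
    define d where "d = min (min (\<delta> / 2) (\<delta>0 / 2)) (min ll \<mu>)"
    have d: "0 < d" "d \<le> \<delta> / 2" "d \<le> ll" "d \<le> \<mu>" "d \<le> \<delta>0 / 2"
      using \<delta> ll(1) \<mu>(1) \<open>0 < \<delta>0\<close> by (auto simp: d_def)
    obtain \<W> where \<W>: "\<W> \<in> open_covers ?A" "{} \<notin> \<W>"
      "\<And>U x y. U \<in> \<W> \<Longrightarrow> x \<in> U \<Longrightarrow> y \<in> U \<Longrightarrow> dist (h x) (h y) < d"
      using small_cover[OF SA d(1)] by auto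
    have q\<W>: "q U \<in> h ` SA \<and> dist (h x) (q U) < d" if "U \<in> \<W>" "x \<in> U" for U x
      using q[OF that(2)] \<W>(3)[OF that] sub[OF \<W>(1) that(1)] by auto
    have "\<exists>p. tracks (\<lambda>x. x) \<W> \<U> p"
    proof (rule tracks_exists)
      fix W assume W: "W \<in> \<W>"
      then obtain w where w: "w \<in> W" using \<W>(2) by (metis ex_in_conv)
      have W_SA: "W \<subseteq> SA" by (rule sub[OF \<W>(1) W])
      obtain V where V: "V \<in> \<U>'" "\<forall>x\<in>topspace X. dist (h w) (h x) < \<mu> \<longrightarrow> x \<in> V" using \<mu>(2) w W_SA by blast
      obtain U where U: "U \<in> \<U>" "V \<inter> SA \<inter> topspace X \<subseteq> U" using \<U>'(3)[OF V(1)] by blast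
      have "x \<in> U" if "x \<in> W" for x
      proof -
        have "dist (h w) (h x) < \<mu>" using \<W>(3)[OF W w that] d(4) by simp
        then show ?thesis using V(2) U(2) W_SA SA(1) that by blast
      qed
      then show "\<exists>U\<in>\<U>. (\<lambda>x. x) ` W \<subseteq> U" using U(1) by auto
    qed
    then obtain p where p: "tracks (\<lambda>x. x) \<W> \<U> p" ..
    obtain z where z: "z \<in> cycles (nerve \<W>) k" "c \<W> = hom_class (nerve \<W>) k z"
      using cech_carrierD(1)[OF c \<W>(1)] by (auto simp: carrier_simplicial_homology)
    have "hom_class (nerve \<U>) k (push_chain p z) = hom_class (nerve \<U>) k 0"
      using cech_carrierD(2)[OF c \<W>(1) \<U>(1) p] c0
      by (simp add: z(2) simplicial_induced_hom_class[OF tracks_simplicial_map[OF p]] zero_simplicial_homology)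
    then have pz: "push_chain p z \<in> boundaries (nerve \<U>) k" by (simp add: hom_class_eq_iff)
    have s1: "simplicial_map (nerve \<U>) (vietoris_rips (h ` SA) (2 * (\<delta>0 / 2))) q"
      by (rule near_simplicial[where h = h]) (rule q\<U>)
    have s2: "simplicial_map (nerve \<W>) (vietoris_rips (h ` SA) (2 * (\<delta> / 2))) q"
      by (rule near_simplicial[where h = h]) (use q\<W> d(2) in fastforce)
    \<comment> \<open>It does not matter at scale \<delta>0 whether the point is picked in a member
      of \<W> or in the member of \<U> around it. So \<open>z\<close>, whose image in the nerve of
      \<U> bounds, also bounds when pushed directly.\<close>
    have s3: "contiguous (nerve \<W>) (vietoris_rips (h ` SA) (2 * (\<delta>0 / 2))) (q \<circ> p) q"
    proof (rule near_contiguous[where h = h])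
      show "q U \<in> h ` SA \<and> dist (h x) (q U) < \<delta>0 / 2" if "U \<in> \<W>" "x \<in> U" for U x
        using q\<W>[OF that] d(5) by simp
      show "(q \<circ> p) U \<in> h ` SA \<and> dist (h x) ((q \<circ> p) U) < \<delta>0 / 2" if "U \<in> \<W>" "x \<in> U" for U x
      proof -
        have "p U \<in> \<U>" "x \<in> p U" using p that by (auto simp: tracks_def)
        then show ?thesis using q\<U> by simp
      qed
    qed
    have "push_chain q (push_chain p z) \<in> boundaries (vietoris_rips (h ` SA) \<delta>0) k"
      using push_chain_boundaries[OF s1 pz] by simp
    moreover have "push_chain q z - push_chain (q \<circ> p) z \<in> boundaries (vietoris_rips (h ` SA) \<delta>0) k"
      using contiguous_homologous[OF asc_vietoris_rips _ s3 z(1)] asc_nerve[of \<W>] by (simp add: asc_def)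
    ultimately have "(push_chain q z - push_chain (q \<circ> p) z) + push_chain (q \<circ> p) z \<in> boundaries (vietoris_rips (h ` SA) \<delta>0) k"
      unfolding push_chain_comp by (intro boundaries_subspace(2))
    then have "push_chain q z \<in> boundaries (vietoris_rips (h ` SA) \<delta>0) k" by simp
    moreover have "push_chain q z \<in> cycles (vietoris_rips (h ` SA) \<delta>) k"
      using push_chain_cycles[OF s2 z(1)] by simp
    ultimately have "push_chain q z \<in> boundaries (vietoris_rips (h ` SB) ll) k" by (rule fill[rotated])
    from push_chain_boundaries[OF G_simp this]
    have Gqz: "push_chain (G \<circ> q) z \<in> boundaries (nerve \<V>) k"
      by (simp only: push_chain_comp)
    \<comment> \<open>The detour through points is itself a refinement map, hence it computes the
      inclusion at \<V>.\<close>
    have Gq: "tracks (\<lambda>x. x) \<W> \<V> (G \<circ> q)"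
      unfolding tracks_def
    proof
      fix W assume W: "W \<in> \<W>"
      then obtain w where w: "w \<in> W" using \<W>(2) by (metis ex_in_conv)

      have qW: "q W \<in> h ` SB" using q\<W>[OF W w] SAB by blast
      have "x \<in> G (q W)" if "x \<in> W" for x
      proof (rule G(2)[OF qW])
        show "x \<in> SB" using sub[OF \<W>(1) W] SAB that by blast
        show "dist (q W) (h x) < ll" using q\<W>[OF W that] d(3) by (simp add: dist_commute)
      qed
      then show "(G \<circ> q) W \<in> \<V> \<and> (\<lambda>x. x) ` W \<subseteq> (G \<circ> q) W" using G(1)[OF qW] by auto
    qed
    have "cech_inclusion k ?A ?B c \<V> = hom_class (nerve \<V>) k (push_chain (G \<circ> q) z)"
      using cech_inclusion_eq[OF ABs c \<V> \<W>(1) Gq]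
      by (simp add: z(2) simplicial_induced_hom_class[OF tracks_simplicial_map[OF Gq]])
    also have "\<dots> = \<zero>\<^bsub>nerve_homology k \<V>\<^esub>"
      using Gqz by (simp add: zero_simplicial_homology hom_class_eq_iff)
    finally show "cech_inclusion k ?A ?B c \<V> = \<zero>\<^bsub>cech_homology k ?B\<^esub> \<V>" by (simp add: cech_ops \<V>)
  qed
  have ev: "linear_map coeff_field (cech_homology k ?A :: ('k, _) module) (nerve_homology k \<U>) (\<lambda>c. c \<U>)"
    by (rule linear_mapI[OF vectorspace_cech vectorspace_simplicial_homology])
      (auto simp: cech_ops \<U>(1) cech_carrierD(1)[OF _ \<U>(1)])
  have "finite (\<Union>(nerve \<U>))"
    by (rule finite_subset[OF _ \<U>(2)]) (auto simp: nerve_def)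
  from finsub_image_factor[OF ev cech_inclusion_linear[OF ABs] zero finsub_simplicial_homology[OF this]]
  show ?thesis .
qed

end


subsection \<open>Jumps of monotone integer-valued functions\<close>

text \<open>For monotone \<open>g\<close> this is the right limit minus the left limit: the
  differences decrease with \<open>e\<close> and, being integers at least 0, are eventually
  constant.\<close>

definition jump :: "(real \<Rightarrow> int) \<Rightarrow> real \<Rightarrow> int" where
  "jump g s = (LEAST n. \<exists>e>0. n = g (s + e) - g (s - e))"

text \<open>\<open>LEAST\<close> on integers is meaningful only for predicates bounded below; the
  lower bound 0 transports it to the natural numbers.\<close>

lemma int_Least:
  fixes P :: "int \<Rightarrow> bool"
  assumes "\<exists>n. P n" "\<And>n. P n \<Longrightarrow> 0 \<le> n"
  shows "P (LEAST n. P n) \<and> (\<forall>n. P n \<longrightarrow> (LEAST n. P n) \<le> n)"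
proof -
  obtain n where n: "P n" using assms by blast
  define m where "m = (LEAST m. P (int m))"
  have "P (int (nat n))" using n assms(2) by simp
  then have m: "P (int m)" unfolding m_def by (rule LeastI)
  have le: "int m \<le> n'" if "P n'" for n'
  proof -
    have "P (int (nat n'))" using that assms(2) by simp
    then have "m \<le> nat n'" unfolding m_def by (rule Least_le)
    then show ?thesis using assms(2)[OF that] by linarith
  qed
  have "(LEAST n. P n) = int m"
    by (rule Least_equality) (use m le in auto)
  then show ?thesis using m le by simp
qed

lemma Least_scale:
  fixes w :: "real \<Rightarrow> int"
  assumes nonneg: "\<And>e. 0 < e \<Longrightarrow> e < d \<Longrightarrow> 0 \<le> w e" and mono: "\<And>e e'. 0 < e \<Longrightarrow> e \<le> e' \<Longrightarrow> e' < d \<Longrightarrow> w e \<le> w e'"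
    and "0 < d"
  shows "\<exists>e0>0. e0 < d \<and> (\<forall>e. 0 < e \<longrightarrow> e \<le> e0 \<longrightarrow> w e = (LEAST n. \<exists>e>0. e < d \<and> n = w e))"
    "0 < e \<Longrightarrow> e < d \<Longrightarrow> (LEAST n. \<exists>e>0. e < d \<and> n = w e) \<le> w e"
proof -
  let ?P = "\<lambda>n. \<exists>e>0. e < d \<and> n = w e"
  have L: "?P (Least ?P) \<and> (\<forall>n. ?P n \<longrightarrow> Least ?P \<le> n)"
    by (rule int_Least) (use nonneg \<open>0 < d\<close> in \<open>auto intro!: exI[of _ "d / 2"]\<close>)
  then show le: "0 < e \<Longrightarrow> e < d \<Longrightarrow> Least ?P \<le> w e" for e
    by blast
  obtain e0 where e0: "0 < e0" "e0 < d" "Least ?P = w e0"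
    using L by blast
  have "w e = Least ?P" if "0 < e" "e \<le> e0" for e
    using le[of e] mono[of e e0] that e0 by auto
  then show "\<exists>e0>0. e0 < d \<and> (\<forall>e. 0 < e \<longrightarrow> e \<le> e0 \<longrightarrow> w e = Least ?P)"
    using e0 by blast
qed

lemma jump_props:
  assumes "mono g"
  shows "\<exists>e0>0. \<forall>e. 0 < e \<longrightarrow> e \<le> e0 \<longrightarrow> g (s + e) - g (s - e) = jump g s"
    and "0 < e \<Longrightarrow> jump g s \<le> g (s + e) - g (s - e)" and "0 \<le> jump g s"
proof -
  let ?P = "\<lambda>n. \<exists>e>0. n = g (s + e) - g (s - e)"
  have g: "x \<le> y \<Longrightarrow> g x \<le> g y" for x y
    using assms by (rule monoD)
  have L: "?P (Least ?P) \<and> (\<forall>n. ?P n \<longrightarrow> Least ?P \<le> n)"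
    by (rule int_Least) (auto intro!: exI[of _ "1::real"] g)
  then show le: "0 < e \<Longrightarrow> jump g s \<le> g (s + e) - g (s - e)" for e
    unfolding jump_def by blast
  obtain e0 where e0: "0 < e0" "jump g s = g (s + e0) - g (s - e0)"
    using L unfolding jump_def by blast
  show "0 \<le> jump g s"
    using e0 g[of "s - e0" "s + e0"] by simp
  have "g (s + e) - g (s - e) = jump g s" if "0 < e" "e \<le> e0" for e
    using le[of e] e0 that g[of "s + e" "s + e0"] g[of "s - e0" "s - e"] by simp
  then show "\<exists>e0>0. \<forall>e. 0 < e \<longrightarrow> e \<le> e0 \<longrightarrow> g (s + e) - g (s - e) = jump g s"
    using e0 by blast
qed

lemma jump_zeroI:
  assumes "mono g" "0 < e" "g (s + e) = g (s - e)"
  shows "jump g s = 0"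
  using jump_props(2)[OF assms(1,2), of s] jump_props(3)[OF assms(1), of s] assms(3) by simp

lemma jump_zeroE:
  assumes "mono g" "jump g s = 0"
  obtains e where "0 < e" "g (s + e) = g (s - e)"
proof -
  obtain e0 where "0 < e0" "\<And>e. 0 < e \<Longrightarrow> e \<le> e0 \<Longrightarrow> g (s + e) - g (s - e) = jump g s"
    using jump_props(1)[OF assms(1), of s] by blast
  from this(2)[OF this(1)] this(1) assms(2) show ?thesis
    using that[of e0] by simp
qed

lemma jump_inside:
  assumes "mono g" "a < s" "s < c" "g a = g c"
  shows "jump g s = 0"
proof (rule jump_zeroI[OF assms(1), of "min (s - a) (c - s)"])
  have g: "x \<le> y \<Longrightarrow> g x \<le> g y" for x y
    using assms by (auto dest: monoD)
  show "g (s + min (s - a) (c - s)) = g (s - min (s - a) (c - s))"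
    using g[of "s + min (s - a) (c - s)" c] g[of a "s - min (s - a) (c - s)"] assms
      g[of "s - min (s - a) (c - s)" "s + min (s - a) (c - s)"] by (auto simp: min_def)
qed (use assms in auto)

text \<open>Induction on the total increment. The first point of increase carries a positive jump,
  and just to its right the argument restarts with a smaller increment. Vanishing jumps at the
  endpoints keep every point of increase inside the open interval, so that no half of a jump is
  counted.\<close>

lemma sum_jumps:
  assumes g: "mono g" and "a < c" and "jump g a = 0" "jump g c = 0"
  shows "finite {s \<in> {a<..<c}. jump g s \<noteq> 0} \<and>
    g c - g a = (\<Sum>s\<in>{s \<in> {a<..<c}. jump g s \<noteq> 0}. jump g s)"
  using assms(2-)
proof (induction "nat (g c - g a)" arbitrary: a rule: less_induct)
  case less
  have mono: "x \<le> y \<Longrightarrow> g x \<le> g y" for x y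
    using g by (rule monoD)
  show ?case
  proof (cases "g a = g c")
    case True
    then have "{s \<in> {a<..<c}. jump g s \<noteq> 0} = {}"
      using jump_inside[OF g] by auto
    with True show ?thesis by (simp del: Collect_empty_eq)
  next
    case False
    then have lt: "g a < g c" using mono[of a c] less.prems by simp
    obtain ea where ea: "0 < ea" "g (a + ea) = g (a - ea)"
      using jump_zeroE[OF g, of a] less.prems by blast
    obtain ec where ec: "0 < ec" "g (c + ec) = g (c - ec)"
      using jump_zeroE[OF g, of c] less.prems by blast
    \<comment> \<open>The first point of increase. Local constancy of \<open>g\<close> at both
      endpoints places it strictly between them.\<close>
    define \<sigma> where "\<sigma> = Inf {s \<in> {a..c}. g a < g s}"
    have bdd: "bdd_below {s \<in> {a..c}. g a < g s}"
      by (auto intro: bdd_belowI)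
    have cin: "c \<in> {s \<in> {a..c}. g a < g s}" using lt less.prems by auto
    have ga: "g (a + ea) = g a" using mono[of a "a + ea"] mono[of "a - ea" a] ea by simp
    have "a + ea \<le> \<sigma>"
      unfolding \<sigma>_def
    proof (rule cInf_greatest)
      fix s assume "s \<in> {s \<in> {a..c}. g a < g s}"
      then show "a + ea \<le> s" using mono[of s "a + ea"] ga by (cases "s \<le> a + ea") auto
    qed (use cin in blast)
    have gc: "g (c - ec) = g c" using mono[of c "c + ec"] mono[of "c - ec" c] ec by simp
    have "a \<le> c - ec" using gc mono[of "c - ec" a] lt by (cases "a \<le> c - ec") auto
    then have "c - ec \<in> {s \<in> {a..c}. g a < g s}" using gc lt ec by auto
    then have "\<sigma> \<le> c - ec" unfolding \<sigma>_def by (rule cInf_lower[OF _ bdd])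
    have below: "g s = g a" if "a \<le> s" "s < \<sigma>" for s
    proof -
      have "\<not> g a < g s"
      proof
        assume "g a < g s"
        moreover have "s \<le> c" using that(2) \<open>\<sigma> \<le> c - ec\<close> ec(1) by linarith
        ultimately have "s \<in> {s \<in> {a..c}. g a < g s}" using that(1) by simp
        then have "\<sigma> \<le> s"
          unfolding \<sigma>_def by (rule cInf_lower[OF _ bdd])
        with that(2) show False by simp
      qed
      with mono[OF that(1)] show ?thesis by simp
    qed
    have above: "g a < g s" if \<sigma>s: "\<sigma> < s" for s
    proof -
      have "Inf {s \<in> {a..c}. g a < g s} < s" using \<sigma>s by (simp add: \<sigma>_def)
      then obtain t where "t \<in> {s \<in> {a..c}. g a < g s}" "t < s"
        using cInf_lessD[of "{s \<in> {a..c}. g a < g s}" s] cin by blast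
      then show ?thesis using mono[of t s] by auto
    qed
    obtain e0 where e0: "0 < e0" "\<And>e. 0 < e \<Longrightarrow> e \<le> e0 \<Longrightarrow> g (\<sigma> + e) - g (\<sigma> - e) = jump g \<sigma>"
      using jump_props(1)[OF g, of \<sigma>] by blast
    \<comment> \<open>\<open>e0\<close> makes the increments around \<sigma> equal to the jump; the
      other two bounds keep the interval around \<sigma> between \<open>a\<close> and
      \<open>c\<close>.\<close>
    define e where "e = min e0 (min (ea / 2) (ec / 2))"
    have e: "0 < e" "e \<le> e0" "e < ea" "e < ec"
      using e0 ea ec by (auto simp: e_def)
    \<comment> \<open>An interior point of an interval on which \<open>g\<close> is constant, so
      that its jump vanishes as the induction hypothesis requires.\<close>
    define a' where "a' = \<sigma> + e / 2"
    have jump\<sigma>: "jump g \<sigma> = g a' - g a"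
    proof -
      have "g (\<sigma> - e / 2) = g a"
        by (rule below) (use \<open>a + ea \<le> \<sigma>\<close> e in auto)
      then show ?thesis using e0(2)[of "e / 2"] e by (simp add: a'_def)
    qed
    have const: "g s = g a'" if "\<sigma> < s" "s \<le> \<sigma> + e" for s
    proof -
      have "g (\<sigma> - (s - \<sigma>)) = g a"
        by (rule below) (use \<open>a + ea \<le> \<sigma>\<close> e that in auto)
      then show ?thesis using e0(2)[of "s - \<sigma>"] e that jump\<sigma> by simp
    qed
    have "jump g a' = 0"
      by (rule jump_zeroI[OF g, of "e / 4"]) (use const[of "a' + e / 4"] const[of "a' - e / 4"] e in \<open>auto simp: a'_def\<close>)
    moreover have "a' < c" using \<open>\<sigma> \<le> c - ec\<close> e by (simp add: a'_def)
    moreover have "nat (g c - g a') < nat (g c - g a)"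
      using above[of a'] e lt mono[of a' c] \<open>a' < c\<close> by (simp add: a'_def)
    ultimately have IH: "finite {s \<in> {a'<..<c}. jump g s \<noteq> 0}"
      "g c - g a' = (\<Sum>s\<in>{s \<in> {a'<..<c}. jump g s \<noteq> 0}. jump g s)"
      using less.hyps[of a'] less.prems by auto
    have nz: "jump g \<sigma> \<noteq> 0" using jump\<sigma> above[of a'] e by (simp add: a'_def)
    have eq: "{s \<in> {a<..<c}. jump g s \<noteq> 0} = insert \<sigma> {s \<in> {a'<..<c}. jump g s \<noteq> 0}"
    proof (intro equalityI subsetI)
      fix s assume s: "s \<in> {s \<in> {a<..<c}. jump g s \<noteq> 0}"
      show "s \<in> insert \<sigma> {s \<in> {a'<..<c}. jump g s \<noteq> 0}"
      proof (rule ccontr)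
        assume not: "s \<notin> insert \<sigma> {s \<in> {a'<..<c}. jump g s \<noteq> 0}"
        then consider "s < \<sigma>" | "\<sigma> < s" "s \<le> a'" using s by force
        then have "jump g s = 0"
        proof cases
          case 1
          show ?thesis
            by (rule jump_inside[OF g, of a s "(s + \<sigma>) / 2"]) (use 1 s below[of "(s + \<sigma>) / 2"] in auto)
        next
          case 2
          show ?thesis
            by (rule jump_inside[OF g, of "(s + \<sigma>) / 2" s "\<sigma> + e"])
              (use 2 e const[of "(s + \<sigma>) / 2"] const[of "\<sigma> + e"] in \<open>auto simp: a'_def\<close>)
        qed
        then show False using s by simp
      qed
    next
      fix s assume "s \<in> insert \<sigma> {s \<in> {a'<..<c}. jump g s \<noteq> 0}"
      then show "s \<in> {s \<in> {a<..<c}. jump g s \<noteq> 0}"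
        using nz \<open>a + ea \<le> \<sigma>\<close> ea \<open>\<sigma> \<le> c - ec\<close> ec e by (auto simp: a'_def)
    qed
    have "\<sigma> \<notin> {s \<in> {a'<..<c}. jump g s \<noteq> 0}" using e by (simp add: a'_def)
    then show ?thesis
      unfolding eq using IH jump\<sigma> by simp
  qed
qed


lemma jump_diff:
  assumes "mono f" "mono g" "mono (\<lambda>s. f s - g s)"
  shows "jump (\<lambda>s. f s - g s) s = jump f s - jump g s"
proof -
  obtain e1 where e1: "0 < e1" "\<And>e. 0 < e \<Longrightarrow> e \<le> e1 \<Longrightarrow> f (s + e) - f (s - e) = jump f s"
    using jump_props(1)[OF assms(1), of s] by blast
  obtain e2 where e2: "0 < e2" "\<And>e. 0 < e \<Longrightarrow> e \<le> e2 \<Longrightarrow> g (s + e) - g (s - e) = jump g s"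
    using jump_props(1)[OF assms(2), of s] by blast
  obtain e3 where e3: "0 < e3" "\<And>e. 0 < e \<Longrightarrow> e \<le> e3 \<Longrightarrow>
      (f (s + e) - g (s + e)) - (f (s - e) - g (s - e)) = jump (\<lambda>s. f s - g s) s"
    using jump_props(1)[OF assms(3), of s] by blast
  define e where "e = min e1 (min e2 e3)"
  have "0 < e" "e \<le> e1" "e \<le> e2" "e \<le> e3" using e1 e2 e3 by (auto simp: e_def)
  with e1(2)[of e] e2(2)[of e] e3(2)[of e] show ?thesis by simp
qed

text \<open>Below, \<open>b s t\<close> is the persistent Betti number at \<open>(u' + s e, v' + t e)\<close>; it is meaningful
  for \<open>s < t + \<delta>\<close> only, where \<open>\<delta>\<close> measures the distance of \<open>(u', v')\<close> from the diagonal along \<open>e\<close>.\<close>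

locale persistence_function =
  fixes b :: "real \<Rightarrow> real \<Rightarrow> int" and \<delta> M :: real
  assumes \<delta>: "0 < \<delta>" and M: "0 < M"
    and box: "s1 \<le> s2 \<Longrightarrow> t1 \<le> t2 \<Longrightarrow> s2 < t1 + \<delta> \<Longrightarrow> b s2 t2 - b s1 t2 \<le> b s2 t1 - b s1 t1"
    and mono_s: "s1 \<le> s2 \<Longrightarrow> s2 < t + \<delta> \<Longrightarrow> b s1 t \<le> b s2 t"
    and anti_t: "t1 \<le> t2 \<Longrightarrow> s < t1 + \<delta> \<Longrightarrow> b s t2 \<le> b s t1"
    and low: "s \<le> - M \<Longrightarrow> s < t + \<delta> \<Longrightarrow> b s t = 0"
    and high: "M \<le> t \<Longrightarrow> M \<le> t' \<Longrightarrow> s < t + \<delta> \<Longrightarrow> s < t' + \<delta> \<Longrightarrow> b s t = b s t'"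
    and right_s: "0 \<le> t \<Longrightarrow> \<exists>\<eta>>0. \<eta> < t + \<delta> \<and> b \<eta> t = b 0 t"
    and right_t: "\<exists>\<epsilon>>0. b 0 \<epsilon> = b 0 0"
begin

definition w :: "real \<Rightarrow> real \<Rightarrow> real \<Rightarrow> int" where
  "w s t e = b (s + e) (t - e) - b (s - e) (t - e) - b (s + e) (t + e) + b (s - e) (t + e)"

text \<open>The multiplicity with half-widths restricted to multiples of the direction vector;
  \<open>mult_proper_eq\<close> shows that the restriction does not change the minimum.\<close>

definition m :: "real \<Rightarrow> real \<Rightarrow> int" where
  "m s t = (LEAST n. \<exists>e>0. s + e < t - e + \<delta> \<and> n = w s t e)"

definition minf :: "real \<Rightarrow> int" where
  "minf s = (LEAST n. \<exists>e t. 0 < e \<and> s + e < t + \<delta> \<and> n = b (s + e) t - b (s - e) t)"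

lemma w_nonneg: "0 < e \<Longrightarrow> s + e < t - e + \<delta> \<Longrightarrow> 0 \<le> w s t e"
  using box[of "s - e" "s + e" "t - e" "t + e"] by (simp add: w_def)

text \<open>The rectangle is enlarged first in t and then in s; each strip that is added contributes
  a nonnegative amount.\<close>

lemma box_mono:
  assumes "s1' \<le> s1" "s1 \<le> s2" "s2 \<le> s2'" "t1' \<le> t1" "t1 \<le> t2" "t2 \<le> t2'" "s2' < t1' + \<delta>"
  shows "b s2 t1 - b s1 t1 - b s2 t2 + b s1 t2 \<le> b s2' t1' - b s1' t1' - b s2' t2' + b s1' t2'"
proof -
  have "b s2 t1 - b s1 t1 - b s2 t2 + b s1 t2 \<le> b s2 t1' - b s1 t1' - b s2 t2' + b s1 t2'"
    using box[of s1 s2 t1' t1] box[of s1 s2 t2 t2'] assms by simp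
  also have "\<dots> \<le> b s2' t1' - b s1' t1' - b s2' t2' + b s1' t2'"
    using box[of s2 s2' t1' t2'] box[of s1' s1 t1' t2'] assms by simp
  finally show ?thesis .
qed

lemma w_mono: "0 < e \<Longrightarrow> e \<le> e' \<Longrightarrow> s + e' < t - e' + \<delta> \<Longrightarrow> w s t e \<le> w s t e'"
  unfolding w_def using box_mono[of "s - e'" "s - e" "s + e" "s + e'" "t - e'" "t - e" "t + e" "t + e'"]
  by simp

lemma m_props:
  assumes "s < t + \<delta>"
  shows "\<exists>e0>0. \<forall>e. 0 < e \<longrightarrow> e \<le> e0 \<longrightarrow> s + e < t - e + \<delta> \<and> w s t e = m s t"
    and "0 < e \<Longrightarrow> s + e < t - e + \<delta> \<Longrightarrow> m s t \<le> w s t e"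
    and "0 \<le> m s t"
proof -
  define d where "d = (t - s + \<delta>) / 2"
  have d: "0 < d" using assms by (simp add: d_def)
  have d': "s + e < t - e + \<delta> \<longleftrightarrow> e < d" for e by (auto simp: d_def)
  have "0 \<le> w s t e" if "0 < e" "e < d" for e using w_nonneg that d' by simp
  moreover have "w s t e \<le> w s t e'" if "0 < e" "e \<le> e'" "e' < d" for e e'
    using w_mono that d' by simp
  ultimately have
    1: "\<exists>e0>0. e0 < d \<and> (\<forall>e. 0 < e \<longrightarrow> e \<le> e0 \<longrightarrow> w s t e = (LEAST n. \<exists>e>0. e < d \<and> n = w s t e))"
    and 2: "0 < e \<Longrightarrow> e < d \<Longrightarrow> (LEAST n. \<exists>e>0. e < d \<and> n = w s t e) \<le> w s t e" for e
    using Least_scale[of d "w s t"] d by blast+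
  have m: "m s t = (LEAST n. \<exists>e>0. e < d \<and> n = w s t e)"
    by (simp add: m_def d')
  obtain e0 where e0: "0 < e0" "e0 < d" "\<And>e. 0 < e \<Longrightarrow> e \<le> e0 \<Longrightarrow> w s t e = m s t"
    using 1 unfolding m by blast
  then show "\<exists>e0>0. \<forall>e. 0 < e \<longrightarrow> e \<le> e0 \<longrightarrow> s + e < t - e + \<delta> \<and> w s t e = m s t"
    unfolding d' by (intro exI[of _ e0]) auto
  show "0 < e \<Longrightarrow> s + e < t - e + \<delta> \<Longrightarrow> m s t \<le> w s t e"
    using 2[of e] by (simp only: m d')
  show "0 \<le> m s t" using e0(3)[of e0] w_nonneg[of e0 s t] e0 d' by simp
qed

lemma m_zeroI: "0 < e \<Longrightarrow> s + e < t - e + \<delta> \<Longrightarrow> w s t e \<le> 0 \<Longrightarrow> m s t = 0"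
  using m_props(2)[of s t e] m_props(3)[of s t] by simp

theorem sum_multiplicities:
  "finite {(s, t). s \<le> 0 \<and> 0 < t \<and> m s t \<noteq> 0} \<and> finite {s. s \<le> 0 \<and> minf s \<noteq> 0} \<and>
   b 0 0 = (\<Sum>(s, t)\<in>{(s, t). s \<le> 0 \<and> 0 < t \<and> m s t \<noteq> 0}. m s t) + (\<Sum>s\<in>{s. s \<le> 0 \<and> minf s \<noteq> 0}. minf s)"
proof -
  obtain \<epsilon> where \<epsilon>: "0 < \<epsilon>" "b 0 \<epsilon> = b 0 0" using right_t by blast
  \<comment> \<open>On [0, \<epsilon>] the function \<open>b 0\<close> is constant. The sum over t
    starts at \<open>t1\<close>, with room on both sides, and all functions of t are considered from
    \<open>t0\<close> on.\<close>
  define t0 where "t0 = \<epsilon> / 4"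
  define t1 where "t1 = \<epsilon> / 2"
  have t01: "0 < t0" "t0 < t1" "t1 < \<epsilon>" using \<epsilon> by (auto simp: t0_def t1_def)
  obtain \<eta>0 where \<eta>0: "0 < \<eta>0" "\<eta>0 < t0 + \<delta>" "b \<eta>0 t0 = b 0 t0"
    using right_s[of t0] t01 by auto
  \<comment> \<open>The bound by \<delta> puts every point with s \<le> \<eta> and t \<ge> 0 into
    the domain of \<open>b\<close>.\<close>
  define \<eta> where "\<eta> = min \<eta>0 (\<delta> / 2)"
  have \<eta>: "0 < \<eta>" "\<eta> < \<delta>" "\<eta> \<le> \<eta>0" using \<eta>0 \<delta> by (auto simp: \<eta>_def)
  \<comment> \<open>By \<open>box\<close> the increment over [0, \<eta>0] at t is at most the one at
    \<open>t0\<close>, which is zero. Hence one \<eta> serves all t \<ge> t0.\<close>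
  have \<eta>_const: "b s t = b 0 t" if "0 \<le> s" "s \<le> \<eta>" "t0 \<le> t" for s t
    using box[of 0 \<eta>0 t0 t] mono_s[of 0 s t] mono_s[of s \<eta>0 t] \<eta> \<eta>0 that by simp
  \<comment> \<open>The extra 1 here and in \<open>S\<close> leaves an interval around the endpoint
    on which nothing changes, so the jumps there vanish.\<close>
  define T where "T = max (M + 1) (\<epsilon> + 1)"
  have T: "M + 1 \<le> T" "\<epsilon> < T" by (auto simp: T_def)
  define S where "S = - M - 1"
  define c where "c = \<eta> / 2"
  define B where "B t s = b (min s \<eta>) t" for t s
  have monoB: "mono (B t)" if "t0 \<le> t" for t
    unfolding B_def by (rule monoI, rule mono_s) (use \<eta> that t01 in \<open>auto simp: min_def\<close>)
  have monoG: "mono (\<lambda>s. B t s - B t' s)" if "t0 \<le> t" "t \<le> t'" for t t'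
  proof (rule monoI)
    fix x y :: real assume "x \<le> y"
    then show "B t x - B t' x \<le> B t y - B t' y"
      unfolding B_def using box[of "min x \<eta>" "min y \<eta>" t t'] \<eta> that t01 by (auto simp: min_def)
  qed
  define J where "J t s = jump (B t) s" for t s
  have J_diff: "jump (\<lambda>s. B t s - B t' s) s = J t s - J t' s" if "t0 \<le> t" "t \<le> t'" for t t' s
    unfolding J_def by (rule jump_diff) (use monoB monoG that in auto)
  have J_anti: "J t' s \<le> J t s" if "t0 \<le> t" "t \<le> t'" for t t' s
    using jump_props(3)[OF monoG[OF that]] J_diff[OF that] by (metis diff_ge_0_iff_ge)
  have J_nonneg: "0 \<le> J t s" if "t0 \<le> t" for t s
    unfolding J_def by (rule jump_props(3)[OF monoB[OF that]])
  have J_const: "J t s = J t0 s" if "t0 \<le> t" "t \<le> \<epsilon>" for t s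
  proof -
    \<comment> \<open>The difference is nonnegative and increases with x, and from \<eta> on it
      equals \<open>b 0 t - b 0 \<epsilon>\<close>, which is at most 0. So \<open>B t\<close> and
      \<open>B \<epsilon>\<close> coincide.\<close>
    have le: "B t x - B \<epsilon> x \<le> 0" "0 \<le> B t x - B \<epsilon> x" if "t0 \<le> t" "t \<le> \<epsilon>" for x t
    proof -
      have "B t x - B \<epsilon> x \<le> B t (max x \<eta>) - B \<epsilon> (max x \<eta>)"
        using monoG[OF that] by (rule monoD) simp
      also have "\<dots> = b 0 t - b 0 \<epsilon>"
        using \<eta>_const[of \<eta> t] \<eta>_const[of \<eta> \<epsilon>] \<eta> that by (simp add: B_def max_def)
      also have "\<dots> \<le> 0"
        using anti_t[of 0 t 0] \<epsilon> that t01 \<delta> by simp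
      finally show "B t x - B \<epsilon> x \<le> 0" .
      show "0 \<le> B t x - B \<epsilon> x"
        unfolding B_def using anti_t[of t \<epsilon> "min x \<eta>"] that t01 \<eta> by (simp add: min_def split: if_splits)
    qed
    have "B t = B \<epsilon>" "B t0 = B \<epsilon>"
      using le[OF that] le[of t0] t01 by (auto intro!: ext antisym simp: )
    then show ?thesis by (simp add: J_def)
  qed
  have J_zero: "J t s = 0" if "t0 \<le> t" "s \<le> S \<or> 0 < s" "s < \<eta>" for t s
  proof (cases "0 < s")
    case True
    then show ?thesis
      unfolding J_def
      by (intro jump_inside[OF monoB[OF that(1)], of 0 s \<eta>]) (use that \<eta> \<eta>_const[of \<eta> t] in \<open>auto simp: B_def\<close>)
  next
    case False
    then have "s \<le> S" using that by simp
    then show ?thesis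
      unfolding J_def
      by (intro jump_inside[OF monoB[OF that(1)], of "s - 1" s "- M"])
        (use that \<eta> M t01 low[of "s - 1" t] low[of "- M" t] in \<open>auto simp: B_def S_def min_def\<close>)
  qed
  have J_top: "J t s = J T s" if "M \<le> t" "t0 \<le> t" for t s
  proof -
    have "B t = B T"
      unfolding B_def by (rule ext, rule high) (use that T t01 \<eta> M in \<open>auto simp: min_def\<close>)
    then show ?thesis by (simp add: J_def)
  qed
  \<comment> \<open>The sign makes the function increasing in t; below \<open>t0\<close> it is
    continued as a constant.\<close>
  define H where "H s t = - J (max t t0) s" for s t
  have monoH: "mono (H s)" for s
    unfolding H_def by (rule monoI) (auto intro!: J_anti)
  have mH: "m s t = jump (H s) t" if st: "s \<le> 0" "t0 < t" for s t
  proof (rule antisym)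
    obtain e1 where e1: "0 < e1" "\<And>e. 0 < e \<Longrightarrow> e \<le> e1 \<Longrightarrow> H s (t + e) - H s (t - e) = jump (H s) t"
      using jump_props(1)[OF monoH, of s t] by blast
    \<comment> \<open>The half-width in t is fixed first, so as to realize the jump of
      \<open>H s\<close>, and then a smaller half-width \<open>e\<close> in s. The resulting
      rectangle contains the square of half-width \<open>e\<close>, whose mixed difference bounds
      \<open>m s t\<close> from above.\<close>
    define e' where "e' = min e1 (t - t0)"
    have e': "0 < e'" "e' \<le> e1" "e' \<le> t - t0" using e1 st by (auto simp: e'_def)
    have jH: "jump (H s) t = J (t - e') s - J (t + e') s"
      using e1(2)[of e'] e' by (simp add: H_def)
    let ?G = "\<lambda>x. B (t - e') x - B (t + e') x"
    have G: "mono ?G" "jump ?G s = jump (H s) t"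
      using monoG[of "t - e'" "t + e'"] J_diff[of "t - e'" "t + e'" s] jH e' by auto
    obtain e2 where e2: "0 < e2" "\<And>e. 0 < e \<Longrightarrow> e \<le> e2 \<Longrightarrow> ?G (s + e) - ?G (s - e) = jump (H s) t"
      using jump_props(1)[OF G(1), of s] G(2) by auto
    define e where "e = min e2 (min e' \<eta>)"
    have e: "0 < e" "e \<le> e2" "e \<le> e'" "e \<le> \<eta>" using e2 e' \<eta> by (auto simp: e_def)
    have "m s t \<le> w s t e"
      by (rule m_props(2)) (use e e' st \<eta> t01 in auto)
    also have "\<dots> \<le> ?G (s + e) - ?G (s - e)"
      using box_mono[of "s - e" "s - e" "s + e" "s + e" "t - e'" "t - e" "t + e" "t + e'"] e e' st \<eta> t01
      by (simp add: w_def B_def min_def)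
    also have "\<dots> = jump (H s) t" using e2(2) e by simp
    finally show "m s t \<le> jump (H s) t" .
  next
    obtain e0 where e0: "0 < e0" "\<And>e. 0 < e \<Longrightarrow> e \<le> e0 \<Longrightarrow> w s t e = m s t"
      using m_props(1)[of s t] st t01 \<delta> by auto
    \<comment> \<open>Conversely the square of half-width \<open>e\<close> realizes
      \<open>m s t\<close>, and in each variable a jump is at most the increment across it.\<close>
    define e where "e = min e0 (min \<eta> (t - t0))"
    have e: "0 < e" "e \<le> e0" "e \<le> \<eta>" "e \<le> t - t0" using e0 \<eta> st by (auto simp: e_def)
    let ?G = "\<lambda>x. B (t - e) x - B (t + e) x"
    have "jump (H s) t \<le> H s (t + e) - H s (t - e)"
      by (rule jump_props(2)[OF monoH e(1)])
    also have "\<dots> = jump ?G s"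
      using J_diff[of "t - e" "t + e" s] e by (simp add: H_def)
    also have "\<dots> \<le> ?G (s + e) - ?G (s - e)"
      by (rule jump_props(2)[OF monoG]) (use e in auto)
    also have "\<dots> = w s t e"
      using e st by (simp add: w_def B_def min_def)
    also have "\<dots> = m s t" using e0(2) e by simp
    finally show "jump (H s) t \<le> m s t" .
  qed
  have minfJ: "minf s = J T s" if s: "s \<le> 0" for s
    unfolding minf_def
  proof (rule Least_equality)
    have T0: "t0 \<le> T" using T t01 by simp
    obtain e1 where e1: "0 < e1" "\<And>e. 0 < e \<Longrightarrow> e \<le> e1 \<Longrightarrow> B T (s + e) - B T (s - e) = J T s"
      using jump_props(1)[OF monoB[OF T0], of s] unfolding J_def by blast
    define e where "e = min e1 \<eta>"
    have e: "0 < e" "e \<le> e1" "e \<le> \<eta>" using e1 \<eta> by (auto simp: e_def)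
    have "J T s = b (s + e) T - b (s - e) T"
      using e1(2)[of e] e s by (simp add: B_def min_def)
    then show "\<exists>e t. 0 < e \<and> s + e < t + \<delta> \<and> J T s = b (s + e) t - b (s - e) t"
      using e s \<eta> T0 t01 by (intro exI[of _ e] exI[of _ T]) auto
  next
    fix n assume "\<exists>e t. 0 < e \<and> s + e < t + \<delta> \<and> n = b (s + e) t - b (s - e) t"
    then obtain e t where n: "0 < e" "s + e < t + \<delta>" "n = b (s + e) t - b (s - e) t" by blast
    define e' where "e' = min e \<eta>"
    have e': "0 < e'" "e' \<le> e" "e' \<le> \<eta>" using n \<eta> by (auto simp: e'_def)
    \<comment> \<open>Raising t lowers the difference by \<open>box\<close>, and shrinking the
      half-width lowers it by monotonicity. From \<open>M\<close> on the difference no longer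
      depends on t, so the minimum is the jump at level \<open>T\<close>.\<close>
    define t' where "t' = max t T"
    have t': "t \<le> t'" "T \<le> t'" "t0 \<le> t'" using T t01 by (auto simp: t'_def)
    have "J T s = J t' s" using J_top[of t' s] t' T by simp
    also have "\<dots> \<le> B t' (s + e') - B t' (s - e')"
      unfolding J_def by (rule jump_props(2)[OF monoB[OF t'(3)] e'(1)])
    also have "\<dots> = b (s + e') t' - b (s - e') t'"
      using e' s by (simp add: B_def min_def)
    also have "\<dots> \<le> b (s + e') t - b (s - e') t"
      using box[of "s - e'" "s + e'" t t'] e' t' n by simp
    also have "\<dots> \<le> n"
      using mono_s[of "s - e" "s - e'" t] mono_s[of "s + e'" "s + e" t] n e' by simp
    finally show "J T s \<le> n" .
  qed
  \<comment> \<open>The claim sums over all t > 0, the jump formula only over t > t1. Up to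
    \<open>t1\<close> the mixed difference is bounded by a drop of \<open>b 0\<close> inside
    [0, \<epsilon>], where there is none.\<close>
  have m_low: "m s t = 0" if st: "s \<le> 0" "0 < t" "t \<le> t1" for s t
  proof -
    \<comment> \<open>Here t may lie below \<open>t0\<close>, where \<eta> gives no control, so
      right-continuity is invoked anew at height t / 2.\<close>
    obtain \<eta>' where \<eta>': "0 < \<eta>'" "\<eta>' < t / 2 + \<delta>" "b \<eta>' (t / 2) = b 0 (t / 2)"
      using right_s[of "t / 2"] st by auto
    define e where "e = min \<eta>' (t / 2)"
    have e: "0 < e" "e \<le> \<eta>'" "e \<le> t / 2" using \<eta>' st by (auto simp: e_def)
    have "w s t e \<le> b (s + e) (t - e) - b (s + e) (t + e)"
      using anti_t[of "t - e" "t + e" "s - e"] e st \<delta> by (simp add: w_def)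
    also have "\<dots> \<le> b \<eta>' (t - e) - b \<eta>' (t + e)"
      using box[of "s + e" \<eta>' "t - e" "t + e"] e st \<eta>' by simp
    also have "\<dots> \<le> b 0 (t - e) - b 0 (t + e)"
      using box[of 0 \<eta>' "t / 2" "t - e"] box[of 0 \<eta>' "t / 2" "t + e"] mono_s[of 0 \<eta>' "t - e"]
        mono_s[of 0 \<eta>' "t + e"] \<eta>' e st by simp
    also have "\<dots> \<le> b 0 0 - b 0 \<epsilon>"
    proof -
      have "t + e \<le> \<epsilon>" using e st by (simp add: t1_def)
      then show ?thesis
        using anti_t[of 0 "t - e" 0] anti_t[of "t + e" \<epsilon> 0] e st \<delta> by simp
    qed
    finally have "w s t e \<le> 0" using \<epsilon> by simp
    then show ?thesis
      using m_zeroI[of e s t] e st \<eta>' \<delta> by simp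
  qed
  have m_high: "m s t = 0" if st: "s \<le> 0" "T \<le> t" for s t
  proof -
    define e :: real where "e = 1 / 2"
    have "b (s + e) (t - e) = b (s + e) (t + e)" "b (s - e) (t - e) = b (s - e) (t + e)"
      by (rule high; use st T \<delta> M in \<open>auto simp: e_def\<close>)+
    then have "w s t e \<le> 0" by (simp add: w_def)
    then show ?thesis
      using m_zeroI[of e s t] st T M \<delta> by (simp add: e_def)
  qed
  define A where "A = {s \<in> {S<..<c}. J t1 s \<noteq> 0}"
  have c: "0 < c" "c < \<eta>" using \<eta> by (auto simp: c_def)
  have S: "S < 0" using M by (simp add: S_def)
  have "finite {s \<in> {S<..<c}. jump (B t1) s \<noteq> 0} \<and>
    B t1 c - B t1 S = (\<Sum>s\<in>{s \<in> {S<..<c}. jump (B t1) s \<noteq> 0}. jump (B t1) s)"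
    by (rule sum_jumps) (use monoB[of t1] t01 J_zero[of t1 S] J_zero[of t1 c] c S \<eta> in \<open>auto simp: J_def\<close>)
  \<comment> \<open>At the right end \<open>B t1\<close> takes the value \<open>b 0 t1\<close>,
    which equals \<open>b 0 0\<close>; at the left end it is zero.\<close>
  then have A: "finite A" "b 0 0 = (\<Sum>s\<in>A. J t1 s)"
    using \<eta>_const[of c t1] c t01 low[of S t1] S \<eta> \<epsilon> anti_t[of 0 t1 0] anti_t[of t1 \<epsilon> 0] \<delta>
    by (simp_all add: A_def J_def B_def min_def) (auto simp: S_def)
  have A_neg: "s \<le> 0" if "s \<in> A" for s
    using J_zero[of t1 s] t01 that c by (force simp: A_def)
  \<comment> \<open>\<open>J\<close> decreases in t and is constant from \<open>t0\<close> to
    \<open>t1\<close>, so where it vanishes at \<open>t1\<close> it vanishes at every t \<ge> t0.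
    The one finite set \<open>A\<close> thus serves all columns.\<close>
  have J_A: "J t s = 0" if "s \<le> 0" "s \<notin> A" "t0 \<le> t" for s t
  proof -
    have "J t1 s = 0"
      using that J_zero[of t1 s] t01 \<eta> c by (cases "s \<le> S") (auto simp: A_def)
    then have "J t0 s = 0" using J_const[of t1 s] t01 by simp
    then show ?thesis using J_anti[of t0 t s] J_nonneg[of t s] that by simp
  qed
  have col: "finite {t \<in> {t1<..<T}. m s t \<noteq> 0} \<and>
      J t1 s = J T s + (\<Sum>t\<in>{t \<in> {t1<..<T}. m s t \<noteq> 0}. m s t)" if s: "s \<le> 0" for s
  proof -
    have "jump (H s) t1 = 0"
      by (rule jump_inside[OF monoH, of t0 t1 \<epsilon>]) (use t01 J_const[of \<epsilon> s] in \<open>auto simp: H_def max_def\<close>)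
    moreover have "jump (H s) T = 0"
      by (rule jump_inside[OF monoH, of "max M t0" T "T + 1"])
        (use T t01 J_top[of "max M t0" s] J_top[of "T + 1" s] in \<open>auto simp: H_def max_def\<close>)
    ultimately have *: "finite {t \<in> {t1<..<T}. jump (H s) t \<noteq> 0} \<and>
        H s T - H s t1 = (\<Sum>t\<in>{t \<in> {t1<..<T}. jump (H s) t \<noteq> 0}. jump (H s) t)"
      by (intro sum_jumps monoH) (use T t01 in auto)
    have eq: "{t \<in> {t1<..<T}. jump (H s) t \<noteq> 0} = {t \<in> {t1<..<T}. m s t \<noteq> 0}"
      using mH[OF s] t01 by auto
    have "(\<Sum>t\<in>{t \<in> {t1<..<T}. m s t \<noteq> 0}. jump (H s) t) = (\<Sum>t\<in>{t \<in> {t1<..<T}. m s t \<noteq> 0}. m s t)"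
      using mH[OF s] t01 by (intro sum.cong) auto
    then show ?thesis
      using * T t01 unfolding eq by (simp add: H_def max_def split: if_splits)
  qed
  have P_eq: "{(s, t). s \<le> 0 \<and> 0 < t \<and> m s t \<noteq> 0} = Sigma A (\<lambda>s. {t \<in> {t1<..<T}. m s t \<noteq> 0})"
  proof (intro equalityI subsetI)
    fix p assume p: "p \<in> {(s, t). s \<le> 0 \<and> 0 < t \<and> m s t \<noteq> 0}"
    obtain s t where st: "p = (s, t)" "s \<le> 0" "0 < t" "m s t \<noteq> 0" using p by auto
    then have t: "t1 < t" "t < T" using m_low[of s t] m_high[of s t] by (force simp: not_le[symmetric])+
    have "s \<in> A"
    proof (rule ccontr)
      assume "s \<notin> A"
      then have "H s = (\<lambda>_. 0)" using J_A st by (auto simp: H_def)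
      then have "jump (H s) t = 0" using jump_zeroI[OF monoH, of 1 s t] by simp
      then show False using mH[of s t] st t t01 by simp
    qed
    then show "p \<in> Sigma A (\<lambda>s. {t \<in> {t1<..<T}. m s t \<noteq> 0})" using st t by simp
  next
    fix p assume "p \<in> Sigma A (\<lambda>s. {t \<in> {t1<..<T}. m s t \<noteq> 0})"
    then show "p \<in> {(s, t). s \<le> 0 \<and> 0 < t \<and> m s t \<noteq> 0}" using A_neg t01 by auto
  qed
  have Q_sub: "{s. s \<le> 0 \<and> minf s \<noteq> 0} \<subseteq> A"
    using minfJ J_A[of _ T] T t01 by force
  have "finite {(s, t). s \<le> 0 \<and> 0 < t \<and> m s t \<noteq> 0}"
    unfolding P_eq using A col A_neg by (intro finite_SigmaI) auto
  moreover have "finite {s. s \<le> 0 \<and> minf s \<noteq> 0}"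
    by (rule finite_subset[OF Q_sub A(1)])
  moreover have "b 0 0 = (\<Sum>s\<in>A. (\<Sum>t\<in>{t \<in> {t1<..<T}. m s t \<noteq> 0}. m s t)) + (\<Sum>s\<in>A. minf s)"
    unfolding A(2) sum.distrib[symmetric] using col A_neg minfJ by (intro sum.cong) auto
  moreover have "(\<Sum>s\<in>A. (\<Sum>t\<in>{t \<in> {t1<..<T}. m s t \<noteq> 0}. m s t))
      = (\<Sum>(s, t)\<in>{(s, t). s \<le> 0 \<and> 0 < t \<and> m s t \<noteq> 0}. m s t)"
    unfolding P_eq using A col A_neg by (intro sum.Sigma) auto
  moreover have "(\<Sum>s\<in>A. minf s) = (\<Sum>s\<in>{s. s \<le> 0 \<and> minf s \<noteq> 0}. minf s)"
    by (rule sum.mono_neutral_right) (use A Q_sub A_neg in auto)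
  ultimately show ?thesis by simp
qed

end


subsection \<open>Persistent Betti numbers\<close>

lemma subdim_zero:
  assumes "vectorspace K V"
  shows "subdim K V {\<zero>\<^bsub>V\<^esub>} = 0"
proof -
  interpret V: vectorspace K V by fact
  have "subspace K {\<zero>\<^bsub>V\<^esub>} V" by (rule submoduleI'[OF assms]) auto
  then interpret Z: vectorspace K "V\<lparr>carrier := {\<zero>\<^bsub>V\<^esub>}\<rparr>"
    by (rule V.subspace_is_vs)
  have "subspace K (Z.span {\<zero>\<^bsub>V\<^esub>}) (V\<lparr>carrier := {\<zero>\<^bsub>V\<^esub>}\<rparr>)"
    by (rule Z.span_is_subspace) simp
  from subspaceD(2,3)[OF this] have "Z.gen_set {\<zero>\<^bsub>V\<^esub>}" by auto
  then show ?thesis unfolding subdim_def by (intro Z.dim0I) simp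
qed

lemma cech_homology_empty:
  assumes "topspace A = {}" and c: "c \<in> carrier (cech_homology k A)"
  shows "c = \<zero>\<^bsub>cech_homology k A\<^esub>"
proof (rule cech_eqI[OF cech_carrierD(3)[OF c] cech_ops(6)])
  fix \<U> assume \<U>: "\<U> \<in> open_covers A"
  have "\<Inter>S = {}" if "S \<subseteq> \<U>" "S \<noteq> {}" for S
    using open_coversD(3)[OF \<U>] that assms(1) by blast
  then have nerve: "nerve \<U> = {}" by (auto simp: nerve_def)
  obtain z where z: "z \<in> cycles (nerve \<U>) k" "c \<U> = hom_class (nerve \<U>) k z"
    using cech_carrierD(1)[OF c \<U>] by (auto simp: carrier_simplicial_homology)
  then have "Poly_Mapping.keys z = {}"
    unfolding nerve by (auto simp: cycles_def simplicial_chains_def)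
  then have "z = 0" by simp
  then show "c \<U> = \<zero>\<^bsub>cech_homology k A\<^esub> \<U>"
    by (simp add: cech_ops \<U> z(2) zero_simplicial_homology)
qed

section \<open>The componentwise strict order\<close>

lemma vec_less_trans [trans]:
  "u \<prec>\<^sub>n v \<Longrightarrow> v \<le> w \<Longrightarrow> u \<prec>\<^sub>n w" "u \<le> v \<Longrightarrow> v \<prec>\<^sub>n w \<Longrightarrow> u \<prec>\<^sub>n w"
  unfolding vec_less_def less_eq_vec_def by (meson order_less_le_trans order_le_less_trans)+

lemma vec_less_imp_le: "u \<prec>\<^sub>n v \<Longrightarrow> u \<le> v"
  by (simp add: vec_less_def less_eq_vec_def less_imp_le)

lemma open_vec_less:
  fixes v :: "real ^ 'n"
  shows "open {y. y \<prec>\<^sub>n v}"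
proof -
  have "{y. y \<prec>\<^sub>n v} = (\<Inter>i. {y. y $ i < v $ i})" by (auto simp: vec_less_def)
  moreover have "open {y :: real ^ 'n. y $ i < v $ i}" for i
    by (intro open_Collect_less continuous_intros)
  ultimately show ?thesis by (simp add: open_INT)
qed

lemma vec_less_scale:
  assumes "0 \<prec>\<^sub>n e" "0 \<prec>\<^sub>n e'"
  shows "\<exists>c>0. c *\<^sub>R e \<le> e'"
proof -
  define c where "c = Min (range (\<lambda>i. e' $ i / e $ i))"
  have "0 < c" unfolding c_def using assms by (subst Min_gr_iff) (auto simp: vec_less_def)
  moreover have "c * e $ i \<le> e' $ i" for i
  proof -
    have "c \<le> e' $ i / e $ i" unfolding c_def by (rule Min_le) auto
    then show ?thesis using assms(1) by (simp add: vec_less_def field_simps)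
  qed
  ultimately show ?thesis by (auto simp: less_eq_vec_def)
qed

lemma vec_less_room:
  assumes "u \<prec>\<^sub>n v" "0 \<prec>\<^sub>n e"
  shows "\<exists>c>0. u + c *\<^sub>R e \<prec>\<^sub>n v"
proof -
  have "0 \<prec>\<^sub>n (1 / 2) *\<^sub>R (v - u)" using assms(1) by (simp add: vec_less_def)
  from vec_less_scale[OF assms(2) this] obtain c where c: "0 < c" "c *\<^sub>R e \<le> (1 / 2) *\<^sub>R (v - u)" by blast
  have "u $ i + c * e $ i < v $ i" for i
  proof -
    have "c * e $ i \<le> (v $ i - u $ i) / 2" using c(2) by (simp add: less_eq_vec_def)
    moreover have "u $ i < v $ i" using assms(1) by (simp add: vec_less_def)
    ultimately show ?thesis by argo
  qed
  then show ?thesis using c(1) by (intro exI[of _ c]) (simp add: vec_less_def)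
qed

locale filtered_space = embedded_space X h K
  for X :: "'a topology" and h :: "'a \<Rightarrow> 'm::euclidean_space" and K :: "'m set" +
  fixes f :: "'a \<Rightarrow> real ^ 'n"
  assumes cont: "continuous_map X euclidean f"
begin

definition S :: "real ^ 'n \<Rightarrow> 'a set" where
  "S u = {x \<in> topspace X. f x \<le> u}"

lemma sublevel_eq: "sublevel X f u = subtopology X (S u)"
  by (simp add: sublevel_def S_def)

lemma S_sub: "S u \<subseteq> topspace X" and S_mono: "u \<le> v \<Longrightarrow> S u \<subseteq> S v"
  by (auto simp: S_def)

lemma sublevel_sub: "u \<le> v \<Longrightarrow> sublevel X f u = subtopology (sublevel X f v) (S u)"
  unfolding sublevel_eq by (rule subtopology_of_subset[OF S_mono])

lemma closedin_S: "closedin X (S u)"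
proof -
  have "closedin euclidean {y :: real ^ 'n. y \<le> u}"
    using closed_eucl_atMost[of u] by (simp add: atMost_def)
  from closedin_continuous_map_preimage[OF cont this] show ?thesis by (simp add: S_def)
qed

lemma compact_S: "compact (h ` S u)"
  by (rule compact_image[OF closedin_S])

text \<open>The open set of points with values strictly below \<open>v\<close> contains the compact
  \<open>S u\<close>; a Lebesgue number of this one-member cover is the width.\<close>

lemma collar:
  assumes "u \<prec>\<^sub>n v"
  shows "\<exists>\<epsilon>>0. \<forall>a\<in>S u. \<forall>x\<in>topspace X. dist (h a) (h x) < \<epsilon> \<longrightarrow> x \<in> S v"
proof -
  let ?V = "{x \<in> topspace X. f x \<in> {y. y \<prec>\<^sub>n v}}"
  have "openin X ?V"
    by (rule openin_continuous_map_preimage[OF cont]) (simp add: open_vec_less)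
  moreover have "S u \<subseteq> ?V" using assms by (auto simp: S_def intro: vec_less_trans)
  ultimately have "\<exists>ll>0. \<forall>a\<in>S u. \<exists>V\<in>{?V}. \<forall>x\<in>topspace X. dist (h a) (h x) < ll \<longrightarrow> x \<in> V"
    by (intro lebesgue_number[OF _ S_sub compact_S]) auto
  then show ?thesis by (fastforce simp: S_def intro: vec_less_imp_le)
qed

section \<open>Images of inclusions and their ranks\<close>

abbreviation H :: "'k itself \<Rightarrow> int \<Rightarrow> real ^ 'n \<Rightarrow> ('k::field, _) module" where
  "H F k u \<equiv> cech_homology k (sublevel X f u)"

abbreviation inc :: "'k itself \<Rightarrow> int \<Rightarrow> real ^ 'n \<Rightarrow> real ^ 'n \<Rightarrow> ('a set set \<Rightarrow> ('a set list \<Rightarrow>\<^sub>0 'k::field) set) \<Rightarrow> _" where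
  "inc F k u v \<equiv> cech_inclusion k (sublevel X f u) (sublevel X f v)"

definition image where "image F k u v = inc F k u v ` carrier (H F k u)"

lemma betti_eq: "betti F k X f u v = subdim coeff_field (H F k v) (image F k u v)"
  by (simp add: betti_def subdim_def image_def)

lemma inc_linear: "u \<le> v \<Longrightarrow> linear_map coeff_field (H F k u) (H F k v) (inc F k u v)"
  by (rule cech_inclusion_linear[OF sublevel_sub])

lemma inc_comp: "u \<le> v \<Longrightarrow> v \<le> w \<Longrightarrow> c \<in> carrier (H F k u) \<Longrightarrow> inc F k v w (inc F k u v c) = inc F k u w c"
  by (rule cech_inclusion_comp[OF sublevel_sub sublevel_sub sublevel_sub]) auto

lemma inc_carrier: "u \<le> v \<Longrightarrow> c \<in> carrier (H F k u) \<Longrightarrow> inc F k u v c \<in> carrier (H F k v)"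
  by (rule cech_inclusion_carrier[OF sublevel_sub])

lemma image_subspace: "u \<le> v \<Longrightarrow> subspace coeff_field (image F k u v) (H F k v)"
  unfolding image_def by (rule subspace_image[OF inc_linear subspace_carrier[OF vectorspace_cech]])

lemma image_finsub: "u \<prec>\<^sub>n v \<Longrightarrow> finsub coeff_field (H F k v) (image F k u v)"
  using collar[of u v] finsub_cech_image[OF S_sub compact_S S_sub compact_S]
  unfolding image_def sublevel_eq by blast

lemma image_mono: "u \<le> u' \<Longrightarrow> u' \<le> v \<Longrightarrow> image F k u v \<subseteq> image F k u' v"
  unfolding image_def
proof
  fix x assume le: "u \<le> u'" "u' \<le> v" and "x \<in> inc F k u v ` carrier (H F k u)"
  then obtain c where c: "c \<in> carrier (H F k u)" "x = inc F k u v c" by blast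
  then have "x = inc F k u' v (inc F k u u' c)" using inc_comp[OF le c(1)] by simp
  then show "x \<in> inc F k u' v ` carrier (H F k u')" using inc_carrier[OF le(1) c(1)] by blast
qed

lemma image_push: "u \<le> v \<Longrightarrow> v \<le> w \<Longrightarrow> inc F k v w ` image F k u v = image F k u w"
  unfolding image_def image_image using inc_comp by (intro image_cong) auto

lemma betti_box:
  assumes "u1 \<le> u2" "v1 \<le> v2" "u2 \<prec>\<^sub>n v1"
  shows "int (betti F k X f u2 v2) - int (betti F k X f u1 v2) \<le> int (betti F k X f u2 v1) - int (betti F k X f u1 v1)"
proof -
  have le: "u2 \<le> v1" "u1 \<le> v1" using vec_less_imp_le[OF assms(3)] assms(1) by auto
  show ?thesis
    unfolding betti_eq
    using subdim_image_diff_le[OF inc_linear[OF assms(2)] image_finsub[OF assms(3)] image_subspace[OF le(2)] image_mono[OF assms(1) le(1)]]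
    by (simp add: image_push[OF le(1) assms(2)] image_push[OF le(2) assms(2)])
qed

lemma betti_mono: "u1 \<le> u2 \<Longrightarrow> u2 \<prec>\<^sub>n v \<Longrightarrow> betti F k X f u1 v \<le> betti F k X f u2 v"
  unfolding betti_eq
  by (rule finsub_mono(2)[OF image_subspace image_finsub image_mono]) (auto dest: vec_less_imp_le)

lemma betti_anti:
  assumes "v1 \<le> v2" "u \<prec>\<^sub>n v1"
  shows "betti F k X f u v2 \<le> betti F k X f u v1"
  unfolding betti_eq
  using subdim_image_le[OF inc_linear[OF assms(1)] image_finsub[OF assms(2)]]
  by (simp add: image_push[OF vec_less_imp_le[OF assms(2)] assms(1)])

lemma betti_empty:
  assumes "S u = {}" "u \<le> v"
  shows "betti F k X f u v = 0"
proof -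
  have "topspace (sublevel X f u) = {}" using assms(1) by (simp add: sublevel_eq)
  then have "carrier (H F k u) = {\<zero>\<^bsub>H F k u\<^esub>}"
    using cech_homology_empty subspaceD(3)[OF subspace_carrier[OF vectorspace_cech]] by blast
  then have "image F k u v = {\<zero>\<^bsub>H F k v\<^esub>}"
    using linear_mapD(6)[OF inc_linear[OF assms(2)]] by (simp add: image_def)
  then show ?thesis
    unfolding betti_eq by (simp only: subdim_zero[OF vectorspace_cech])
qed

text \<open>A nearest-point choice, in general discontinuous, serves as the map \<open>\<rho>\<close> of
  \<^locale>\<open>cech_shrinking\<close>.\<close>

definition proj :: "real ^ 'n \<Rightarrow> 'a \<Rightarrow> 'a" where
  "proj u x = (SOME a. a \<in> S u \<and> (\<forall>b\<in>S u. dist (h x) (h a) \<le> dist (h x) (h b)))"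

lemma proj_props:
  assumes "S u \<noteq> {}"
  shows "proj u x \<in> S u" "b \<in> S u \<Longrightarrow> dist (h x) (h (proj u x)) \<le> dist (h x) (h b)"
proof -
  have ne: "h ` S u \<noteq> {}" using assms by simp
  obtain y where y: "y \<in> h ` S u" "\<And>z. z \<in> h ` S u \<Longrightarrow> dist (h x) y \<le> dist (h x) z"
    by (rule distance_attains_inf[OF compact_imp_closed[OF compact_S[of u]] ne, of "h x"]) (rule that)
  then obtain a where "a \<in> S u" "y = h a" by blast
  with y(2) have "\<exists>a. a \<in> S u \<and> (\<forall>b\<in>S u. dist (h x) (h a) \<le> dist (h x) (h b))"
    by (intro exI[of _ a]) simp
  then have "proj u x \<in> S u \<and> (\<forall>b\<in>S u. dist (h x) (h (proj u x)) \<le> dist (h x) (h b))"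
    unfolding proj_def by (rule someI_ex)
  then show "proj u x \<in> S u" "b \<in> S u \<Longrightarrow> dist (h x) (h (proj u x)) \<le> dist (h x) (h b)"
    by simp_all
qed

text \<open>The images of the points of \<open>S (U n)\<close> at distance at least \<open>l\<close>
  from \<open>S u\<close> form decreasing compact sets. A common point would lie in all
  \<open>S (U n)\<close>, hence in \<open>S u\<close>. If \<open>S u\<close> is empty, the
  conclusion says that some \<open>S (U n)\<close> is empty.\<close>

lemma sublevels_converge:
  fixes U :: "nat \<Rightarrow> real ^ 'n"
  assumes dec: "\<And>m n. m \<le> n \<Longrightarrow> U n \<le> U m" and lim: "\<And>y. (\<And>n. y \<le> U n) \<Longrightarrow> y \<le> u" and "0 < l"
  shows "\<exists>n. \<forall>x\<in>S (U n). \<exists>a\<in>S u. dist (h x) (h a) < l"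
proof (rule ccontr)
  assume neg: "\<nexists>n. \<forall>x\<in>S (U n). \<exists>a\<in>S u. dist (h x) (h a) < l"
  define C where "C n = h ` S (U n) - (\<Union>a\<in>S u. ball (h a) l)" for n
  have "\<Inter>(range C) \<noteq> {}"
  proof (rule compact_nest)
    show "compact (C n)" for n
      unfolding C_def by (intro compact_diff compact_S open_UN ballI open_ball)
    show "C n \<noteq> {}" for n
    proof -
      have "\<exists>x\<in>S (U n). \<forall>a\<in>S u. \<not> dist (h x) (h a) < l" using neg by blast
      then show ?thesis by (force simp: C_def dist_commute)
    qed
    show "C n \<subseteq> C m" if "m \<le> n" for m n
      unfolding C_def using S_mono[OF dec[OF that]] by blast
  qed
  then obtain y where y: "\<And>n. y \<in> C n" by blast
  obtain x where x: "x \<in> S (U 0)" "y = h x" using y[of 0] by (auto simp: C_def)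
  have "x \<in> S (U n)" for n
  proof -
    obtain x' where "x' \<in> S (U n)" "y = h x'" using y[of n] by (auto simp: C_def)
    moreover from this have "x = x'"
      using x S_sub by (intro inj_onD[OF inj_h]) auto
    ultimately show ?thesis by simp
  qed
  then have "x \<in> S u" using lim[of "f x"] by (simp add: S_def)
  then have "y \<in> ball (h x) l" using x(2) \<open>0 < l\<close> by simp
  then show False using y[of 0] \<open>x \<in> S u\<close> by (auto simp: C_def)
qed

lemma shrinking:
  fixes U :: "nat \<Rightarrow> real ^ 'n"
  assumes U: "\<And>n. u \<le> U n" and dec: "\<And>m n. m \<le> n \<Longrightarrow> U n \<le> U m" and lim: "\<And>y. (\<And>n. y \<le> U n) \<Longrightarrow> y \<le> u"
  shows "cech_shrinking X (\<lambda>n. S (U n)) (S u) (proj u)"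
proof
  show "S u \<subseteq> S (U n)" for n by (rule S_mono[OF U])
  show "S (U (Suc n)) \<subseteq> S (U n)" for n by (rule S_mono[OF dec]) simp
  show "proj u x = x" if "x \<in> topspace X" "x \<in> S u" for x
  proof -
    have "S u \<noteq> {}" "x \<in> S u" using that by auto
    have "proj u x \<in> S u" by (rule proj_props(1)) fact
    have "dist (h x) (h (proj u x)) \<le> dist (h x) (h x)" by (rule proj_props(2)) fact+
    then have "h (proj u x) = h x" by simp
    then show ?thesis using \<open>proj u x \<in> S u\<close> that S_sub by (intro inj_onD[OF inj_h]) auto
  qed
  fix \<V> assume \<V>: "\<And>V. V \<in> \<V> \<Longrightarrow> openin X V" "topspace X \<inter> S u \<subseteq> \<Union>\<V>"
  have cov: "S u \<subseteq> \<Union>\<V>" using \<V>(2) S_sub by blast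
  obtain l where l: "0 < l" "\<forall>a\<in>S u. \<exists>V\<in>\<V>. \<forall>x\<in>topspace X. dist (h a) (h x) < l \<longrightarrow> x \<in> V"
    using lebesgue_number[OF \<V>(1) S_sub compact_S cov] by blast
  \<comment> \<open>Three steps of this length lead from the projection of w via w and x to the
    projection of x, and their total stays below the Lebesgue number \<open>l\<close>.\<close>
  have "0 < l / 4" using l by simp
  obtain n where n: "\<forall>x\<in>S (U n). \<exists>a\<in>S u. dist (h x) (h a) < l / 4"
  proof -
    have "\<exists>n. \<forall>x\<in>S (U n). \<exists>a\<in>S u. dist (h x) (h a) < l / 4"
      by (rule sublevels_converge) (fact dec lim \<open>0 < l / 4\<close>)+
    then show ?thesis using that by blast
  qed
  obtain \<W> where \<W>: "\<W> \<in> open_covers (subtopology X (S (U n)))" "{} \<notin> \<W>"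
    "\<forall>W\<in>\<W>. \<forall>x\<in>W. \<forall>y\<in>W. dist (h x) (h y) < l / 4"
    using small_cover[OF S_sub compact_S \<open>0 < l / 4\<close>, of "U n"] by auto
  have near: "proj u x \<in> S u \<and> dist (h x) (h (proj u x)) < l / 4" if x: "x \<in> S (U n)" for x
  proof -
    obtain a where a: "a \<in> S u" "dist (h x) (h a) < l / 4" using n x by blast
    then have "S u \<noteq> {}" by blast
    from proj_props(1)[OF this] proj_props(2)[OF this a(1)] a(2) show ?thesis by (meson order_le_less_trans)
  qed
  have "\<forall>W\<in>\<W>. proj u ` W \<subseteq> topspace X \<inter> S u \<and> (\<exists>V\<in>\<V>. W \<union> proj u ` W \<subseteq> V)"
  proof
    fix W assume W: "W \<in> \<W>"
    have WS: "W \<subseteq> S (U n)" using open_coversD(3)[OF \<W>(1) W] by auto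
    obtain w where w: "w \<in> W" using W \<W>(2) by (metis ex_in_conv)
    obtain V where V: "V \<in> \<V>" "\<forall>x\<in>topspace X. dist (h (proj u w)) (h x) < l \<longrightarrow> x \<in> V"
      using l(2) near[of w] w WS by blast
    have "x \<in> V \<and> proj u x \<in> V" if x: "x \<in> W" for x
    proof -
      have 1: "dist (h w) (h x) < l / 4" using \<W>(3) W w x by blast
      have 2: "dist (h w) (h (proj u w)) < l / 4" "dist (h x) (h (proj u x)) < l / 4" "proj u x \<in> S u"
        using near w x WS by blast+
      have "dist (h (proj u w)) (h x) < l"
        using 1 2 dist_triangle3[of "h (proj u w)" "h x" "h w"] l(1) by linarith
      moreover have "dist (h (proj u w)) (h (proj u x)) < l"
        using 1 2 dist_triangle3[of "h (proj u w)" "h x" "h w"] dist_triangle[of "h (proj u w)" "h (proj u x)" "h x"] l(1)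
        by linarith
      ultimately show ?thesis using V(2) 2(3) x WS S_sub by blast
    qed
    then show "proj u ` W \<subseteq> topspace X \<inter> S u \<and> (\<exists>V\<in>\<V>. W \<union> proj u ` W \<subseteq> V)"
      using V(1) near WS S_sub by blast
  qed
  with \<W>(1) show "\<exists>n. \<exists>\<W>\<in>open_covers (subtopology X (S (U n))).
    \<forall>W\<in>\<W>. proj u ` W \<subseteq> topspace X \<inter> S u \<and> (\<exists>V\<in>\<V>. W \<union> proj u ` W \<subseteq> V)" by blast
qed

lemma shrinking_line:
  assumes e: "0 \<prec>\<^sub>n e" and "0 < c"
  shows "cech_shrinking X (\<lambda>n. S (u + (c / real (Suc n)) *\<^sub>R e)) (S u) (proj u)"
proof (rule shrinking)
  have e0: "0 \<le> e $ i" for i using e by (simp add: vec_less_def less_imp_le)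
  show "u \<le> u + (c / real (Suc n)) *\<^sub>R e" for n
    using e0 \<open>0 < c\<close> by (simp add: less_eq_vec_def)
  show "u + (c / real (Suc n)) *\<^sub>R e \<le> u + (c / real (Suc m)) *\<^sub>R e" if "m \<le> n" for m n
    using that \<open>0 < c\<close> e0 by (auto simp: less_eq_vec_def intro!: mult_right_mono divide_left_mono)
  show "y \<le> u" if y: "\<And>n. y \<le> u + (c / real (Suc n)) *\<^sub>R e" for y
    unfolding less_eq_vec_def
  proof
    fix i
    have "(\<lambda>n. u $ i + c / real (Suc n) * e $ i) \<longlonglongrightarrow> u $ i + 0 * e $ i"
      by (intro tendsto_intros LIMSEQ_Suc[OF lim_const_over_n])
    moreover have "y $ i \<le> u $ i + c / real (Suc n) * e $ i" for n
      using y[of n] by (simp add: less_eq_vec_def)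
    ultimately show "y $ i \<le> u $ i" using LIMSEQ_le_const[of _ "u $ i + 0 * e $ i" "y $ i"] by auto
  qed
qed

text \<open>The images of the larger sublevel sets in the homology of \<open>v\<close> stabilize. A
  class in the stable image comes from each of these sets, so Mittag-Leffler gives a thread of
  preimages, whose limit is a class on \<open>S u\<close>.\<close>

lemma betti_right_continuous_u:
  assumes uv: "u \<prec>\<^sub>n v" and e: "0 \<prec>\<^sub>n e"
  shows "\<exists>\<eta>>0. u + \<eta> *\<^sub>R e \<prec>\<^sub>n v \<and> betti F k X f (u + \<eta> *\<^sub>R e) v = betti F k X f u v"
proof -
  obtain c where c: "0 < c" "u + c *\<^sub>R e \<prec>\<^sub>n v" using vec_less_room[OF uv e] by blast
  define U where "U n = u + (c / real (Suc n)) *\<^sub>R e" for n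
  interpret cech_shrinking X "\<lambda>n. S (U n)" "S u" "proj u"
    unfolding U_def by (rule shrinking_line[OF e c(1)])
  have e0: "0 < e $ i" for i using e by (simp add: vec_less_def)
  \<comment> \<open>Strictness yields the finite rank of the connecting maps that Mittag-Leffler
    requires.\<close>
  have U_less: "U n \<prec>\<^sub>n U m" if "m < n" for m n
    using that c(1) e0 by (auto simp: U_def vec_less_def intro!: mult_strict_right_mono divide_strict_left_mono)
  have U_mono: "U n \<le> U m" if "m \<le> n" for m n
    using U_less[of m n] that vec_less_imp_le by (cases "m = n") auto
  have uU: "u \<le> U n" for n using c(1) e0 by (auto simp: U_def less_eq_vec_def intro!: mult_nonneg_nonneg less_imp_le)
  have Uv: "U n \<prec>\<^sub>n v" for n
    using vec_less_trans(2)[OF U_mono[of 0 n] ] c(2) by (simp add: U_def)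
  note Uv' = vec_less_imp_le[OF Uv]
  have "\<exists>N. \<forall>n\<ge>N. image F k (U n) v = image F k (U N) v"
    by (rule decreasing_subspaces_stabilize[where K = coeff_field and V = "H F k v", OF image_subspace[OF Uv']
          image_finsub[OF Uv] image_mono[OF U_mono Uv']]) simp
  then obtain N where N: "\<And>n. n \<ge> N \<Longrightarrow> image F k (U n) v = image F k (U N) v" by blast
  have "image F k (U N) v \<subseteq> image F k u v"
  proof
    fix x assume x: "x \<in> image F k (U N) v"
    have x_image: "x \<in> inc F k (U n) v ` carrier (H F k (U n))" for n
      using x N[of n] image_mono[OF U_mono[of n N] Uv'[of n]] by (cases "N \<le> n") (auto simp: image_def)
    then obtain y where y: "\<And>n. y n \<in> carrier (H F k (U n)) \<and> inc F k (U (Suc n)) (U n) (y (Suc n)) = y n"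
      "inc F k (U 0) v (y 0) = x"
    proof -
      have "\<exists>y. (\<forall>n. y n \<in> carrier (H F k (U n)) \<and> inc F k (U (Suc n)) (U n) (y (Suc n)) = y n) \<and> inc F k (U 0) v (y 0) = x"
      proof (rule mittag_leffler_thread[where K = coeff_field and V = "\<lambda>n. H F k (U n)" and f = "\<lambda>m n. inc F k (U n) (U m)"
          and g = "\<lambda>n. inc F k (U n) v" and x = x])
        show "linear_map coeff_field (H F k (U n)) (H F k (U m)) (inc F k (U n) (U m))" if "m \<le> n" for m n
          by (rule inc_linear[OF U_mono[OF that]])
        show "inc F k (U m) (U l) (inc F k (U n) (U m) c) = inc F k (U n) (U l) c"
          if "l \<le> m" "m \<le> n" "c \<in> carrier (H F k (U n))" for l m n c
          by (rule inc_comp[OF U_mono[OF that(2)] U_mono[OF that(1)] that(3)])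
        show "finsub coeff_field (H F k (U m)) (inc F k (U n) (U m) ` carrier (H F k (U n)))" if "m < n" for m n
          using image_finsub[OF U_less[OF that]] by (simp only: image_def)
        show "inc F k (U 0) v (inc F k (U n) (U 0) c) = inc F k (U n) v c" if "c \<in> carrier (H F k (U n))" for n c
          by (rule inc_comp[OF U_mono Uv' that]) simp
        show "x \<in> inc F k (U n) v ` carrier (H F k (U n))" for n by (rule x_image)
      qed
      then show ?thesis using that by blast
    qed
    have "S (U 0) \<subseteq> S v" by (rule S_mono[OF Uv'])
    from thread_limit[OF _ _ this, of y k] y obtain z where "z \<in> carrier (H F k u)" "inc F k u v z = x"
      unfolding sublevel_eq by auto
    then show "x \<in> image F k u v" by (auto simp: image_def)
  qed
  moreover have "image F k u v \<subseteq> image F k (U N) v" by (rule image_mono[OF uU Uv'])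
  ultimately have "betti F k X f (U N) v = betti F k X f u v" unfolding betti_eq by simp
  then show ?thesis using Uv[of N] c(1) unfolding U_def by (intro exI[of _ "c / real (Suc N)"]) auto
qed

text \<open>The kernels of the maps to the larger sublevel sets, taken inside the finite-dimensional
  image of \<open>u\<close>, decrease and stabilize. A class in the stable kernel dies in all of
  these sets, so it is zero by \<open>inclusion_injective\<close>, and from there on the rank is
  preserved.\<close>

lemma betti_right_continuous_v:
  assumes uv: "u \<prec>\<^sub>n v" and e: "0 \<prec>\<^sub>n e"
  shows "\<exists>\<eta>>0. betti F k X f u (v + \<eta> *\<^sub>R e) = betti F k X f u v"
proof -
  define V where "V n = v + (1 / real (Suc n)) *\<^sub>R e" for n
  interpret cech_shrinking X "\<lambda>n. S (V n)" "S v" "proj v"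
    unfolding V_def by (rule shrinking_line[OF e]) simp
  have e0: "0 < e $ i" for i using e by (simp add: vec_less_def)
  have V_mono: "V n \<le> V m" if "m \<le> n" for m n
  proof -
    have "1 / real (Suc n) \<le> 1 / real (Suc m)" using that by (intro divide_left_mono) auto
    then have "1 / real (Suc n) * e $ i \<le> 1 / real (Suc m) * e $ i" for i
      by (rule mult_right_mono) (simp add: e0 less_imp_le)
    then show ?thesis by (simp add: V_def less_eq_vec_def)
  qed
  have vV: "v \<le> V n" for n using e0 by (auto simp: V_def less_eq_vec_def intro!: less_imp_le)
  let ?I = "image F k u v"
  define Z where "Z n = {x \<in> ?I. inc F k v (V n) x = \<zero>\<^bsub>H F k (V n)\<^esub>}" for n
  note nullity = image_rank_nullity[OF inc_linear[OF vV] image_finsub[OF uv]]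
  have sub: "subspace coeff_field (Z n) (H F k v)" for n
    unfolding Z_def by (rule nullity(3))
  have I_carrier: "x \<in> carrier (H F k v)" if "x \<in> ?I" for x
    using that subspaceD(2)[OF image_subspace[OF vec_less_imp_le[OF uv]]] by blast
  have kernel: "inc F k v (V n) x = \<zero>\<^bsub>H F k (V n)\<^esub>" if "n \<le> n'" and x: "x \<in> Z n'" for n n' x
  proof -
    have "x \<in> ?I" and 0: "inc F k v (V n') x = \<zero>\<^bsub>H F k (V n')\<^esub>" using x by (simp_all add: Z_def)
    have "inc F k v (V n) x = inc F k (V n') (V n) (inc F k v (V n') x)"
      by (rule inc_comp[OF vV V_mono[OF \<open>n \<le> n'\<close>] I_carrier[OF \<open>x \<in> ?I\<close>], symmetric])
    also have "\<dots> = \<zero>\<^bsub>H F k (V n)\<^esub>"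
      unfolding 0 by (rule linear_mapD(6)[OF inc_linear[OF V_mono[OF \<open>n \<le> n'\<close>]]])
    finally show ?thesis .
  qed
  have "\<exists>N. \<forall>n\<ge>N. Z n = Z N"
  proof (rule decreasing_subspaces_stabilize[where K = coeff_field and V = "H F k v", OF sub])
    show "finsub coeff_field (H F k v) (Z 0)"
      by (rule finsub_mono(1)[OF sub image_finsub[OF uv]]) (auto simp: Z_def)
    show "Z (Suc n) \<subseteq> Z n" for n
    proof
      fix x assume x: "x \<in> Z (Suc n)"
      show "x \<in> Z n" using kernel[OF _ x, of n] x by (simp add: Z_def)
    qed
  qed
  then obtain N where N: "\<And>n. n \<ge> N \<Longrightarrow> Z n = Z N" by blast
  have Z0: "Z N = {\<zero>\<^bsub>H F k v\<^esub>}"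
  proof (intro equalityI subsetI)
    fix x assume x: "x \<in> Z N"
    have "inc F k v (V n) x = \<zero>\<^bsub>H F k (V n)\<^esub>" for n
    proof -
      have "x \<in> Z (max n N)" using N[of "max n N"] x by simp
      then show ?thesis by (rule kernel[rotated]) simp
    qed
    then have "x = \<zero>\<^bsub>H F k v\<^esub>"
      using inclusion_injective[of x k] I_carrier x unfolding sublevel_eq Z_def by auto
    then show "x \<in> {\<zero>\<^bsub>H F k v\<^esub>}" by simp
  qed (use subspaceD(3)[OF sub] in auto)
  then have "subdim coeff_field (H F k (V N)) (inc F k v (V N) ` ?I) = subdim coeff_field (H F k v) ?I"
  proof -
    have "subdim coeff_field (H F k (V N)) (inc F k v (V N) ` ?I) + subdim coeff_field (H F k v) (Z N)
        = subdim coeff_field (H F k v) ?I"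
      unfolding Z_def by (rule nullity(2))
    then show ?thesis
      unfolding Z0 by (simp add: subdim_zero[OF vectorspace_cech])
  qed
  then have "betti F k X f u (V N) = betti F k X f u v"
    unfolding betti_eq by (simp add: image_push[OF vec_less_imp_le[OF uv] vV])
  then show ?thesis unfolding V_def by (intro exI[of _ "1 / real (Suc N)"]) simp
qed

end


subsection \<open>Restriction to a line\<close>

context filtered_space
begin

context
  fixes F :: "'k::field itself" and k :: int and u' v' e :: "real ^ 'n"
  assumes uv: "u' \<prec>\<^sub>n v'" and e: "0 \<prec>\<^sub>n e" and cpt: "compact_space X"
begin

definition b :: "real \<Rightarrow> real \<Rightarrow> int" where
  "b s t = int (betti F k X f (u' + s *\<^sub>R e) (v' + t *\<^sub>R e))"

definition \<delta> :: real where
  "\<delta> = Min (range (\<lambda>i. (v' $ i - u' $ i) / e $ i))"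

lemma e_pos: "0 < e $ i"
  using e by (simp add: vec_less_def)

lemma line_less_iff: "u' + s *\<^sub>R e \<prec>\<^sub>n v' + t *\<^sub>R e \<longleftrightarrow> s < t + \<delta>"
proof -
  have "s < t + \<delta> \<longleftrightarrow> s - t < \<delta>" by auto
  also have "\<dots> \<longleftrightarrow> (\<forall>i. s - t < (v' $ i - u' $ i) / e $ i)"
    unfolding \<delta>_def by (subst Min_gr_iff) auto
  also have "\<dots> \<longleftrightarrow> (\<forall>i. u' $ i + s * e $ i < v' $ i + t * e $ i)"
    by (intro all_cong1, subst pos_less_divide_eq[OF e_pos]) (simp add: algebra_simps)
  finally show ?thesis by (simp add: vec_less_def)
qed

lemma line_le: "s \<le> s' \<Longrightarrow> x + s *\<^sub>R e \<le> x + s' *\<^sub>R e"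
  using e_pos by (simp add: less_eq_vec_def mult_right_mono less_imp_le)

lemma bounded_filtration:
  "\<exists>M>0. (\<forall>s\<le>-M. S (u' + s *\<^sub>R e) = {}) \<and> (\<forall>t\<ge>M. S (v' + t *\<^sub>R e) = topspace X)"
proof -
  have "compact (f ` topspace X)"
    using image_compactin[OF _ cont, of "topspace X"] cpt by (simp add: compact_space_def)
  then have "bounded (f ` topspace X)" by (rule compact_imp_bounded)
  then obtain R where R: "\<And>x. x \<in> topspace X \<Longrightarrow> norm (f x) \<le> R" by (auto simp: bounded_iff)
  define g where "g i = (\<bar>R\<bar> + \<bar>u' $ i\<bar> + \<bar>v' $ i\<bar>) / e $ i" for i
  \<comment> \<open>The sum of the nonnegative \<open>g i\<close> bounds each of them, and the 1
    makes the bound strict.\<close>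
  define M where "M = 1 + (\<Sum>i\<in>UNIV. g i)"
  have g0: "0 \<le> g i" for i using e_pos[of i] by (simp add: g_def)
  have M: "g i < M" for i
    using member_le_sum[of i UNIV g] g0 by (simp add: M_def)
  have M': "\<bar>R\<bar> + \<bar>u' $ i\<bar> + \<bar>v' $ i\<bar> < M * e $ i" for i
    using M[of i] e_pos[of i] by (simp add: g_def pos_divide_less_eq)
  have fR: "\<bar>f x $ i\<bar> \<le> \<bar>R\<bar>" if "x \<in> topspace X" for x i
    using R[OF that] component_le_norm_cart[of "f x" i] by linarith
  have "0 < M" using M g0 by (meson order_le_less_trans)
  moreover have "S (u' + s *\<^sub>R e) = {}" if s: "s \<le> - M" for s
  proof -
    have "\<not> f x \<le> u' + s *\<^sub>R e" if x: "x \<in> topspace X" for x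
    proof
      assume le: "f x \<le> u' + s *\<^sub>R e"
      fix i :: 'n
      have "f x $ i \<le> u' $ i + s * e $ i" using le by (simp add: less_eq_vec_def)
      moreover have "s * e $ i \<le> - M * e $ i" using s e_pos[of i] by (intro mult_right_mono) auto
      ultimately show False using M'[of i] fR[OF x, of i] by linarith
    qed
    then show ?thesis by (auto simp: S_def)
  qed
  moreover have "S (v' + t *\<^sub>R e) = topspace X" if t: "M \<le> t" for t
  proof -
    have "f x \<le> v' + t *\<^sub>R e" if x: "x \<in> topspace X" for x
      unfolding less_eq_vec_def
    proof
      fix i
      have "M * e $ i \<le> t * e $ i" using t e_pos[of i] by (intro mult_right_mono) auto
      then have "f x $ i \<le> v' $ i + t * e $ i" using M'[of i] fR[OF x, of i] by linarith
      then show "f x $ i \<le> (v' + t *\<^sub>R e) $ i" by simp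
    qed
    then show ?thesis by (auto simp: S_def)
  qed
  ultimately show ?thesis by (intro exI[of _ M]) auto
qed

lemma persistence_function_line: "\<exists>M. persistence_function b \<delta> M"
proof -
  obtain M where M: "0 < M" "\<And>s. s \<le> - M \<Longrightarrow> S (u' + s *\<^sub>R e) = {}"
    "\<And>t. M \<le> t \<Longrightarrow> S (v' + t *\<^sub>R e) = topspace X"
    using bounded_filtration by auto
  have "persistence_function b \<delta> M"
  proof
    show "0 < \<delta>" using line_less_iff[of 0 0] uv by simp
    show "0 < M" by fact
    show "b s2 t2 - b s1 t2 \<le> b s2 t1 - b s1 t1" if "s1 \<le> s2" "t1 \<le> t2" "s2 < t1 + \<delta>" for s1 s2 t1 t2
      unfolding b_def by (rule betti_box) (use that line_le line_less_iff in auto)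
    show "b s1 t \<le> b s2 t" if "s1 \<le> s2" "s2 < t + \<delta>" for s1 s2 t
      unfolding b_def using betti_mono[OF line_le[OF that(1)], of u' "v' + t *\<^sub>R e"] that line_less_iff by simp
    show "b s t2 \<le> b s t1" if "t1 \<le> t2" "s < t1 + \<delta>" for t1 t2 s
      unfolding b_def using betti_anti[OF line_le[OF that(1)], of "u' + s *\<^sub>R e" v'] that line_less_iff by simp
    show "b s t = 0" if "s \<le> - M" "s < t + \<delta>" for s t
    proof -
      have "u' + s *\<^sub>R e \<le> v' + t *\<^sub>R e"
        by (rule vec_less_imp_le) (simp add: line_less_iff that)
      then show ?thesis
        unfolding b_def using betti_empty[OF M(2)[OF that(1)]] by simp
    qed
    show "b s t = b s t'" if "M \<le> t" "M \<le> t'" "s < t + \<delta>" "s < t' + \<delta>" for t t' s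
      unfolding b_def betti_def sublevel_eq by (simp only: M(3)[OF that(1)] M(3)[OF that(2)])
    show "\<exists>\<eta>>0. \<eta> < t + \<delta> \<and> b \<eta> t = b 0 t" if "0 \<le> t" for t
    proof -
      have "u' \<prec>\<^sub>n v' + t *\<^sub>R e" using line_less_iff[of 0 t] line_less_iff[of 0 0] uv that by simp
      from betti_right_continuous_u[OF this e, of F k] show ?thesis
        unfolding b_def line_less_iff by simp
    qed
    show "\<exists>\<epsilon>>0. b 0 \<epsilon> = b 0 0"
      using betti_right_continuous_v[OF uv e, of F k] by (simp add: b_def)
  qed
  then show ?thesis ..
qed

section \<open>Multiplicities computed along the line\<close>

definition rect :: "real ^ 'n \<Rightarrow> real ^ 'n \<Rightarrow> real ^ 'n \<Rightarrow> int" where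
  "rect u v d = int (betti F k X f (u + d) (v - d)) - int (betti F k X f (u - d) (v - d))
     - int (betti F k X f (u + d) (v + d)) + int (betti F k X f (u - d) (v + d))"

lemma rect_mono:
  assumes "0 \<prec>\<^sub>n d" "d \<le> d'" "u + d' \<prec>\<^sub>n v - d'"
  shows "rect u v d \<le> rect u v d'"
proof -
  have d0: "0 \<le> d $ i" "d $ i \<le> d' $ i" for i
    using assms(1,2) by (auto simp: vec_less_def less_eq_vec_def less_imp_le)
  have d1: "- d $ i \<le> d $ i" for i
    using d0[of i] by linarith
  have le: "u - d' \<le> u - d" "u - d \<le> u + d" "u + d \<le> u + d'" "v - d' \<le> v - d" "v - d \<le> v + d" "v + d \<le> v + d'"
    using d0 d1 by (simp_all add: less_eq_vec_def)
  have less: "u + d \<prec>\<^sub>n v - d'" using le(3) assms(3) by (rule vec_less_trans(2))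
  have less2: "u + d \<prec>\<^sub>n v + d" using less le(4,5) by (meson vec_less_trans(1))
  have less3: "u - d \<prec>\<^sub>n v - d'" using le(2) less by (rule vec_less_trans(2))
  have vv: "v - d' \<le> v + d'" using le(4-6) by (rule order_trans[OF order_trans])
  show ?thesis
    unfolding rect_def
    using betti_box[OF le(2) le(4) less, where F = F and k = k] betti_box[OF le(2) le(6) less2, where F = F and k = k]
      betti_box[OF le(3) vv assms(3), where F = F and k = k] betti_box[OF le(1) vv less3, where F = F and k = k]
    by linarith
qed

lemma mult_proper_eq:
  assumes "s < t + \<delta>"
  shows "mult_proper F k X f (u' + s *\<^sub>R e) (v' + t *\<^sub>R e) = persistence_function.m b \<delta> s t"
proof -
  obtain M where "persistence_function b \<delta> M" using persistence_function_line by blast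
  then interpret persistence_function b \<delta> M .
  let ?u = "u' + s *\<^sub>R e" and ?v = "v' + t *\<^sub>R e"
  have w: "w s t \<epsilon> = rect ?u ?v (\<epsilon> *\<^sub>R e)" for \<epsilon>
    by (simp add: w_def rect_def b_def algebra_simps)
  have dom: "?u + \<epsilon> *\<^sub>R e \<prec>\<^sub>n ?v - \<epsilon> *\<^sub>R e \<longleftrightarrow> s + \<epsilon> < t - \<epsilon> + \<delta>" for \<epsilon>
    using line_less_iff[of "s + \<epsilon>" "t - \<epsilon>"] by (simp add: algebra_simps)
  show ?thesis
    unfolding mult_proper_def rect_def[symmetric]
  proof (rule Least_equality)
    obtain e0 where e0: "0 < e0" "s + e0 < t - e0 + \<delta>" "w s t e0 = m s t"
      using m_props(1)[OF assms] by blast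
    have "0 \<prec>\<^sub>n e0 *\<^sub>R e" using e0(1) e_pos by (simp add: vec_less_def)
    moreover have "?u + e0 *\<^sub>R e \<prec>\<^sub>n ?v - e0 *\<^sub>R e" using e0(2) by (simp only: dom)
    ultimately show "\<exists>d. 0 \<prec>\<^sub>n d \<and> ?u + d \<prec>\<^sub>n ?v - d \<and> m s t = rect ?u ?v d"
      using w e0(3) by metis
  next
    fix n assume "\<exists>d. 0 \<prec>\<^sub>n d \<and> ?u + d \<prec>\<^sub>n ?v - d \<and> n = rect ?u ?v d"
    then obtain d where d: "0 \<prec>\<^sub>n d" "?u + d \<prec>\<^sub>n ?v - d" "n = rect ?u ?v d" by blast
    obtain \<epsilon> where \<epsilon>: "0 < \<epsilon>" "\<epsilon> *\<^sub>R e \<le> d" using vec_less_scale[OF e d(1)] by blast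
    have "?u + \<epsilon> *\<^sub>R e \<prec>\<^sub>n ?v - d" by (rule vec_less_trans(2)[OF add_left_mono[OF \<epsilon>(2)] d(2)])
    then have "?u + \<epsilon> *\<^sub>R e \<prec>\<^sub>n ?v - \<epsilon> *\<^sub>R e" by (rule vec_less_trans(1)) (rule diff_left_mono[OF \<epsilon>(2)])
    then have "m s t \<le> w s t \<epsilon>" by (intro m_props(2)[OF assms \<epsilon>(1)]) (simp only: dom)
    also have "\<dots> \<le> n"
      unfolding w d(3) by (rule rect_mono[OF _ \<epsilon>(2) d(2)]) (use e_pos \<epsilon>(1) in \<open>simp add: vec_less_def\<close>)
    finally show "m s t \<le> n" .
  qed
qed

lemma mult_infinity_eq:
  "mult_infinity F k X f (u' + s *\<^sub>R e) = persistence_function.minf b \<delta> s"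
proof -
  obtain M where "persistence_function b \<delta> M" using persistence_function_line by blast
  then interpret persistence_function b \<delta> M .
  let ?u = "u' + s *\<^sub>R e"
  let ?P = "\<lambda>n. \<exists>\<epsilon> t. 0 < \<epsilon> \<and> s + \<epsilon> < t + \<delta> \<and> n = b (s + \<epsilon>) t - b (s - \<epsilon>) t"
  have diff: "b (s + \<epsilon>) t - b (s - \<epsilon>) t = int (betti F k X f (?u + \<epsilon> *\<^sub>R e) (v' + t *\<^sub>R e))
      - int (betti F k X f (?u - \<epsilon> *\<^sub>R e) (v' + t *\<^sub>R e))" for \<epsilon> t
    by (simp add: b_def algebra_simps)
  have dom: "?u + \<epsilon> *\<^sub>R e \<prec>\<^sub>n v' + t *\<^sub>R e \<longleftrightarrow> s + \<epsilon> < t + \<delta>" for \<epsilon> t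
    using line_less_iff[of "s + \<epsilon>" t] by (simp add: algebra_simps)
  have L: "?P (minf s) \<and> (\<forall>n. ?P n \<longrightarrow> minf s \<le> n)"
    unfolding minf_def
  proof (rule int_Least)
    show "\<exists>n. ?P n" by (rule exI, rule exI[of _ 1], rule exI[of _ "s + 2"]) (use \<delta> in auto)
    show "0 \<le> n" if "?P n" for n using that mono_s[of "s - \<epsilon>" "s + \<epsilon>" t for \<epsilon> t] by force
  qed
  show ?thesis
    unfolding mult_infinity_def
  proof (rule Least_equality)
    obtain \<epsilon> t where \<epsilon>t: "0 < \<epsilon>" "s + \<epsilon> < t + \<delta>" "minf s = b (s + \<epsilon>) t - b (s - \<epsilon>) t"
      using L by blast
    have "0 \<prec>\<^sub>n \<epsilon> *\<^sub>R e" using \<epsilon>t(1) e_pos by (simp add: vec_less_def)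
    moreover have "?u + \<epsilon> *\<^sub>R e \<prec>\<^sub>n v' + t *\<^sub>R e" using \<epsilon>t(2) by (simp only: dom)
    ultimately show "\<exists>d v. 0 \<prec>\<^sub>n d \<and> ?u + d \<prec>\<^sub>n v \<and>
        minf s = int (betti F k X f (?u + d) v) - int (betti F k X f (?u - d) v)"
      using \<epsilon>t(3) unfolding diff by blast
  next
    fix n assume "\<exists>d v. 0 \<prec>\<^sub>n d \<and> ?u + d \<prec>\<^sub>n v \<and> n = int (betti F k X f (?u + d) v) - int (betti F k X f (?u - d) v)"
    then obtain d v where d: "0 \<prec>\<^sub>n d" "?u + d \<prec>\<^sub>n v" "n = int (betti F k X f (?u + d) v) - int (betti F k X f (?u - d) v)" by blast
    obtain \<epsilon> where \<epsilon>: "0 < \<epsilon>" "\<epsilon> *\<^sub>R e \<le> d" using vec_less_scale[OF e d(1)] by blast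
    \<comment> \<open>An arbitrary \<open>v\<close> need not lie on the line through
      \<open>v'\<close>. It is moved up to a point of the line, which by \<open>betti_box\<close>
      can only lower the difference.\<close>
    have "\<exists>t. v \<le> v' + t *\<^sub>R e"
    proof -
      define t where "t = Max (range (\<lambda>i. (v $ i - v' $ i) / e $ i))"
      have "v $ i \<le> v' $ i + t * e $ i" for i
      proof -
        have "(v $ i - v' $ i) / e $ i \<le> t" unfolding t_def by (rule Max_ge) auto
        then show ?thesis using e_pos[of i] by (simp add: pos_divide_le_eq algebra_simps)
      qed
      then show ?thesis by (auto simp: less_eq_vec_def)
    qed
    then obtain t where t: "v \<le> v' + t *\<^sub>R e" by blast
    have le: "?u - d \<le> ?u - \<epsilon> *\<^sub>R e" "?u - \<epsilon> *\<^sub>R e \<le> ?u + \<epsilon> *\<^sub>R e" "?u + \<epsilon> *\<^sub>R e \<le> ?u + d"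
      using \<epsilon> e_pos by (auto intro: diff_left_mono simp: less_eq_vec_def intro!: order_trans[of _ 0] less_imp_le)
    have less: "?u + \<epsilon> *\<^sub>R e \<prec>\<^sub>n v" by (rule vec_less_trans(2)[OF le(3) d(2)])
    then have "?u + \<epsilon> *\<^sub>R e \<prec>\<^sub>n v' + t *\<^sub>R e" using t by (rule vec_less_trans(1))
    then have "minf s \<le> b (s + \<epsilon>) t - b (s - \<epsilon>) t" using L \<epsilon>(1) dom by blast
    also have "\<dots> \<le> int (betti F k X f (?u + \<epsilon> *\<^sub>R e) v) - int (betti F k X f (?u - \<epsilon> *\<^sub>R e) v)"
      unfolding diff by (rule betti_box[OF le(2) t less])
    also have "\<dots> \<le> n"
      using betti_mono[OF le(3) d(2), of F k] betti_mono[OF le(1) vec_less_trans(2)[OF le(2) less], of F k]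
      unfolding d(3) by linarith
    finally show "minf s \<le> n" .
  qed
qed

theorem betti_eq_sum_multiplicities:
  defines "P \<equiv> {(u, v). u \<le> u' \<and> v' \<prec>\<^sub>n v \<and> u' - u \<in> span {e} \<and> v - v' \<in> span {e}}"
    and "Q \<equiv> {u. u \<le> u' \<and> u' - u \<in> span {e}}"
  shows "finite {(u, v) \<in> P. mult_proper F k X f u v \<noteq> 0} \<and>
    finite {u \<in> Q. mult_infinity F k X f u \<noteq> 0} \<and>
    int (betti F k X f u' v') =
      (\<Sum>(u, v) \<in> {(u, v) \<in> P. mult_proper F k X f u v \<noteq> 0}. mult_proper F k X f u v) +
      (\<Sum>u \<in> {u \<in> Q. mult_infinity F k X f u \<noteq> 0}. mult_infinity F k X f u)"
proof -
  obtain M where "persistence_function b \<delta> M" using persistence_function_line by blast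
  then interpret persistence_function b \<delta> M .
  let ?\<phi> = "\<lambda>(s, t). (u' + s *\<^sub>R e, v' + t *\<^sub>R e)" and ?\<psi> = "\<lambda>s. u' + s *\<^sub>R e"
  let ?A = "{(s, t). s \<le> 0 \<and> 0 < t \<and> m s t \<noteq> 0}" and ?B = "{s. s \<le> 0 \<and> minf s \<noteq> 0}"
  have e_ne: "e \<noteq> 0"
    using e_pos[of undefined] by auto
  have Q: "Q = ?\<psi> ` {s. s \<le> 0}"
  proof (intro equalityI subsetI)
    fix u assume "u \<in> Q"
    then obtain c where c: "u \<le> u'" "u' - u = c *\<^sub>R e" by (auto simp: Q_def span_singleton)
    \<comment> \<open>All coordinates of \<open>e\<close> are positive, so any one coordinate
      decides the sign of the multiple.\<close>
    fix i :: 'n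
    have "0 \<le> (u' - u) $ i" using c(1) by (simp add: less_eq_vec_def)
    then have "0 \<le> c * e $ i" unfolding c(2) by simp
    then have "0 \<le> c" using e_pos[of i] by (simp add: zero_le_mult_iff)
    moreover have "u = u' + (- c) *\<^sub>R e" using c(2) by (simp add: algebra_simps)
    ultimately show "u \<in> ?\<psi> ` {s. s \<le> 0}" by (intro image_eqI[of _ _ "- c"]) auto
  next
    fix u assume "u \<in> ?\<psi> ` {s. s \<le> 0}"
    then obtain s where s: "s \<le> 0" "u = u' + s *\<^sub>R e" by blast
    have "u \<le> u'" using line_le[OF s(1), of u'] s(2) by simp
    moreover have "u' - u \<in> span {e}" using s(2) by (simp add: span_neg span_scale span_base)
    ultimately show "u \<in> Q" by (simp add: Q_def)
  qed
  have mem: "p \<in> ?\<phi> ` {(s, t). R s t} \<longleftrightarrow> (\<exists>s t. R s t \<and> p = (u' + s *\<^sub>R e, v' + t *\<^sub>R e))" for p R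
    by (simp add: image_iff Bex_def split_paired_Ex)
  have P: "P = ?\<phi> ` {(s, t). s \<le> 0 \<and> 0 < t}"
  proof -
    have "{v. v' \<prec>\<^sub>n v \<and> v - v' \<in> span {e}} = (\<lambda>t. v' + t *\<^sub>R e) ` {t. 0 < t}"
    proof (intro equalityI subsetI)
      fix v assume "v \<in> {v. v' \<prec>\<^sub>n v \<and> v - v' \<in> span {e}}"
      then obtain c where c: "v' \<prec>\<^sub>n v" "v - v' = c *\<^sub>R e" by (auto simp: span_singleton)
      fix i :: 'n
      have "0 < (v - v') $ i" using c(1) by (simp add: vec_less_def)
      then have "0 < c * e $ i" unfolding c(2) by simp
      then have "0 < c" using e_pos[of i] by (simp add: zero_less_mult_iff)
      moreover have "v = v' + c *\<^sub>R e" using c(2) by (simp add: algebra_simps)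
      ultimately show "v \<in> (\<lambda>t. v' + t *\<^sub>R e) ` {t. 0 < t}" by blast
    qed (use e_pos in \<open>auto simp: vec_less_def span_singleton\<close>)
    moreover have "P = Q \<times> {v. v' \<prec>\<^sub>n v \<and> v - v' \<in> span {e}}" by (auto simp: P_def Q_def)
    ultimately have PQ: "P = Q \<times> (\<lambda>t. v' + t *\<^sub>R e) ` {t. 0 < t}" by simp
    show ?thesis
    proof (intro equalityI subsetI)
      fix p assume "p \<in> P"
      then obtain s t where "p = (u' + s *\<^sub>R e, v' + t *\<^sub>R e)" "s \<le> 0" "0 < t"
        unfolding PQ Q by blast
      then show "p \<in> ?\<phi> ` {(s, t). s \<le> 0 \<and> 0 < t}" by (intro image_eqI[of _ _ "(s, t)"]) auto
    next
      fix p assume "p \<in> ?\<phi> ` {(s, t). s \<le> 0 \<and> 0 < t}"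
      then obtain s t where "p = (u' + s *\<^sub>R e, v' + t *\<^sub>R e)" "s \<le> 0" "0 < t"
        unfolding mem by blast
      then show "p \<in> P" unfolding PQ Q by blast
    qed
  qed
  have mp: "mult_proper F k X f (u' + s *\<^sub>R e) (v' + t *\<^sub>R e) = m s t" if "s \<le> 0" "0 < t" for s t
    by (rule mult_proper_eq) (use that \<delta> in auto)
  have 1: "{(u, v) \<in> P. mult_proper F k X f u v \<noteq> 0} = ?\<phi> ` ?A"
  proof (intro equalityI subsetI)
    fix p assume "p \<in> {(u, v) \<in> P. mult_proper F k X f u v \<noteq> 0}"
    then obtain u v where p: "p = (u, v)" "(u, v) \<in> P" "mult_proper F k X f u v \<noteq> 0" by blast
    then obtain s t where st: "s \<le> 0" "0 < t" "u = u' + s *\<^sub>R e" "v = v' + t *\<^sub>R e"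
      unfolding P mem by blast
    then have "m s t \<noteq> 0" using p(3) mp[OF st(1,2)] by simp
    then show "p \<in> ?\<phi> ` ?A" using st p(1) by (intro image_eqI[of _ _ "(s, t)"]) auto
  next
    fix p assume "p \<in> ?\<phi> ` ?A"
    then obtain s t where st: "s \<le> 0" "0 < t" "m s t \<noteq> 0" "p = (u' + s *\<^sub>R e, v' + t *\<^sub>R e)"
      unfolding mem by blast
    then have "p \<in> P" unfolding P mem by blast
    then show "p \<in> {(u, v) \<in> P. mult_proper F k X f u v \<noteq> 0}"
      unfolding st(4) using mp[OF st(1,2)] st(3) by simp
  qed
  have 2: "{u \<in> Q. mult_infinity F k X f u \<noteq> 0} = ?\<psi> ` ?B"
    unfolding Q by (auto simp: mult_infinity_eq)
  have inj1: "inj_on ?\<phi> ?A" and inj2: "inj_on ?\<psi> ?B"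
    using e_ne by (auto intro!: inj_onI)
  have s1: "(\<Sum>(u, v) \<in> ?\<phi> ` ?A. mult_proper F k X f u v) = (\<Sum>(s, t)\<in>?A. m s t)"
    by (subst sum.reindex[OF inj1], rule sum.cong) (auto simp: mp)
  have s2: "(\<Sum>u \<in> ?\<psi> ` ?B. mult_infinity F k X f u) = (\<Sum>s\<in>?B. minf s)"
    by (subst sum.reindex[OF inj2], rule sum.cong) (simp_all add: mult_infinity_eq)
  have "b 0 0 = int (betti F k X f u' v')" by (simp add: b_def)
  moreover have "finite ?A" and "finite ?B"
    using sum_multiplicities by argo+
  moreover from this have "finite (?\<phi> ` ?A)" "finite (?\<psi> ` ?B)"
    by (simp_all only: finite_imageI)
  ultimately show ?thesis
    unfolding 1 2 s1 s2
    by (intro conjI) (simp_all only: conjunct2[OF conjunct2[OF sum_multiplicities]])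
qed

end

end

text \<open>The index sets of the sums are infinite. Each sum is therefore taken over the points of
  nonzero multiplicity, and the finiteness of these supports is part of the claim.\<close>

theorem theorem3p13:
  fixes F :: "'k::field itself" and k :: int
    and X :: "'a topology" and f :: "'a \<Rightarrow> real ^ 'n"
    and \<T> :: "'m::euclidean_space set set"
    and u' v' e :: "real ^ 'n"
  assumes "compact_space X"
    and "simplicial_complex \<T>" and "X homeomorphic_space top_of_set (\<Union>\<T>)"
    and "continuous_map X euclidean f"
    and "u' \<prec>\<^sub>n v'" and "0 \<prec>\<^sub>n e"
  defines "P \<equiv> {(u, v). u \<le> u' \<and> v' \<prec>\<^sub>n v \<and> u' - u \<in> span {e} \<and> v - v' \<in> span {e}}"
    and "Q \<equiv> {u. u \<le> u' \<and> u' - u \<in> span {e}}"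
  shows "finite {(u, v) \<in> P. mult_proper F k X f u v \<noteq> 0} \<and>
    finite {u \<in> Q. mult_infinity F k X f u \<noteq> 0} \<and>
    int (betti F k X f u' v') =
      (\<Sum>(u, v) \<in> {(u, v) \<in> P. mult_proper F k X f u v \<noteq> 0}. mult_proper F k X f u v) +
      (\<Sum>u \<in> {u \<in> Q. mult_infinity F k X f u \<noteq> 0}. mult_infinity F k X f u)"
proof -
  obtain h where h: "homeomorphic_map X (top_of_set (\<Union>\<T>)) h"
    using assms(3) by (auto simp: homeomorphic_space)
  have fin: "finite \<T>" and simplex: "\<And>C. C \<in> \<T> \<Longrightarrow> \<exists>n. n simplex C"
    using assms(2) by (auto simp: simplicial_complex_def)
  have closed: "closed C" and convex: "convex C" and compact: "compact C" if "C \<in> \<T>" for C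
    using simplex[OF that] compact_simplex convex_simplex closed_simplex by blast+
  have cpt: "compact (\<Union>\<T>)" using fin compact by (rule compact_Union)
  \<comment> \<open>The polyhedron is a finite union of closed convex sets, hence an absolute
    neighbourhood retract; compactness makes it a Euclidean one.\<close>
  have "ANR (\<Union>\<T>)" by (rule ANR_finite_Union_convex_closed[OF fin closed convex])
  then have "ENR (\<Union>\<T>)"
    using cpt by (simp add: ENR_ANR compact_imp_closed closed_imp_locally_compact)
  with h cpt assms(4) interpret filtered_space X h "\<Union>\<T>" f
    by unfold_locales
  show ?thesis
    unfolding P_def Q_def by (rule betti_eq_sum_multiplicities[OF assms(5,6,1)])
qed

end
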